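(* Let $M$ be an arbitrary connected manifold and let $g\in\mathrm{Homeo}(M)$. Then there is an $L_{\omega_1\omega}$ formula $\psi_g(x)$ in the language of group theory (without parameters) such that for all $h\in\mathrm{Homeo}(M)$, we have $\mathrm{Homeo}(M)\models\psi_g(h)$ if and only if $h$ is conjugate to $g$ in $\mathrm{Homeo}(M)$.
   Context: Conventions: a manifold is a connected, second countable, Hausdorff topological manifold of positive finite dimension with empty boundary, not necessarily compact. $\mathrm{Homeo}(M)$ is the group of all homeomorphisms of $M$, viewed as a structure in the language of group theory (binary multiplication and identity). $L_{\omega_1\omega}$ formulae are built from the usual atomic formulae by negation, quantification over single variables, and countable conjunctions and disjunctions. The result is a theorem of ZFC. *)

theory Defs
  imports "HOL-Analysis.Analysis" "HOL-Algebra.Bij"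
begin

section \<open>Connected manifolds\<close>

definition second_countable_space :: "'a topology \<Rightarrow> bool" where
  "second_countable_space X \<longleftrightarrow>
     (\<exists>B. countable B \<and> (\<forall>V\<in>B. openin X V) \<and>
          (\<forall>U x. openin X U \<and> x \<in> U \<longrightarrow> (\<exists>V\<in>B. x \<in> V \<and> V \<subseteq> U)))"

text \<open>Charts are onto open subsets of the whole of \<open>Euclidean_space n\<close>, not of a half-space:
  the boundary is empty.\<close>

definition locally_Euclidean_space :: "nat \<Rightarrow> 'a topology \<Rightarrow> bool" where
  "locally_Euclidean_space n X \<longleftrightarrow>
     (\<forall>x\<in>topspace X. \<exists>U V. openin X U \<and> x \<in> U \<and> openin (Euclidean_space n) V \<and>
        subtopology X U homeomorphic_space subtopology (Euclidean_space n) V)"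

definition connected_manifold :: "'a topology \<Rightarrow> bool" where
  "connected_manifold M \<longleftrightarrow>
     connected_space M \<and> second_countable_space M \<and> Hausdorff_space M \<and>
     (\<exists>n>0. locally_Euclidean_space n M)"

section \<open>The homeomorphism group\<close>

text \<open>As in \<^const>\<open>BijGroup\<close>, homeomorphisms are represented by extensional functions, so that
  a homeomorphism is determined by its values on the underlying space.\<close>

definition Homeo :: "'a topology \<Rightarrow> ('a \<Rightarrow> 'a) monoid" where
  "Homeo M =
     \<lparr>carrier = {f \<in> extensional (topspace M). homeomorphic_map M M f},
      mult = compose (topspace M),
      one = (\<lambda>x\<in>topspace M. x)\<rparr>"

lemma group_Homeo: "group (Homeo M)"
proof (rule groupI)
  have funcset: "f \<in> topspace M \<rightarrow> topspace M" if "homeomorphic_map M M f" for f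
    using that homeomorphic_imp_surjective_map by fastforce
  show "x \<otimes>\<^bsub>Homeo M\<^esub> y \<in> carrier (Homeo M)"
    if "x \<in> carrier (Homeo M)" "y \<in> carrier (Homeo M)" for x y
  proof -
    have "homeomorphic_map M M (x \<circ> y)"
      using that by (auto simp: Homeo_def intro: homeomorphic_map_compose)
    then have "homeomorphic_map M M (compose (topspace M) x y)"
      by (rule homeomorphic_map_eq) (simp add: compose_def)
    then show ?thesis
      by (simp add: Homeo_def)
  qed
  have "homeomorphic_map M M (\<lambda>x\<in>topspace M. x)"
    by (rule homeomorphic_map_eq[of _ _ id]) auto
  then show "\<one>\<^bsub>Homeo M\<^esub> \<in> carrier (Homeo M)"
    by (simp add: Homeo_def)
  show "x \<otimes>\<^bsub>Homeo M\<^esub> y \<otimes>\<^bsub>Homeo M\<^esub> z = x \<otimes>\<^bsub>Homeo M\<^esub> (y \<otimes>\<^bsub>Homeo M\<^esub> z)"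
    if "x \<in> carrier (Homeo M)" "y \<in> carrier (Homeo M)" "z \<in> carrier (Homeo M)" for x y z
    using that funcset[of z] by (auto simp: Homeo_def compose_def fun_eq_iff)
  show "\<one>\<^bsub>Homeo M\<^esub> \<otimes>\<^bsub>Homeo M\<^esub> x = x" if "x \<in> carrier (Homeo M)" for x
    using that funcset[of x] by (auto simp: Homeo_def Id_compose)
  show "\<exists>y\<in>carrier (Homeo M). y \<otimes>\<^bsub>Homeo M\<^esub> x = \<one>\<^bsub>Homeo M\<^esub>"
    if x: "x \<in> carrier (Homeo M)" for x
  proof -
    obtain y where y: "homeomorphic_maps M M x y"
      using x by (auto simp: Homeo_def homeomorphic_map_maps)
    have "homeomorphic_map M M y"
      using y homeomorphic_maps_sym homeomorphic_map_maps by blast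
    then have "homeomorphic_map M M (restrict y (topspace M))"
      by (rule homeomorphic_map_eq) simp
    moreover have "compose (topspace M) (restrict y (topspace M)) x = (\<lambda>x\<in>topspace M. x)"
      using y x funcset[of x] by (auto simp: Homeo_def homeomorphic_maps_def compose_def fun_eq_iff)
    ultimately show ?thesis
      by (intro bexI[of _ "restrict y (topspace M)"]) (auto simp: Homeo_def)
  qed
qed

definition conjugate_in :: "('g, 'b) monoid_scheme \<Rightarrow> 'g \<Rightarrow> 'g \<Rightarrow> bool" where
  "conjugate_in G h g \<longleftrightarrow> (\<exists>k\<in>carrier G. h = k \<otimes>\<^bsub>G\<^esub> g \<otimes>\<^bsub>G\<^esub> inv\<^bsub>G\<^esub> k)"

section \<open>\<open>L\<^sub>\<omega>\<^sub>1\<^sub>\<omega>\<close> in the language of group theory\<close>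

datatype gterm =
    Var nat
  | One
  | Mult gterm gterm

text \<open>Countable families of formulae are indexed by \<^typ>\<open>nat\<close>; nonempty finite conjunctions and
  disjunctions arise by repetition.\<close>

datatype gformula =
    Eq gterm gterm
  | Neg gformula
  | Conj "nat \<Rightarrow> gformula"
  | Disj "nat \<Rightarrow> gformula"
  | All nat gformula
  | Ex nat gformula

primrec tvars :: "gterm \<Rightarrow> nat set" where
  "tvars (Var i) = {i}"
| "tvars One = {}"
| "tvars (Mult s t) = tvars s \<union> tvars t"

primrec fvars :: "gformula \<Rightarrow> nat set" where
  "fvars (Eq s t) = tvars s \<union> tvars t"
| "fvars (Neg \<phi>) = fvars \<phi>"
| "fvars (Conj \<Phi>) = (\<Union>k. fvars (\<Phi> k))"
| "fvars (Disj \<Phi>) = (\<Union>k. fvars (\<Phi> k))"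
| "fvars (All i \<phi>) = fvars \<phi> - {i}"
| "fvars (Ex i \<phi>) = fvars \<phi> - {i}"

primrec tval :: "('g, 'b) monoid_scheme \<Rightarrow> (nat \<Rightarrow> 'g) \<Rightarrow> gterm \<Rightarrow> 'g" where
  "tval G v (Var i) = v i"
| "tval G v One = \<one>\<^bsub>G\<^esub>"
| "tval G v (Mult s t) = tval G v s \<otimes>\<^bsub>G\<^esub> tval G v t"

primrec sat :: "('g, 'b) monoid_scheme \<Rightarrow> gformula \<Rightarrow> (nat \<Rightarrow> 'g) \<Rightarrow> bool" where
  "sat G (Eq s t) v \<longleftrightarrow> tval G v s = tval G v t"
| "sat G (Neg \<phi>) v \<longleftrightarrow> \<not> sat G \<phi> v"
| "sat G (Conj \<Phi>) v \<longleftrightarrow> (\<forall>k. sat G (\<Phi> k) v)"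
| "sat G (Disj \<Phi>) v \<longleftrightarrow> (\<exists>k. sat G (\<Phi> k) v)"
| "sat G (All i \<phi>) v \<longleftrightarrow> (\<forall>a\<in>carrier G. sat G \<phi> (v(i := a)))"
| "sat G (Ex i \<phi>) v \<longleftrightarrow> (\<exists>a\<in>carrier G. sat G \<phi> (v(i := a)))"

text \<open>The free variable \<open>x\<close> of a formula \<open>\<psi>(x)\<close> is variable \<open>0\<close>. When \<open>fvars \<psi> \<subseteq> {0}\<close> the values
  that the assignment below gives to the other variables are irrelevant.\<close>

definition sat1 :: "('g, 'b) monoid_scheme \<Rightarrow> gformula \<Rightarrow> 'g \<Rightarrow> bool" where
  "sat1 G \<psi> h \<longleftrightarrow> sat G \<psi> (\<lambda>_. h)"

end

theory Submission
  imports Defs "HOL-Library.Countable" "HOL-Algebra.Generated_Groups"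
begin

text \<open>
  A homeomorphism of the manifold \<open>M\<close> is coded, up to conjugacy, by countably many relations between
  regular open sets, each of which is the interior of the closure of the support of some group element.
  Inclusion of these sets is definable in the group (Rubin), and so is a relation that implies compact
  containment: the support of \<open>a\<close> can be squeezed into every small set by homeomorphisms supported in
  a fixed set. A dense null family of disjoint ball charts, on which affine maps of all the balls act
  simultaneously, gives finitely many homeomorphisms generating a group with nontrivial elements supported
  in every given nonempty open set. A regular open set is then determined by the set of words in
  these generators whose support lies below it, and this is a countable conjunction. Existentially
  quantifying the generators, the formula says that the coded sets form a basis with the same diagram as
  a reference basis of \<open>M\<close>, including the action of the given homeomorphism. Two bases with the same
  diagram are matched by a homeomorphism of \<open>M\<close>, which conjugates one action to the other.
\<close>

section \<open>Definable predicates\<close>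

text \<open>A formula quantifies one element at a time, and only finitely often along each branch of
  its syntax tree. A countable basis therefore cannot be guessed as a sequence; finitely many
  elements are guessed, and the countably many words in them serve as names. Data about
  \<open>g\<close> and the reference basis enter the formula only as truth values, so no parameters
  remain.

  As \<open>M\<close> may be noncompact, a consistent family of basic sets need not close in on a
  point: it may run off to infinity. This is what compact containment rules out, and it has to be
  expressed by conjugation and inclusion alone.

  An element that acts by one formula in infinitely many balls is never small. Commutators repair
  this: two such elements are displaced against each other until they interact in a single ball
  only, and their commutator lives in that ball.

  Both bases live on the same \<open>M\<close>, so matching them produces an element of the group
  itself. In the other direction the formula has to be verified at \<open>g\<close> only, because
  satisfaction is invariant under inner automorphisms.\<close>

text \<open>The variables below \<open>n\<close> may occur free in a predicate of context \<open>n\<close>; a quantifier in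
  context \<open>n\<close> binds variable \<open>n\<close>.\<close>

definition definable :: "('g, 'b) monoid_scheme \<Rightarrow> nat \<Rightarrow> ((nat \<Rightarrow> 'g) \<Rightarrow> bool) \<Rightarrow> bool" where
  "definable G n P \<longleftrightarrow>
     (\<exists>\<phi>. fvars \<phi> \<subseteq> {..<n} \<and> (\<forall>v. (\<forall>i. v i \<in> carrier G) \<longrightarrow> sat G \<phi> v = P v))"

definition term_elt :: "('g, 'b) monoid_scheme \<Rightarrow> nat \<Rightarrow> ((nat \<Rightarrow> 'g) \<Rightarrow> 'g) \<Rightarrow> bool" where
  "term_elt G n s \<longleftrightarrow> (\<exists>t. tvars t \<subseteq> {..<n} \<and> (\<forall>v. tval G v t = s v))"

text \<open>Words in the generators are terms, so a conjunction over all words is a countable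
  one.\<close>

instance gterm :: countable
  by countable_datatype

lemma tval_cong: "(\<And>i. i \<in> tvars t \<Longrightarrow> v i = w i) \<Longrightarrow> tval G v t = tval G w t"
  by (induction t) auto

lemma (in group) tval_closed:
  assumes "\<And>i. i \<in> tvars t \<Longrightarrow> v i \<in> carrier G"
  shows "tval G v t \<in> carrier G"
  using assms by (induction t) auto

lemma term_elt_tval: "tvars t \<subseteq> {..<n} \<Longrightarrow> term_elt G n (\<lambda>v. tval G v t)"
  unfolding term_elt_def by blast

lemma term_elt_var: "i < n \<Longrightarrow> term_elt G n (\<lambda>v. v i)"
  using term_elt_tval[of "Var i" n G] by simp

lemma term_elt_one: "term_elt G n (\<lambda>v. \<one>\<^bsub>G\<^esub>)"
  using term_elt_tval[of One n G] by simp

lemma term_elt_mult: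
  assumes "term_elt G n s" "term_elt G n t"
  shows "term_elt G n (\<lambda>v. s v \<otimes>\<^bsub>G\<^esub> t v)"
proof -
  obtain s' t' where "tvars s' \<subseteq> {..<n}" "\<forall>v. tval G v s' = s v" "tvars t' \<subseteq> {..<n}" "\<forall>v. tval G v t' = t v"
    using assms unfolding term_elt_def by metis
  then show ?thesis
    using term_elt_tval[of "Mult s' t'" n G] by simp
qed

lemma term_elt_mono: "term_elt G n s \<Longrightarrow> n \<le> m \<Longrightarrow> term_elt G m s"
  unfolding term_elt_def by (meson lessThan_subset_iff order_trans)

lemma term_elt_upd: "term_elt G n s \<Longrightarrow> s (v(n := a)) = s v"
proof -
  assume "term_elt G n s"
  then obtain t where t: "tvars t \<subseteq> {..<n}" "\<forall>v. tval G v t = s v"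
    unfolding term_elt_def by blast
  have "tval G (v(n := a)) t = tval G v t"
    by (rule tval_cong) (use t(1) in auto)
  with t(2) show ?thesis
    by simp
qed

lemma definable_eq:
  assumes "term_elt G n s" "term_elt G n t"
  shows "definable G n (\<lambda>v. s v = t v)"
proof -
  obtain s' t' where "tvars s' \<subseteq> {..<n}" "\<forall>v. tval G v s' = s v" "tvars t' \<subseteq> {..<n}" "\<forall>v. tval G v t' = t v"
    using assms unfolding term_elt_def by metis
  then show ?thesis
    unfolding definable_def by (intro exI[of _ "Eq s' t'"]) auto
qed

lemma definable_not:
  assumes "definable G n P"
  shows "definable G n (\<lambda>v. \<not> P v)"
proof -
  obtain \<phi> where "fvars \<phi> \<subseteq> {..<n}" "\<And>v. (\<forall>i. v i \<in> carrier G) \<Longrightarrow> sat G \<phi> v = P v"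
    using assms unfolding definable_def by metis
  then show ?thesis
    unfolding definable_def by (intro exI[of _ "Neg \<phi>"]) auto
qed

lemma definable_all_nat:
  assumes "\<And>k :: nat. definable G n (P k)"
  shows "definable G n (\<lambda>v. \<forall>k. P k v)"
proof -
  obtain \<Phi> where "\<And>k. fvars (\<Phi> k) \<subseteq> {..<n}" "\<And>k v. (\<forall>i. v i \<in> carrier G) \<Longrightarrow> sat G (\<Phi> k) v = P k v"
    using assms unfolding definable_def by metis
  then show ?thesis
    unfolding definable_def by (intro exI[of _ "Conj \<Phi>"]) auto
qed

lemma definable_ex_nat:
  assumes "\<And>k :: nat. definable G n (P k)"
  shows "definable G n (\<lambda>v. \<exists>k. P k v)"
  using definable_not[OF definable_all_nat[OF definable_not[OF assms]]] by simp

lemma definable_all_countable: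
  fixes P :: "'i::countable \<Rightarrow> _"
  assumes "\<And>k. definable G n (P k)"
  shows "definable G n (\<lambda>v. \<forall>k. P k v)"
proof -
  have "(\<forall>k. P k v) \<longleftrightarrow> (\<forall>k. P (from_nat k) v)" for v
    by (metis from_nat_to_nat)
  with definable_all_nat[OF assms, of from_nat] show ?thesis
    by simp
qed

lemma definable_conj:
  assumes "definable G n P" "definable G n Q"
  shows "definable G n (\<lambda>v. P v \<and> Q v)"
proof -
  have "definable G n (\<lambda>v. \<forall>k. (if k = (0::nat) then P v else Q v))"
  proof (rule definable_all_nat)
    show "definable G n (\<lambda>v. if k = (0::nat) then P v else Q v)" for k
      using assms by (cases "k = 0") simp_all
  qed
  moreover have "(\<lambda>v. \<forall>k. (if k = (0::nat) then P v else Q v)) = (\<lambda>v. P v \<and> Q v)"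
    by (auto simp: fun_eq_iff intro: one_neq_zero)
  ultimately show ?thesis
    by simp
qed

lemma definable_imp:
  assumes "definable G n P" "definable G n Q"
  shows "definable G n (\<lambda>v. P v \<longrightarrow> Q v)"
  using definable_not[OF definable_conj[OF assms(1) definable_not[OF assms(2)]]] by simp

lemma definable_const: "definable G n (\<lambda>v. b)"
proof -
  have "definable G n (\<lambda>v. \<one>\<^bsub>G\<^esub> = \<one>\<^bsub>G\<^esub>)"
    by (intro definable_eq term_elt_one)
  then show ?thesis
    using definable_not[of G n "\<lambda>v. True"] by (cases b) simp_all
qed

lemma definable_iff_const:
  assumes "definable G n P"
  shows "definable G n (\<lambda>v. P v \<longleftrightarrow> b)"
  using assms definable_not[OF assms] by (cases b) simp_all

text \<open>\<open>P\<close> receives the bound value apart from the assignment, so overwriting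
  position \<open>n\<close> is harmless once \<open>P a\<close> ignores that position. In this shape
  \<open>intro\<close> can peel the quantifiers off a definition while the context counts the bound
  variables.\<close>

lemma definable_ex:
  assumes "definable G (Suc n) (\<lambda>v. P (v n) v)" "\<And>a b v. P a (v(n := b)) = P a v"
  shows "definable G n (\<lambda>v. \<exists>a\<in>carrier G. P a v)"
proof -
  obtain \<phi> where \<phi>: "fvars \<phi> \<subseteq> {..<Suc n}" "\<And>v. (\<forall>i. v i \<in> carrier G) \<Longrightarrow> sat G \<phi> v = P (v n) v"
    using assms unfolding definable_def by metis
  have "fvars (Ex n \<phi>) \<subseteq> {..<n}"
    using \<phi>(1) by auto
  moreover have "sat G (Ex n \<phi>) v \<longleftrightarrow> (\<exists>a\<in>carrier G. P a v)" if "\<forall>i. v i \<in> carrier G" for v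
    using that assms(2) by (auto simp: \<phi>(2))
  ultimately show ?thesis
    unfolding definable_def by blast
qed

lemma definable_all:
  assumes "definable G (Suc n) (\<lambda>v. P (v n) v)" "\<And>a b v. P a (v(n := b)) = P a v"
  shows "definable G n (\<lambda>v. \<forall>a\<in>carrier G. P a v)"
  using definable_not[OF definable_ex[of G n "\<lambda>a v. \<not> P a v"]] definable_not[OF assms(1)] assms(2)
  by simp

text \<open>The number of generators is not a numeral, so their quantifiers are added by induction
  on \<open>k\<close>. The witness \<open>w\<close> is a whole assignment, tied to \<open>v\<close>
  on the first \<open>n\<close> variables only.\<close>

lemma definable_ex_tuple:
  assumes "definable G (n + k) P"
  shows "definable G n (\<lambda>v. \<exists>w. (\<forall>i. w i \<in> carrier G) \<and> (\<forall>i<n. w i = v i) \<and> P w)"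
  using assms
proof (induction k arbitrary: P)
  case 0
  then obtain \<phi> where \<phi>: "fvars \<phi> \<subseteq> {..<n}" "\<And>v. (\<forall>i. v i \<in> carrier G) \<Longrightarrow> sat G \<phi> v = P v"
    unfolding definable_def by auto
  \<comment> \<open>Even with no quantifier to add, \<open>w\<close> and \<open>v\<close> may differ
    from position \<open>n\<close> on, so satisfaction must be shown to depend on the free variables
    alone.\<close>
  have cong: "sat G \<psi> v = sat G \<psi> w" if "\<forall>i\<in>fvars \<psi>. v i = w i" for \<psi> v w
    using that
  proof (induction \<psi> arbitrary: v w)
    case (Eq s t)
    then show ?case by (auto intro!: arg_cong2[of _ _ _ _ "(=)"] tval_cong)
  next
    case (Neg \<psi>)
    then show ?case by (metis fvars.simps(2) sat.simps(2))
  next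
    case (Conj \<Psi>)
    then have "sat G (\<Psi> k) v = sat G (\<Psi> k) w" for k
      by auto
    then show ?case by simp
  next
    case (Disj \<Psi>)
    then have "sat G (\<Psi> k) v = sat G (\<Psi> k) w" for k
      by auto
    then show ?case by simp
  next
    case (All i \<psi>)
    then have "sat G \<psi> (v(i := a)) = sat G \<psi> (w(i := a))" for a
      by (intro All.IH) auto
    then show ?case by simp
  next
    case (Ex i \<psi>)
    then have "sat G \<psi> (v(i := a)) = sat G \<psi> (w(i := a))" for a
      by (intro Ex.IH) auto
    then show ?case by simp
  qed
  have "sat G \<phi> v \<longleftrightarrow> (\<exists>w. (\<forall>i. w i \<in> carrier G) \<and> (\<forall>i<n. w i = v i) \<and> P w)"
    if "\<forall>i. v i \<in> carrier G" for v
    using that \<phi> cong[of \<phi>] by (metis lessThan_iff subsetD)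
  then show ?case
    unfolding definable_def using \<phi>(1) by blast
next
  case (Suc k)
  obtain \<phi> where \<phi>: "fvars \<phi> \<subseteq> {..<Suc (n + k)}" "\<And>v. (\<forall>i. v i \<in> carrier G) \<Longrightarrow> sat G \<phi> v = P v"
    using Suc.prems unfolding definable_def by auto
  have "definable G (n + k) (\<lambda>v. \<exists>a\<in>carrier G. P (v(n + k := a)))"
    unfolding definable_def
  proof (intro exI[of _ "Ex (n + k) \<phi>"] conjI allI impI)
    show "fvars (Ex (n + k) \<phi>) \<subseteq> {..<n + k}"
      using \<phi>(1) by auto
  qed (simp add: \<phi>(2))
  from Suc.IH[OF this] have "definable G n (\<lambda>v. \<exists>w. (\<forall>i. w i \<in> carrier G) \<and> (\<forall>i<n. w i = v i) \<and>
      (\<exists>a\<in>carrier G. P (w(n + k := a))))" .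
  moreover have "(\<exists>w. (\<forall>i. w i \<in> carrier G) \<and> (\<forall>i<n. w i = v i) \<and> (\<exists>a\<in>carrier G. P (w(n + k := a))))
      \<longleftrightarrow> (\<exists>w. (\<forall>i. w i \<in> carrier G) \<and> (\<forall>i<n. w i = v i) \<and> P w)" (is "?L \<longleftrightarrow> ?R") for v
  proof
    assume ?L
    then obtain w a where "\<forall>i. w i \<in> carrier G" "\<forall>i<n. w i = v i" "a \<in> carrier G" "P (w(n + k := a))"
      by blast
    then show ?R
      by (intro exI[of _ "w(n + k := a)"]) auto
  next
    assume ?R
    then show ?L
      by (metis fun_upd_triv)
  qed
  ultimately show ?case
    by simp
qed

text \<open>Applied to inner automorphisms, this carries truth at \<open>g\<close> over to every
  conjugate of \<open>g\<close>. Injectivity of \<open>\<sigma>\<close> handles equations,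
  surjectivity handles quantifiers.\<close>

lemma sat_automorphism:
  assumes "group G" "\<sigma> \<in> hom G G" "bij_betw \<sigma> (carrier G) (carrier G)"
    and "\<forall>i. v i \<in> carrier G"
  shows "sat G \<phi> (\<lambda>i. \<sigma> (v i)) = sat G \<phi> v"
  using assms(4)
proof (induction \<phi> arbitrary: v)
  interpret group G by fact
  interpret group_hom G G \<sigma>
    using assms by unfold_locales
  have tval: "tval G (\<lambda>i. \<sigma> (v i)) t = \<sigma> (tval G v t)" if "\<forall>i. v i \<in> carrier G" for v t
    using that by (induction t) (auto simp: tval_closed)
  {
    case (Eq s t)
    then show ?case
      using tval inj_on_eq_iff[OF bij_betw_imp_inj_on[OF assms(3)]] by (simp add: tval_closed)
  }
  have upd: "(\<lambda>i. \<sigma> (v i))(i := \<sigma> a) = (\<lambda>j. \<sigma> ((v(i := a)) j))" for v a i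
    by auto
  have surj: "carrier G = \<sigma> ` carrier G"
    using assms(3) by (simp add: bij_betw_def)
  {
    case (All i \<phi>)
    then have "sat G \<phi> ((\<lambda>i. \<sigma> (v i))(i := \<sigma> a)) = sat G \<phi> (v(i := a))" if "a \<in> carrier G" for a
      using that unfolding upd by (intro All.IH) auto
    moreover have "sat G (All i \<phi>) (\<lambda>i. \<sigma> (v i)) \<longleftrightarrow> (\<forall>a\<in>carrier G. sat G \<phi> ((\<lambda>i. \<sigma> (v i))(i := \<sigma> a)))"
      by (subst sat.simps, subst surj) blast
    ultimately show ?case
      by simp
  }
  {
    case (Ex i \<phi>)
    then have "sat G \<phi> ((\<lambda>i. \<sigma> (v i))(i := \<sigma> a)) = sat G \<phi> (v(i := a))" if "a \<in> carrier G" for a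
      using that unfolding upd by (intro Ex.IH) auto
    moreover have "sat G (Ex i \<phi>) (\<lambda>i. \<sigma> (v i)) \<longleftrightarrow> (\<exists>a\<in>carrier G. sat G \<phi> ((\<lambda>i. \<sigma> (v i))(i := \<sigma> a)))"
      by (subst sat.simps, subst surj) blast
    ultimately show ?case
      by simp
  }
qed auto

section \<open>Supports\<close>

definition supp :: "'a topology \<Rightarrow> ('a \<Rightarrow> 'a) \<Rightarrow> 'a set" where
  "supp M f = {x \<in> topspace M. f x \<noteq> x}"

lemma supp_subset: "supp M f \<subseteq> topspace M"
  by (auto simp: supp_def)

locale homeo_space =
  fixes M :: "'a topology" and G :: "('a \<Rightarrow> 'a) monoid" (structure)
  defines G: "G \<equiv> Homeo M"
  assumes Hausdorff: "Hausdorff_space M"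
begin

sublocale group G
  unfolding G by (rule group_Homeo)

lemma carrier_iff: "f \<in> carrier G \<longleftrightarrow> f \<in> extensional (topspace M) \<and> homeomorphic_map M M f"
  by (simp add: G Homeo_def)

lemma carrier_hmap: "f \<in> carrier G \<Longrightarrow> homeomorphic_map M M f"
  by (simp add: carrier_iff)

lemma app_closed: "f \<in> carrier G \<Longrightarrow> x \<in> topspace M \<Longrightarrow> f x \<in> topspace M"
  using carrier_hmap homeomorphic_imp_surjective_map by fastforce

lemma mult_app: "x \<in> topspace M \<Longrightarrow> (f \<otimes> g) x = f (g x)"
  by (simp add: G Homeo_def compose_def)

lemma one_app: "x \<in> topspace M \<Longrightarrow> \<one> x = x"
  by (simp add: G Homeo_def)

lemma inv_app: "f \<in> carrier G \<Longrightarrow> x \<in> topspace M \<Longrightarrow> (inv f) (f x) = x"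
  by (metis l_inv mult_app one_app)

lemma app_inv: "f \<in> carrier G \<Longrightarrow> x \<in> topspace M \<Longrightarrow> f ((inv f) x) = x"
  by (metis r_inv mult_app one_app)

lemma homeo_eqI:
  assumes "f \<in> carrier G" "g \<in> carrier G" "\<And>x. x \<in> topspace M \<Longrightarrow> f x = g x"
  shows "f = g"
  using assms by (intro extensionalityI[of f "topspace M" g]) (auto simp: carrier_iff)

lemma app_eq_iff:
  "f \<in> carrier G \<Longrightarrow> x \<in> topspace M \<Longrightarrow> y \<in> topspace M \<Longrightarrow> f x = f y \<longleftrightarrow> x = y"
  by (metis inv_app)

lemma openin_image: "f \<in> carrier G \<Longrightarrow> openin M U \<Longrightarrow> openin M (f ` U)"
  by (metis carrier_hmap homeomorphic_imp_open_map open_map_def)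

lemma mem_image_iff:
  assumes "f \<in> carrier G" "U \<subseteq> topspace M"
  shows "y \<in> f ` U \<longleftrightarrow> y \<in> topspace M \<and> (inv f) y \<in> U"
proof
  assume "y \<in> f ` U"
  then obtain x where "x \<in> U" "y = f x"
    by blast
  then show "y \<in> topspace M \<and> (inv f) y \<in> U"
    using assms by (auto simp: app_closed inv_app)
next
  assume "y \<in> topspace M \<and> (inv f) y \<in> U"
  then show "y \<in> f ` U"
    using assms app_inv[of f y] by (metis imageI)
qed

lemma openin_supp: "f \<in> carrier G \<Longrightarrow> openin M (supp M f)"
proof -
  assume f: "f \<in> carrier G"
  have "closedin M {x \<in> topspace M. f x = x}"
    using closedin_continuous_maps_eq[OF Hausdorff, of M f "\<lambda>x. x"] carrier_hmap[OF f]
    by (simp add: homeomorphic_imp_continuous_map)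
  moreover have "topspace M - {x \<in> topspace M. f x = x} = supp M f"
    by (auto simp: supp_def)
  ultimately show ?thesis
    by (metis openin_diff openin_topspace)
qed

lemma supp_empty_iff: "f \<in> carrier G \<Longrightarrow> supp M f = {} \<longleftrightarrow> f = \<one>"
  using homeo_eqI[of f \<one>] by (auto simp: supp_def one_app)

lemma supp_inv:
  assumes f: "f \<in> carrier G"
  shows "supp M (inv f) = supp M f"
proof -
  have "(inv f) x = x \<longleftrightarrow> f x = x" if "x \<in> topspace M" for x
    using f that by (metis app_inv inv_app)
  then show ?thesis
    by (auto simp: supp_def)
qed

lemma supp_mult: "f \<in> carrier G \<Longrightarrow> g \<in> carrier G \<Longrightarrow> supp M (f \<otimes> g) \<subseteq> supp M f \<union> supp M g"
  by (auto simp: supp_def mult_app)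

lemma supp_conj:
  assumes f: "f \<in> carrier G" and g: "g \<in> carrier G"
  shows "supp M (f \<otimes> g \<otimes> inv f) = f ` supp M g"
proof -
  have "y \<in> supp M (f \<otimes> g \<otimes> inv f) \<longleftrightarrow> y \<in> f ` supp M g" for y
  proof (cases "y \<in> topspace M")
    case True
    then have y: "(inv f) y \<in> topspace M"
      using f by (simp add: app_closed)
    have "f (g ((inv f) y)) = f ((inv f) y) \<longleftrightarrow> g ((inv f) y) = (inv f) y"
      by (rule app_eq_iff[OF f]) (use y g in \<open>auto simp: app_closed\<close>)
    then have "f (g ((inv f) y)) = y \<longleftrightarrow> g ((inv f) y) = (inv f) y"
      by (simp add: app_inv f True)
    then show ?thesis
      using True y f g by (simp add: mem_image_iff[OF f supp_subset]) (simp add: supp_def mult_app)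
  next
    case False
    then show ?thesis
      using f by (simp add: mem_image_iff[OF f supp_subset]) (simp add: supp_def)
  qed
  then show ?thesis
    by blast
qed

lemma app_supp: "f \<in> carrier G \<Longrightarrow> x \<in> supp M f \<Longrightarrow> f x \<in> supp M f"
  by (auto simp: supp_def app_closed app_eq_iff)

lemma app_notin_supp: "x \<in> topspace M \<Longrightarrow> x \<notin> supp M f \<Longrightarrow> f x = x"
  by (auto simp: supp_def)

text \<open>A homeomorphism preserves its own support, so where one of the two moves a point, the
  other is the identity both before and after.\<close>

lemma commute_disjoint:
  assumes f: "f \<in> carrier G" and g: "g \<in> carrier G" and d: "supp M f \<inter> supp M g = {}"
  shows "f \<otimes> g = g \<otimes> f"
proof (rule homeo_eqI)
  fix x assume x: "x \<in> topspace M"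
  consider "x \<in> supp M f" | "x \<in> supp M g" | "x \<notin> supp M f" "x \<notin> supp M g"
    by blast
  then have "f (g x) = g (f x)"
  proof cases
    case 1
    then have "x \<notin> supp M g" "f x \<notin> supp M g"
      using d app_supp[OF f 1] by auto
    then show ?thesis
      using x f by (simp add: app_notin_supp app_closed)
  next
    case 2
    then have "x \<notin> supp M f" "g x \<notin> supp M f"
      using d app_supp[OF g 2] by auto
    then show ?thesis
      using x g by (simp add: app_notin_supp app_closed)
  next
    case 3
    then show ?thesis
      using x by (simp add: app_notin_supp)
  qed
  then show "(f \<otimes> g) x = (g \<otimes> f) x"
    using x f g by (simp add: mult_app)
qed (use f g in auto)

lemma separate:
  assumes f: "f \<in> carrier G" and x: "x \<in> supp M f"
  obtains W where "openin M W" "x \<in> W" "f ` W \<inter> W = {}"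
proof -
  have "x \<in> topspace M" "f x \<in> topspace M" "f x \<noteq> x"
    using x f by (auto simp: supp_def app_closed)
  then obtain U V where UV: "openin M U" "openin M V" "x \<in> U" "f x \<in> V" "disjnt U V"
    using Hausdorff unfolding Hausdorff_space_def by metis
  have U: "U \<subseteq> topspace M" and V: "V \<subseteq> topspace M"
    using UV openin_subset by auto
  have "openin M (U \<inter> (inv f) ` V)"
    using UV f by (intro openin_Int openin_image) auto
  moreover have "x \<in> (inv f) ` V"
    using UV(4) \<open>x \<in> topspace M\<close> f by (metis imageI inv_app)
  moreover have "f ` (U \<inter> (inv f) ` V) \<subseteq> V"
    using V f by (auto simp: app_inv)
  ultimately show thesis
    using that[of "U \<inter> (inv f) ` V"] UV(3,5) by (auto simp: disjnt_iff)
qed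

end

section \<open>Recovering supports from the group\<close>

text \<open>Here \<open>c\<close> and \<open>r\<close> are the commutators \<open>[f2, h]\<close> and \<open>[f1, c]\<close>, written without inverses. If \<open>h\<close> has
  small support, that of \<open>r\<close> is covered by four translates of it by elements commuting with \<open>g\<close>, which
  leaves no room for five disjoint \<open>g\<close>-translates; hence the exponent \<open>12 = lcm(1, 2, 3, 4)\<close> below.\<close>

definition alg_disjoint :: "('g, 'b) monoid_scheme \<Rightarrow> 'g \<Rightarrow> 'g \<Rightarrow> bool" where
  "alg_disjoint G f g \<longleftrightarrow>
     (\<forall>h\<in>carrier G. f \<otimes>\<^bsub>G\<^esub> h \<noteq> h \<otimes>\<^bsub>G\<^esub> f \<longrightarrow>
        (\<exists>f1\<in>carrier G. \<exists>f2\<in>carrier G. \<exists>c\<in>carrier G. \<exists>r\<in>carrier G.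
           f1 \<otimes>\<^bsub>G\<^esub> g = g \<otimes>\<^bsub>G\<^esub> f1 \<and> f2 \<otimes>\<^bsub>G\<^esub> g = g \<otimes>\<^bsub>G\<^esub> f2 \<and>
           c \<otimes>\<^bsub>G\<^esub> (h \<otimes>\<^bsub>G\<^esub> f2) = f2 \<otimes>\<^bsub>G\<^esub> h \<and> r \<otimes>\<^bsub>G\<^esub> (c \<otimes>\<^bsub>G\<^esub> f1) = f1 \<otimes>\<^bsub>G\<^esub> c \<and>
           r \<noteq> \<one>\<^bsub>G\<^esub> \<and> r \<otimes>\<^bsub>G\<^esub> g = g \<otimes>\<^bsub>G\<^esub> r))"

text \<open>\<open>alg_disjoint\<close> controls only the twelfth power of \<open>g\<close>, hence
  the powers here. Such powers still move every point outside the closure of the support of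
  \<open>f\<close> for a suitable \<open>g\<close>, so commuting with all of them confines the
  support of \<open>k\<close> to that closure.\<close>

definition alg_below :: "('g, 'b) monoid_scheme \<Rightarrow> 'g \<Rightarrow> 'g \<Rightarrow> bool" where
  "alg_below G k f \<longleftrightarrow>
     (\<forall>g\<in>carrier G. alg_disjoint G f g \<longrightarrow>
        k \<otimes>\<^bsub>G\<^esub> g [^]\<^bsub>G\<^esub> (12::nat) = g [^]\<^bsub>G\<^esub> (12::nat) \<otimes>\<^bsub>G\<^esub> k)"

text \<open>All positive powers must move \<open>x\<close>, because only twelfth powers can be
  compared algebraically: a \<open>g\<close> whose twelfth power fixes \<open>x\<close> would detect
  nothing there.\<close>

locale locally_moving = homeo_space +
  assumes moving: "openin M W \<Longrightarrow> x \<in> W \<Longrightarrow>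
    \<exists>f\<in>carrier G. supp M f \<subseteq> W \<and> (\<forall>j::nat. j > 0 \<longrightarrow> (f [^] j) x \<noteq> x)"
begin

lemma moving1:
  assumes "openin M W" "x \<in> W"
  obtains f where "f \<in> carrier G" "supp M f \<subseteq> W" "x \<in> supp M f"
proof -
  obtain f where f: "f \<in> carrier G" "supp M f \<subseteq> W" "\<forall>j::nat. j > 0 \<longrightarrow> (f [^] j) x \<noteq> x"
    using moving[OF assms] by blast
  have "f x \<noteq> x"
    using f(1) f(3)[rule_format, of "Suc 0"] by simp
  moreover have "x \<in> topspace M"
    using assms openin_subset by auto
  ultimately show thesis
    using that f(1,2) by (auto simp: supp_def)
qed

text \<open>A point moved by both \<open>f\<close> and \<open>h\<close> has a neighbourhood
  \<open>W\<close> inside \<open>supp M f\<close> that \<open>h\<close> moves off itself. For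
  \<open>f1\<close>, \<open>f2\<close> supported in \<open>W\<close>, the commutator
  \<open>[f2, h]\<close> acts on \<open>W\<close> as \<open>f2\<close>, so
  \<open>[f1, [f2, h]]\<close> equals \<open>[f1, f2]\<close>. Everything supported in
  \<open>W\<close> commutes with \<open>g\<close>, and \<open>f2\<close> is chosen so small that it
  does not commute with \<open>f1\<close>.\<close>

lemma alg_disjoint_if_disjoint:
  assumes f: "f \<in> carrier G" and g: "g \<in> carrier G" and d: "supp M f \<inter> supp M g = {}"
  shows "alg_disjoint G f g"
  unfolding alg_disjoint_def
proof (intro ballI impI)
  fix h assume h: "h \<in> carrier G" and fh: "f \<otimes> h \<noteq> h \<otimes> f"
  have "supp M f \<inter> supp M h \<noteq> {}"
    using commute_disjoint[OF f h] fh by blast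
  then obtain y where y: "y \<in> supp M f" "y \<in> supp M h"
    by blast
  obtain W0 where W0: "openin M W0" "y \<in> W0" "h ` W0 \<inter> W0 = {}"
    using separate[OF h y(2)] .
  define W where "W = W0 \<inter> supp M f"
  have W: "openin M W" "y \<in> W" "h ` W \<inter> W = {}" "W \<subseteq> supp M f"
    using W0 y openin_supp[OF f] by (auto simp: W_def)
  have yM: "y \<in> topspace M"
    using y by (auto simp: supp_def)
  obtain f1 where f1: "f1 \<in> carrier G" "supp M f1 \<subseteq> W" "y \<in> supp M f1"
    using moving1[OF W(1,2)] .
  obtain W1 where W1: "openin M W1" "y \<in> W1" "f1 ` W1 \<inter> W1 = {}"
    using separate[OF f1(1,3)] .
  obtain f2 where f2: "f2 \<in> carrier G" "supp M f2 \<subseteq> W \<inter> W1" "y \<in> supp M f2"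
    using moving1[of "W \<inter> W1" y] W W1 by blast
  \<comment> \<open>The second half of \<open>[f2, h]\<close>; it lives on the image of
    \<open>W\<close> under \<open>h\<close>, hence off \<open>W\<close>.\<close>
  define d' where "d' = h \<otimes> inv f2 \<otimes> inv h"
  have d': "d' \<in> carrier G" "supp M d' \<inter> W = {}"
    using h f2 W(3) by (auto simp: d'_def supp_conj supp_inv)
  define c where "c = f2 \<otimes> d'"
  define r where "r = f1 \<otimes> c \<otimes> inv f1 \<otimes> inv c"
  have c: "c \<in> carrier G" and r: "r \<in> carrier G"
    using f1 f2 d' by (auto simp: c_def r_def)
  have cancel: "inv a \<otimes> (a \<otimes> b) = b" if "a \<in> carrier G" "b \<in> carrier G" for a b
    using that by (simp flip: m_assoc)
  have eq1: "c \<otimes> (h \<otimes> f2) = f2 \<otimes> h"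
    using h f2 by (simp add: c_def d'_def m_assoc cancel)
  have eq2: "r \<otimes> (c \<otimes> f1) = f1 \<otimes> c"
    using c f1 by (simp add: r_def m_assoc cancel)
  have comm: "d' \<otimes> inv f1 = inv f1 \<otimes> d'"
    using f1 d' by (intro commute_disjoint) (auto simp: supp_inv)
  have "r = f1 \<otimes> (f2 \<otimes> ((d' \<otimes> inv f1) \<otimes> (inv d' \<otimes> inv f2)))"
    using f1 f2 d' by (simp add: r_def c_def m_assoc inv_mult_group)
  also have "\<dots> = f1 \<otimes> (f2 \<otimes> (inv f1 \<otimes> ((d' \<otimes> inv d') \<otimes> inv f2)))"
    using f1 f2 d'(1) unfolding comm by (simp only: m_assoc inv_closed m_closed)
  also have "\<dots> = f1 \<otimes> (f2 \<otimes> (inv f1 \<otimes> inv f2))"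
    using f1 f2 d' by simp
  finally have "supp M r \<subseteq> W"
    using f1 f2 supp_mult[of f1 "f2 \<otimes> (inv f1 \<otimes> inv f2)"] supp_mult[of f2 "inv f1 \<otimes> inv f2"]
      supp_mult[of "inv f1" "inv f2"] unfolding supp_inv[OF f1(1)] supp_inv[OF f2(1)] by (simp, blast)
  then have rg: "r \<otimes> g = g \<otimes> r"
    using r g d W by (intro commute_disjoint) auto
  \<comment> \<open>Evaluate \<open>c f1 = f1 c\<close> at \<open>y\<close>. The point
    \<open>f1 y\<close> lies in \<open>W\<close> but outside \<open>supp M f2\<close>, and
    \<open>d'\<close> is the identity on \<open>W\<close>, so the equation becomes
    \<open>f1 y = f1 (f2 y)\<close>, although \<open>f2\<close> moves \<open>y\<close>.\<close>
  have "r \<noteq> \<one>"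
  proof
    assume "r = \<one>"
    then have "(c \<otimes> f1) y = (f1 \<otimes> c) y"
      using eq2 c f1 by auto
    moreover have "f1 y \<in> supp M f1"
      using f1 app_supp by blast
    then have "f1 y \<in> W" "f1 y \<notin> supp M f2"
      using f1(2) f2(2) W1 by auto
    moreover have "d' x = x" if "x \<in> W" for x
      using that d'(2) openin_subset[OF W(1)] by (intro app_notin_supp) auto
    ultimately have "f1 y = f1 (f2 y)"
      using yM W(2) f1 f2 d' c by (auto simp: mult_app c_def app_closed app_notin_supp)
    then show False
      using f1 f2 yM by (auto simp: app_eq_iff app_closed supp_def)
  qed
  moreover have "f1 \<otimes> g = g \<otimes> f1" "f2 \<otimes> g = g \<otimes> f2"
    using f1 f2 g d W(4) by (intro commute_disjoint; auto)+
  ultimately show "\<exists>f1\<in>carrier G. \<exists>f2\<in>carrier G. \<exists>c\<in>carrier G. \<exists>r\<in>carrier G.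
      f1 \<otimes> g = g \<otimes> f1 \<and> f2 \<otimes> g = g \<otimes> f2 \<and> c \<otimes> (h \<otimes> f2) = f2 \<otimes> h \<and> r \<otimes> (c \<otimes> f1) = f1 \<otimes> c \<and>
      r \<noteq> \<one> \<and> r \<otimes> g = g \<otimes> r"
    using f1(1) f2(1) c r eq1 eq2 rg by blast
qed

text \<open>A point moved by \<open>f\<close> and by the twelfth power of \<open>g\<close> has a
  neighbourhood \<open>W\<close> that is disjoint from its images under \<open>f\<close> and the
  first four powers of \<open>g\<close>. An \<open>h\<close> supported in \<open>W\<close> and
  moving the point fails to commute with \<open>f\<close>. Since the resulting \<open>r\<close>
  commutes with \<open>g\<close>, its support contains whole \<open>g\<close>-orbits, and the
  pigeonhole principle applies to five consecutive points of one orbit.\<close>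

lemma disjoint_if_alg_disjoint:
  assumes f: "f \<in> carrier G" and g: "g \<in> carrier G" and ad: "alg_disjoint G f g"
  shows "supp M f \<inter> supp M (g [^] (12::nat)) = {}"
proof (rule ccontr)
  assume "supp M f \<inter> supp M (g [^] (12::nat)) \<noteq> {}"
  then obtain x where x: "x \<in> supp M f" "x \<in> supp M (g [^] (12::nat))"
    by blast
  have xM: "x \<in> topspace M"
    using x by (auto simp: supp_def)
  \<comment> \<open>If a power \<open>g^j\<close> with \<open>j\<close> dividing 12 fixed
    \<open>x\<close>, so would the twelfth power.\<close>
  have pow_fix: "(g [^] (j * i :: nat)) x = x" if "(g [^] j) x = x" for i j
  proof (induction i)
    case 0
    then show ?case using xM by (simp add: one_app)
  next
    case (Suc i)
    have "g [^] (j * Suc i) = g [^] (j * i) \<otimes> g [^] j"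
      using g by (simp add: nat_pow_mult add.commute)
    then show ?case
      using Suc that xM by (simp add: mult_app)
  qed
  have "x \<in> supp M (g [^] j)" if "j \<in> {1..4}" for j :: nat
  proof -
    have "j = 1 \<or> j = 2 \<or> j = 3 \<or> j = 4"
      using that by auto
    then have "j * (12 div j) = 12"
      by auto
    then show ?thesis
      using pow_fix[of j "12 div j"] x(2) by (auto simp: supp_def)
  qed
  then have "\<exists>W. openin M W \<and> x \<in> W \<and> (g [^] j) ` W \<inter> W = {}" if "j \<in> {1..4}" for j :: nat
    using separate[of "g [^] j" x] g that by (metis nat_pow_closed)
  then obtain V where V: "\<And>j::nat. j \<in> {1..4} \<Longrightarrow> openin M (V j) \<and> x \<in> V j \<and> (g [^] j) ` V j \<inter> V j = {}"
    by metis
  obtain V0 where V0: "openin M V0" "x \<in> V0" "f ` V0 \<inter> V0 = {}"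
    using separate[OF f x(1)] .
  define W where "W = V0 \<inter> (\<Inter>j\<in>{1..4}. V j)"
  have W: "openin M W" "x \<in> W" "f ` W \<inter> W = {}"
    using V0 V by (auto simp: W_def intro!: openin_Int openin_INT2)
  have gW: "(g [^] j) ` W \<inter> W = {}" if "j \<in> {1..4}" for j :: nat
  proof -
    have "W \<subseteq> V j"
      using that by (auto simp: W_def)
    then show ?thesis
      using V[OF that] by blast
  qed
  have WM: "W \<subseteq> topspace M"
    using W openin_subset by auto
  obtain h where h: "h \<in> carrier G" "supp M h \<subseteq> W" "x \<in> supp M h"
    using moving1[OF W(1,2)] .
  have "f x \<notin> supp M h"
    using W h(2) by auto
  then have "h (f x) = f x"
    using xM f by (simp add: app_notin_supp app_closed)
  moreover have "f (h x) \<noteq> f x"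
    using app_eq_iff[OF f app_closed[OF h(1) xM] xM] h(3) by (simp add: supp_def)
  ultimately have "(f \<otimes> h) x \<noteq> (h \<otimes> f) x"
    using xM by (simp add: mult_app)
  then have "f \<otimes> h \<noteq> h \<otimes> f"
    by auto
  then obtain f1 f2 c r where el: "f1 \<in> carrier G" "f2 \<in> carrier G" "c \<in> carrier G" "r \<in> carrier G"
    and comm: "f1 \<otimes> g = g \<otimes> f1" "f2 \<otimes> g = g \<otimes> f2" "r \<otimes> g = g \<otimes> r"
    and c: "c \<otimes> (h \<otimes> f2) = f2 \<otimes> h" and r: "r \<otimes> (c \<otimes> f1) = f1 \<otimes> c" and "r \<noteq> \<one>"
    using ad h(1) unfolding alg_disjoint_def by meson
  have "c = f2 \<otimes> h \<otimes> inv (h \<otimes> f2)"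
    using c el h by (metis inv_solve_right m_closed)
  then have "c = (f2 \<otimes> h \<otimes> inv f2) \<otimes> inv h"
    using el h by (simp add: inv_mult_group m_assoc)
  then have sc: "supp M c \<subseteq> f2 ` W \<union> W"
    using supp_mult[of "f2 \<otimes> h \<otimes> inv f2" "inv h"] el h by (auto simp: supp_conj supp_inv)
  have "r = f1 \<otimes> c \<otimes> inv (c \<otimes> f1)"
    using r el by (metis inv_solve_right m_closed)
  then have "r = (f1 \<otimes> c \<otimes> inv f1) \<otimes> inv c"
    using el by (simp add: inv_mult_group m_assoc)
  then have sr: "supp M r \<subseteq> f1 ` (f2 ` W \<union> W) \<union> (f2 ` W \<union> W)"
    using supp_mult[of "f1 \<otimes> c \<otimes> inv f1" "inv c"] el sc
      image_mono[OF sc, of f1] by (simp add: supp_conj supp_inv) blast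
  \<comment> \<open>The expressions \<open>(f2 h f2^-1) h^-1\<close> for \<open>c\<close> and
    \<open>(f1 c f1^-1) c^-1\<close> for \<open>r\<close> cover the support of \<open>r\<close> by
    the translates of \<open>W\<close> under these elements, each of which commutes with
    \<open>g\<close>.\<close>
  define A where "A = {\<one>, f1, f2, f1 \<otimes> f2}"
  have A: "a \<in> carrier G" "a \<otimes> g = g \<otimes> a" if "a \<in> A" for a
    using that el g comm by (auto simp: A_def m_assoc) (auto simp flip: m_assoc)
  have srA: "\<exists>a\<in>A. y \<in> a ` W" if "y \<in> supp M r" for y
  proof -
    have "\<one> ` W = W"
      using WM by (force simp: one_app)
    moreover have "(f1 \<otimes> f2) ` W = f1 ` f2 ` W"
      using WM by (force simp: mult_app)
    ultimately show ?thesis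
      using sr that unfolding A_def by auto
  qed
  obtain z where z: "z \<in> supp M r"
    using \<open>r \<noteq> \<one>\<close> el supp_empty_iff by blast
  have zM: "z \<in> topspace M"
    using z by (auto simp: supp_def)
  have rg: "r \<otimes> g [^] j = g [^] j \<otimes> r" for j :: nat
    using el g comm by (simp add: group_commutes_pow)
  have "(g [^] j) z \<in> supp M r" for j :: nat
    using z zM el g rg[of j] mult_app[OF zM, of r "g [^] j"] mult_app[OF zM, of "g [^] j" r]
    by (auto simp: supp_def app_closed app_eq_iff)
  then have "\<forall>j::nat. \<exists>a. a \<in> A \<and> (g [^] j) z \<in> a ` W"
    using srA by blast
  then obtain a where a: "\<And>j::nat. a j \<in> A \<and> (g [^] j) z \<in> a j ` W"
    using choice by metis
  have "\<not> inj_on a {0..4}"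
  proof
    assume "inj_on a {0..4}"
    then have "card {0..4::nat} \<le> card A"
      using a by (intro card_inj_on_le[of a]) (auto simp: A_def)
    moreover have "card A \<le> 4"
      using card_length[of "[\<one>, f1, f2, f1 \<otimes> f2]"] by (simp add: A_def)
    ultimately show False
      by simp
  qed
  then obtain i j where ij: "i < j" "j \<le> 4" "a i = a j"
    unfolding inj_on_def by (metis atLeastAtMost_iff linorder_neqE_nat)
  have ai: "a i \<in> carrier G" "inv (a i) \<otimes> g [^] k = g [^] k \<otimes> inv (a i)" for k :: nat
  proof -
    show ai: "a i \<in> carrier G"
      using a A by blast
    have "a i \<otimes> g = g \<otimes> a i"
      using a A by blast
    then have "a i \<otimes> g [^] k = g [^] k \<otimes> a i"
      using ai g by (simp add: group_commutes_pow)
    then show "inv (a i) \<otimes> g [^] k = g [^] k \<otimes> inv (a i)"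
      using ai g by (metis inv_solve_left inv_solve_right m_assoc nat_pow_closed inv_closed m_closed)
  qed
  \<comment> \<open>\<open>inv (a i)\<close> commutes with the powers of \<open>g\<close>, so the
    two orbit points in the same translate pull back to points of \<open>W\<close> that differ by
    \<open>g^(j - i)\<close>, against the choice of \<open>W\<close>.\<close>
  have "(inv (a i)) ((g [^] i) z) \<in> W"
    using a[of i] mem_image_iff[OF ai(1) WM] by blast
  moreover have "(g [^] (j - i)) ((inv (a i)) ((g [^] i) z)) = (inv (a i)) ((g [^] j) z)"
  proof -
    have "g [^] (j - i) \<otimes> (inv (a i) \<otimes> g [^] i) = (g [^] (j - i) \<otimes> inv (a i)) \<otimes> g [^] i"
      using ai g by (simp add: m_assoc)
    also have "\<dots> = inv (a i) \<otimes> (g [^] (j - i) \<otimes> g [^] i)"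
      using ai(1) g by (simp add: m_assoc flip: ai(2))
    also have "\<dots> = inv (a i) \<otimes> g [^] j"
      using ij g by (simp add: nat_pow_mult)
    finally have "(g [^] (j - i) \<otimes> (inv (a i) \<otimes> g [^] i)) z = (inv (a i) \<otimes> g [^] j) z"
      by simp
    then show ?thesis
      using zM g by (simp add: mult_app app_closed)
  qed
  moreover have "(inv (a i)) ((g [^] j) z) \<in> W"
    using a[of j] mem_image_iff[OF ai(1) WM] ij by metis
  moreover have "j - i \<in> {1..4}"
    using ij by auto
  ultimately show False
    using gW[of "j - i"] by (metis IntI empty_iff imageI)
qed

text \<open>Suppose \<open>k\<close> moves \<open>x\<close> outside the closure. Take
  \<open>g\<close> supported near \<open>x\<close>, off \<open>supp M f\<close>, on a set that
  \<open>k\<close> moves off itself: then \<open>g^12\<close> fixes \<open>k x\<close> but moves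
  \<open>x\<close>, so it cannot commute with \<open>k\<close>. Conversely, the open support of
  \<open>g^12\<close> misses \<open>supp M f\<close> and hence its closure.\<close>

lemma alg_below_iff:
  assumes k: "k \<in> carrier G" and f: "f \<in> carrier G"
  shows "alg_below G k f \<longleftrightarrow> supp M k \<subseteq> M closure_of supp M f"
proof
  assume kf: "alg_below G k f"
  show "supp M k \<subseteq> M closure_of supp M f"
  proof (rule ccontr)
    assume "\<not> ?thesis"
    then obtain x where x: "x \<in> supp M k" "x \<notin> M closure_of supp M f"
      by blast
    obtain W0 where W0: "openin M W0" "x \<in> W0" "k ` W0 \<inter> W0 = {}"
      using separate[OF k x(1)] .
    define W where "W = W0 - M closure_of supp M f"
    have W: "openin M W" "x \<in> W"
      using W0 x by (auto simp: W_def intro: openin_diff)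
    have xM: "x \<in> topspace M"
      using x by (auto simp: supp_def)
    obtain g where g: "g \<in> carrier G" "supp M g \<subseteq> W" "\<forall>j::nat. j > 0 \<longrightarrow> (g [^] j) x \<noteq> x"
      using moving[OF W] by blast
    have "supp M f \<subseteq> M closure_of supp M f"
      by (simp add: closure_of_subset supp_subset)
    then have "alg_disjoint G f g"
      using g(2) by (intro alg_disjoint_if_disjoint f g) (auto simp: W_def)
    then have "k \<otimes> g [^] (12::nat) = g [^] (12::nat) \<otimes> k"
      using kf g unfolding alg_below_def by blast
    then have eq: "k ((g [^] (12::nat)) x) = (g [^] (12::nat)) (k x)"
      using xM by (metis mult_app)
    have "k x \<notin> W"
      using W0 by (auto simp: W_def)
    moreover have "(g [^] j) y = y" if "y \<in> topspace M" "y \<notin> W" for y and j :: nat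
    proof -
      have "g y = y"
        using that g by (auto intro: app_notin_supp)
      then show ?thesis
        using that by (induction j) (auto simp: one_app mult_app)
    qed
    ultimately have "k ((g [^] (12::nat)) x) = k x"
      using eq k xM by (simp add: app_closed)
    moreover have "(g [^] (12::nat)) x \<noteq> x"
      using g by simp
    ultimately show False
      using k xM g by (simp add: app_eq_iff app_closed)
  qed
next
  assume kf: "supp M k \<subseteq> M closure_of supp M f"
  show "alg_below G k f"
    unfolding alg_below_def
  proof (intro ballI impI)
    fix g assume g: "g \<in> carrier G" "alg_disjoint G f g"
    have "supp M f \<inter> supp M (g [^] (12::nat)) = {}"
      using disjoint_if_alg_disjoint f g by blast
    then have "M closure_of supp M f \<inter> supp M (g [^] (12::nat)) = {}"
      using openin_Int_closure_of_eq_empty[OF openin_supp[of "g [^] (12::nat)"]] g by blast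
    then show "k \<otimes> g [^] (12::nat) = g [^] (12::nat) \<otimes> k"
      using kf k g by (intro commute_disjoint) auto
  qed
qed

end

section \<open>Affine maps of a ball\<close>

definition eucl :: "nat \<Rightarrow> (nat \<Rightarrow> real) set" where
  "eucl n = {x. \<forall>i\<ge>n. x i = 0}"

text \<open>The l1 norm: homogeneity, the triangle inequality and the coordinate bound
  \<open>nrm_coord\<close> come straight from finite sums.\<close>

definition nrm :: "nat \<Rightarrow> (nat \<Rightarrow> real) \<Rightarrow> real" where
  "nrm n x = (\<Sum>i<n. \<bar>x i\<bar>)"

definition unit_cball :: "nat \<Rightarrow> (nat \<Rightarrow> real) set" where
  "unit_cball n = {x \<in> eucl n. nrm n x \<le> 1}"

definition unit_ball :: "nat \<Rightarrow> (nat \<Rightarrow> real) set" where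
  "unit_ball n = {x \<in> eucl n. nrm n x < 1}"

definition shrink :: "nat \<Rightarrow> (nat \<Rightarrow> real) \<Rightarrow> (nat \<Rightarrow> real)" where
  "shrink n x = (\<lambda>i. x i / (1 + nrm n x))"

definition expand :: "nat \<Rightarrow> (nat \<Rightarrow> real) \<Rightarrow> (nat \<Rightarrow> real)" where
  "expand n y = (\<lambda>i. y i / (1 - nrm n y))"

definition aff :: "real \<Rightarrow> (nat \<Rightarrow> real) \<Rightarrow> (nat \<Rightarrow> real) \<Rightarrow> (nat \<Rightarrow> real)" where
  "aff l v x = (\<lambda>i. l * x i + v i)"

text \<open>The affine map \<open>aff l v\<close>, transported by \<open>shrink\<close> to the open unit ball, fixes all
  directions at infinity, so it extends to the closed ball by the identity on the sphere.\<close>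

definition ball_affine :: "nat \<Rightarrow> real \<Rightarrow> (nat \<Rightarrow> real) \<Rightarrow> (nat \<Rightarrow> real) \<Rightarrow> (nat \<Rightarrow> real)" where
  "ball_affine n l v y = (if nrm n y < 1 then shrink n (aff l v (expand n y)) else y)"

lemma topspace_Euclidean: "topspace (Euclidean_space n) = eucl n"
  by (simp add: topspace_Euclidean_space eucl_def)

lemma Euclidean_eq: "Euclidean_space n = top_of_set (eucl n)"
  by (simp add: Euclidean_space_def euclidean_product_topology eucl_def)

lemma nrm_nonneg: "0 \<le> nrm n x"
  by (simp add: nrm_def sum_nonneg)

lemma nrm_scale: "nrm n (\<lambda>i. c * x i) = \<bar>c\<bar> * nrm n x"
  by (simp add: nrm_def abs_mult sum_distrib_left)

lemma nrm_divide: "nrm n (\<lambda>i. x i / c) = nrm n x / \<bar>c\<bar>"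
  using nrm_scale[of n "1 / c" x] by simp

lemma nrm_add: "nrm n (\<lambda>i. x i + y i) \<le> nrm n x + nrm n y"
  unfolding nrm_def sum.distrib[symmetric] by (intro sum_mono abs_triangle_ineq)

lemma nrm_zero [simp]: "nrm n (\<lambda>i. 0) = 0"
  by (simp add: nrm_def)

lemma nrm_coord: "i < n \<Longrightarrow> \<bar>x i\<bar> \<le> nrm n x"
  unfolding nrm_def by (rule member_le_sum) auto

lemma aff_eucl: "x \<in> eucl n \<Longrightarrow> v \<in> eucl n \<Longrightarrow> aff l v x \<in> eucl n"
  by (simp add: eucl_def aff_def)

lemma zero_eucl [simp]: "(\<lambda>i. 0) \<in> eucl n"
  by (simp add: eucl_def)

lemma nrm_shrink: "nrm n (shrink n x) = nrm n x / (1 + nrm n x)"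
  using nrm_nonneg[of n x] by (simp add: shrink_def nrm_divide)

lemma nrm_expand: "nrm n y < 1 \<Longrightarrow> nrm n (expand n y) = nrm n y / (1 - nrm n y)"
  by (simp add: expand_def nrm_divide)

lemma shrink_in: "x \<in> eucl n \<Longrightarrow> shrink n x \<in> unit_ball n"
  using nrm_nonneg[of n x] by (auto simp: unit_ball_def nrm_shrink) (simp add: shrink_def eucl_def)

lemma expand_in: "y \<in> eucl n \<Longrightarrow> expand n y \<in> eucl n"
  by (simp add: expand_def eucl_def)

lemma expand_shrink: "expand n (shrink n x) = x"
proof -
  have "0 < 1 + nrm n x"
    using nrm_nonneg[of n x] by simp
  then show ?thesis
    unfolding expand_def nrm_shrink by (auto simp: shrink_def fun_eq_iff field_simps)
qed

lemma shrink_expand: "nrm n y < 1 \<Longrightarrow> shrink n (expand n y) = y"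
  unfolding shrink_def nrm_expand by (auto simp: expand_def fun_eq_iff field_simps)

lemma shrink_image: "shrink n ` eucl n = unit_ball n"
proof
  show "unit_ball n \<subseteq> shrink n ` eucl n"
    by (metis (no_types, lifting) expand_in image_eqI mem_Collect_eq shrink_expand subsetI unit_ball_def)
qed (auto simp: shrink_in)

lemma ball_affine_shrink: "x \<in> eucl n \<Longrightarrow> ball_affine n l v (shrink n x) = shrink n (aff l v x)"
  using shrink_in[of x n] by (simp add: ball_affine_def expand_shrink unit_ball_def)

lemma ball_affine_sphere: "\<not> nrm n y < 1 \<Longrightarrow> ball_affine n l v y = y"
  by (simp add: ball_affine_def)

lemma unit_ball_subset: "unit_ball n \<subseteq> unit_cball n"
  by (auto simp: unit_ball_def unit_cball_def)

lemma ball_affine_in: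
  assumes "y \<in> unit_cball n" "v \<in> eucl n"
  shows "ball_affine n l v y \<in> unit_cball n"
proof (cases "nrm n y < 1")
  case True
  then have "ball_affine n l v y \<in> unit_ball n"
    using assms by (simp add: ball_affine_def shrink_in aff_eucl expand_in unit_cball_def)
  then show ?thesis
    using unit_ball_subset by blast
qed (use assms in \<open>simp add: ball_affine_sphere\<close>)

lemma aff_composeine: "aff l v (aff m w x) = aff (l * m) (aff l v w) x"
  by (simp add: aff_def algebra_simps)

lemma aff_1_0: "aff 1 (\<lambda>i. 0) x = x"
  by (simp add: aff_def)

lemma ball_affine_compose:
  assumes "y \<in> unit_cball n" "v \<in> eucl n" "w \<in> eucl n"
  shows "ball_affine n l v (ball_affine n m w y) = ball_affine n (l * m) (aff l v w) y"
proof (cases "nrm n y < 1")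
  case True
  then obtain x where x: "x \<in> eucl n" "y = shrink n x"
    using assms(1) that[of "expand n y"] by (auto simp: expand_in shrink_expand unit_cball_def)
  then show ?thesis
    using assms by (simp add: ball_affine_shrink aff_eucl aff_composeine)
qed (simp add: ball_affine_sphere)

lemma ball_affine_1_0: "ball_affine n 1 (\<lambda>i. 0) y = y"
  by (simp add: ball_affine_def aff_1_0 shrink_expand)

lemma continuous_on_nrm: 
  assumes "continuous_on S f"
  shows "continuous_on S (\<lambda>x. nrm n (f x))"
  unfolding nrm_def real_norm_def[symmetric]
  by (intro continuous_on_sum continuous_on_norm continuous_on_product_then_coordinatewise[OF assms])

lemma continuous_on_coord: "continuous_on S (\<lambda>x :: nat \<Rightarrow> real. x i)"
  by (rule continuous_on_subset[OF continuous_on_product_coordinates]) simp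

lemma continuous_on_shrink: "continuous_on S (shrink n)"
proof -
  have "1 + nrm n x \<noteq> 0" for x
    using nrm_nonneg[of n x] by linarith
  then show ?thesis
    unfolding shrink_def
    by (intro continuous_on_coordinatewise_then_product continuous_intros continuous_on_coord
        continuous_on_nrm) auto
qed

lemma continuous_on_expand: "continuous_on (unit_ball n) (expand n)"
  unfolding expand_def
  by (intro continuous_on_coordinatewise_then_product continuous_intros continuous_on_coord
      continuous_on_nrm) (auto simp: unit_ball_def)

text \<open>Clearing the denominator \<open>1 - nrm n y\<close> turns the map into
  \<open>p y / q y\<close>, which makes sense on the whole closed ball. On the sphere
  \<open>p y\<close> is \<open>l * y\<close> and \<open>q y\<close> is \<open>l\<close>, so the
  quotient is the identity there; this is where \<open>l > 0\<close> enters.\<close>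

lemma continuous_on_ball_affine:
  assumes l: "l > 0" and v: "v \<in> eucl n"
  shows "continuous_on (unit_cball n) (ball_affine n l v)"
proof -
  define p where "p = (\<lambda>y i. l * y i + (1 - nrm n y) * v i)"
  define q where "q = (\<lambda>y. 1 - nrm n y + nrm n (p y))"
  have p1: "p y = (\<lambda>i. l * y i)" if "nrm n y = 1" for y
    using that by (simp add: p_def)
  have q0: "q y \<noteq> 0" if "y \<in> unit_cball n" for y
  proof (cases "nrm n y < 1")
    case True
    then show ?thesis
      using nrm_nonneg[of n "p y"] by (simp add: q_def)
  next
    case False
    then have "nrm n y = 1"
      using that by (simp add: unit_cball_def)
    then show ?thesis
      using l by (simp add: q_def p1 nrm_scale)
  qed
  have p: "continuous_on (unit_cball n) p"
    unfolding p_def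
    by (intro continuous_on_coordinatewise_then_product continuous_intros continuous_on_coord
        continuous_on_nrm)
  then have "continuous_on (unit_cball n) q"
    unfolding q_def by (intro continuous_on_add continuous_on_diff continuous_on_const continuous_on_nrm
        continuous_on_id)
  then have "continuous_on (unit_cball n) (\<lambda>y i. p y i / q y)"
    using q0 by (intro continuous_on_coordinatewise_then_product continuous_on_divide
        continuous_on_product_then_coordinatewise[OF p]) auto
  moreover have "(\<lambda>i. p y i / q y) = ball_affine n l v y" if y: "y \<in> unit_cball n" for y
  proof (cases "nrm n y < 1")
    case True
    have "aff l v (expand n y) = (\<lambda>i. p y i / (1 - nrm n y))"
      using True by (auto simp: aff_def expand_def p_def field_simps)
    then have "shrink n (aff l v (expand n y)) = (\<lambda>i. p y i / (1 - nrm n y) / (1 + nrm n (p y) / (1 - nrm n y)))"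
      using True by (simp add: shrink_def nrm_divide)
    also have "1 + nrm n (p y) / (1 - nrm n y) = q y / (1 - nrm n y)"
      using True by (simp add: q_def field_simps)
    also have "(\<lambda>i. p y i / (1 - nrm n y) / (q y / (1 - nrm n y))) = (\<lambda>i. p y i / q y)"
      using True by simp
    finally show ?thesis
      using True by (simp add: ball_affine_def)
  next
    case False
    then have "nrm n y = 1"
      using y by (simp add: unit_cball_def)
    then show ?thesis
      using l by (simp add: q_def p1 nrm_scale ball_affine_def)
  qed
  ultimately show ?thesis
    by (simp cong: continuous_on_cong)
qed

lemma compact_unit_cball: "compact (unit_cball n)"
proof -
  define B where "B = (\<lambda>i. if i < n then {-1..1::real} else {0})"
  have "compactin (product_topology (\<lambda>i. euclidean) UNIV) (PiE UNIV B)"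
    unfolding compactin_PiE by (auto simp: B_def)
  then have "compact (PiE UNIV B)"
    by (simp add: euclidean_product_topology)
  moreover have "x \<in> unit_cball n \<longleftrightarrow> x \<in> PiE UNIV B \<and> nrm n x \<le> 1" for x
  proof -
    have "\<bar>x i\<bar> \<le> 1" if "nrm n x \<le> 1" "i < n" for i
      using nrm_coord[OF that(2), of x] that(1) by linarith
    then show ?thesis
      by (auto simp: unit_cball_def eucl_def B_def PiE_iff abs_le_iff minus_le_iff split: if_splits)
  qed
  then have "unit_cball n = PiE UNIV B \<inter> nrm n -` {..1}"
    by blast
  moreover have "closed (nrm n -` {..1})"
    using continuous_on_nrm[of UNIV "\<lambda>x. x" n] by (intro closed_vimage) (auto simp: continuous_on_id)
  ultimately show ?thesis
    by (simp add: compact_Int_closed)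
qed

lemma eucl_open_contains_ball:
  assumes "openin (top_of_set S) W" "c \<in> W" "S \<subseteq> eucl n"
  shows "\<exists>e>0. \<forall>x\<in>S. nrm n (\<lambda>i. x i - c i) < e \<longrightarrow> x \<in> W"
proof -
  obtain T where T: "open T" "W = S \<inter> T"
    using assms(1) by (auto simp: openin_open)
  then have "openin (product_topology (\<lambda>i. euclidean) UNIV) T" "c \<in> T"
    using assms(2) by (auto simp: euclidean_product_topology)
  from product_topology_open_contains_basis[OF this] obtain X where
    X: "c \<in> PiE UNIV X" "\<And>i. open (X i)" "PiE UNIV X \<subseteq> T"
    by auto
  have "\<exists>d>0. ball (c i) d \<subseteq> X i" for i
    using X(1) X(2)[of i] by (auto simp: PiE_iff open_contains_ball)
  then have "\<forall>i. \<exists>d>0. ball (c i) d \<subseteq> X i"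
    by blast
  then obtain d where d: "\<And>i. d i > 0 \<and> ball (c i) (d i) \<subseteq> X i"
    by metis
  \<comment> \<open>The inserted 1 keeps the minimum meaningful for \<open>n = 0\<close>.
    Coordinates from \<open>n\<close> on vanish for both points and impose no bound.\<close>
  define e where "e = Min (insert 1 (d ` {..<n}))"
  have "x \<in> W" if x: "x \<in> S" "nrm n (\<lambda>i. x i - c i) < e" for x
  proof -
    have "x i \<in> X i" for i
    proof (cases "i < n")
      case True
      have "\<bar>x i - c i\<bar> < e"
        using nrm_coord[OF True, of "\<lambda>i. x i - c i"] x(2) by simp
      also have "e \<le> d i"
        using True by (simp add: e_def)
      finally show ?thesis
        using d[of i] by (auto simp: dist_real_def)
    next
      case False
      then have "x i = c i"
      proof -
        have "x \<in> eucl n" "c \<in> eucl n"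
          using x(1) assms(2,3) T(2) by auto
        with False show ?thesis
          by (simp add: eucl_def)
      qed
      then show ?thesis
        using X(1) by (auto simp: PiE_iff)
    qed
    then show ?thesis
      using X(3) x(1) T(2) by (auto simp: PiE_UNIV_domain)
  qed
  moreover have "e > 0"
    using d by (simp add: e_def)
  ultimately show ?thesis
    by blast
qed

lemma openin_unit_ball: "openin (top_of_set (eucl n)) (unit_ball n)"
proof -
  have "open (nrm n -` {..<1})"
    using continuous_on_nrm[of UNIV "\<lambda>x. x" n] by (intro open_vimage) (auto simp: continuous_on_id)
  moreover have "unit_ball n = eucl n \<inter> nrm n -` {..<1}"
    by (auto simp: unit_ball_def)
  ultimately show ?thesis
    by (auto simp: openin_open)
qed

section \<open>Ball charts\<close>

text \<open>The closed ball is part of the chart so that an affine map of the open ball extends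
  continuously by the identity across the sphere. By compactness such a \<open>\<phi>\<close> is a
  closed map into a Hausdorff space.\<close>

definition ball_chart :: "nat \<Rightarrow> 'a topology \<Rightarrow> ((nat \<Rightarrow> real) \<Rightarrow> 'a) \<Rightarrow> bool" where
  "ball_chart n M \<phi> \<longleftrightarrow> continuous_map (top_of_set (unit_cball n)) M \<phi> \<and>
     inj_on \<phi> (unit_cball n) \<and> openin M (\<phi> ` unit_ball n)"

definition chart_affine ::
  "nat \<Rightarrow> 'a topology \<Rightarrow> ((nat \<Rightarrow> real) \<Rightarrow> 'a) \<Rightarrow> real \<Rightarrow> (nat \<Rightarrow> real) \<Rightarrow> 'a \<Rightarrow> 'a" where
  "chart_affine n M \<phi> l v =
     (\<lambda>x\<in>topspace M. if x \<in> \<phi> ` unit_cball n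
        then \<phi> (ball_affine n l v (inv_into (unit_cball n) \<phi> x)) else x)"

locale manifold = homeo_space M G for M :: "'a topology" and G (structure) +
  fixes n :: nat
  assumes second_countable: "second_countable_space M"
    and locally_Euclidean: "locally_Euclidean_space n M"
    and dim_pos: "n > 0"
begin

lemma chart_closed:
  assumes "ball_chart n M \<phi>" "closedin (top_of_set (unit_cball n)) K"
  shows "closedin M (\<phi> ` K)"
proof -
  have "closed_map (top_of_set (unit_cball n)) M \<phi>"
  proof (rule continuous_imp_closed_map_gen)
    show "compact_space (top_of_set (unit_cball n))"
      by (simp add: compact_space_subtopology compact_unit_cball)
    show "kc_space M"
      by (simp add: Hausdorff Hausdorff_imp_kc_space)
  qed (use assms in \<open>simp add: ball_chart_def\<close>)
  then show ?thesis
    using assms(2) by (simp add: closed_map_def)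
qed

lemma chart_compact:
  assumes "ball_chart n M \<phi>"
  shows "compactin M (\<phi> ` unit_cball n)"
  using assms image_compactin[of "top_of_set (unit_cball n)" "unit_cball n" M \<phi>] compact_unit_cball
  by (simp add: ball_chart_def compactin_subtopology)

lemma chart_in: "ball_chart n M \<phi> \<Longrightarrow> y \<in> unit_cball n \<Longrightarrow> \<phi> y \<in> topspace M"
  unfolding ball_chart_def using continuous_map_image_subset_topspace by fastforce

lemma chart_inj:
  "ball_chart n M \<phi> \<Longrightarrow> x \<in> eucl n \<Longrightarrow> y \<in> eucl n \<Longrightarrow> \<phi> (shrink n x) = \<phi> (shrink n y) \<longleftrightarrow> x = y"
proof -
  assume *: "ball_chart n M \<phi>" "x \<in> eucl n" "y \<in> eucl n"
  then have "shrink n x \<in> unit_cball n" "shrink n y \<in> unit_cball n"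
    using shrink_in unit_ball_subset by blast+
  then have "\<phi> (shrink n x) = \<phi> (shrink n y) \<longleftrightarrow> shrink n x = shrink n y"
    using *(1) inj_on_eq_iff[of \<phi> "unit_cball n" "shrink n x" "shrink n y"] by (simp add: ball_chart_def)
  then show ?thesis
    by (metis expand_shrink)
qed

lemma chart_closure:
  assumes \<phi>: "ball_chart n M \<phi>"
  shows "\<phi> ` unit_cball n \<subseteq> M closure_of (\<phi> ` unit_ball n)"
proof
  fix x assume "x \<in> \<phi> ` unit_cball n"
  then obtain y where y: "y \<in> unit_cball n" "x = \<phi> y"
    by blast
  show "x \<in> M closure_of (\<phi> ` unit_ball n)"
    unfolding in_closure_of
  proof (intro conjI allI impI)
    show "x \<in> topspace M"
      using y \<phi> chart_in by simp
    fix T assume T: "x \<in> T \<and> openin M T"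
    have "openin (top_of_set (unit_cball n)) {z \<in> unit_cball n. \<phi> z \<in> T}"
      using \<phi> T openin_continuous_map_preimage[of "top_of_set (unit_cball n)" M \<phi> T]
      by (simp add: ball_chart_def)
    from eucl_open_contains_ball[OF this, of y n] obtain e where e: "e > 0"
      "\<And>z. z \<in> unit_cball n \<Longrightarrow> nrm n (\<lambda>i. z i - y i) < e \<Longrightarrow> \<phi> z \<in> T"
      using y T by (auto simp: unit_cball_def)
    \<comment> \<open>Pulling \<open>y\<close> towards the centre by the factor \<open>1 - t\<close>
      brings it into the open ball, at distance at most \<open>t < e\<close>.\<close>
    define t where "t = min (e / 2) (1 / 2)"
    have t: "0 < t" "t < e" "t < 1"
      using e(1) by (auto simp: t_def)
    define z where "z = (\<lambda>i. (1 - t) * y i)"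
    have ny: "nrm n y \<le> 1"
      using y by (simp add: unit_cball_def)
    have "nrm n z = (1 - t) * nrm n y"
      using t by (simp add: z_def nrm_scale)
    also have "\<dots> \<le> (1 - t) * 1"
      using t ny by (intro mult_left_mono) auto
    finally have "nrm n z < 1"
      using t by simp
    then have z: "z \<in> unit_ball n"
      using y by (simp add: unit_ball_def unit_cball_def eucl_def z_def)
    have "nrm n (\<lambda>i. z i - y i) = nrm n (\<lambda>i. (- t) * y i)"
      by (simp add: z_def algebra_simps)
    also have "\<dots> = t * nrm n y"
      using t unfolding nrm_scale by simp
    also have "\<dots> \<le> t * 1"
      using t ny by (intro mult_left_mono) auto
    finally have "\<phi> z \<in> T"
      using e(2)[of z] z t unit_ball_subset by auto
    then show "\<exists>y. y \<in> \<phi> ` unit_ball n \<and> y \<in> T"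
      using z by blast
  qed
qed

lemma chart_exists:
  assumes "openin M O'" "p \<in> O'"
  obtains \<phi> where "ball_chart n M \<phi>" "p \<in> \<phi> ` unit_ball n" "\<phi> ` unit_cball n \<subseteq> O'"
proof -
  have "p \<in> topspace M"
    using assms openin_subset by blast
  then obtain U V where UV: "openin M U" "p \<in> U" "openin (Euclidean_space n) V"
    "subtopology M U homeomorphic_space subtopology (Euclidean_space n) V"
    using locally_Euclidean unfolding locally_Euclidean_space_def by blast
  have V: "V \<subseteq> eucl n"
    using openin_subset[OF UV(3)] by (simp add: topspace_Euclidean)
  have topV: "topspace (subtopology (Euclidean_space n) V) = V"
    using V by (auto simp: topspace_Euclidean)
  have U: "topspace (subtopology M U) = U"
    using openin_subset[OF UV(1)] by auto
  obtain h k where hk: "homeomorphic_maps (subtopology M U) (subtopology (Euclidean_space n) V) h k"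
    using UV(4) unfolding homeomorphic_space_def by blast
  then have h: "homeomorphic_map (subtopology M U) (subtopology (Euclidean_space n) V) h"
    and k: "homeomorphic_map (subtopology (Euclidean_space n) V) (subtopology M U) k"
    using homeomorphic_map_maps homeomorphic_maps_sym by blast+
  have kh: "k (h x) = x" "h x \<in> V" if "x \<in> U" for x
    using hk that U topV homeomorphic_imp_surjective_map[OF h] unfolding homeomorphic_maps_def by auto
  have "openin (subtopology M U) (O' \<inter> U)"
    using assms(1) by (simp add: openin_subtopology_Int)
  then have "openin (subtopology (Euclidean_space n) V) (h ` (O' \<inter> U))"
    using homeomorphic_imp_open_map[OF h] by (simp add: open_map_def)
  then have "openin (top_of_set (eucl n)) (h ` (O' \<inter> U))"
    using UV(3) openin_trans_full by (metis Euclidean_eq)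
  from eucl_open_contains_ball[OF this, of "h p" n] obtain e where e: "e > 0"
    "\<And>x. x \<in> eucl n \<Longrightarrow> nrm n (\<lambda>i. x i - h p i) < e \<Longrightarrow> x \<in> h ` (O' \<inter> U)"
    using assms(2) UV(2) by auto
  \<comment> \<open>Half the radius, so that the closed ball also fits into the neighbourhood of
    radius \<open>e\<close>.\<close>
  define A where "A = aff (e / 2) (h p)"
  have hp: "h p \<in> eucl n"
    using kh UV V by blast
  have A: "A y \<in> h ` (O' \<inter> U)" if "y \<in> unit_cball n" for y
  proof (rule e(2))
    show "A y \<in> eucl n"
      using that hp by (auto simp: A_def unit_cball_def intro: aff_eucl)
    have "nrm n (\<lambda>i. A y i - h p i) = (e / 2) * nrm n y"
      using e(1) nrm_scale[of n "e / 2" y] by (simp add: A_def aff_def)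
    also have "\<dots> \<le> (e / 2) * 1"
      using that e(1) by (intro mult_left_mono) (auto simp: unit_cball_def)
    finally show "nrm n (\<lambda>i. A y i - h p i) < e"
      using e(1) by simp
  qed
  have hOU: "h ` (O' \<inter> U) \<subseteq> V"
    using kh by auto
  define \<phi> where "\<phi> = k \<circ> A"
  have "continuous_on S A" for S
    unfolding A_def aff_def
    by (intro continuous_on_coordinatewise_then_product continuous_intros continuous_on_coord)
  then have contA: "continuous_map (top_of_set (unit_cball n)) (subtopology (Euclidean_space n) V) A"
    using A hOU V by (auto simp: Euclidean_eq subtopology_subtopology Int_absorb1)
  have contA': "continuous_on (eucl n) (\<lambda>z i. (z i - h p i) / (e / 2))"
    using e(1)
    by (intro continuous_on_coordinatewise_then_product continuous_intros continuous_on_coord) auto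
  have injA: "A y = A z \<longleftrightarrow> y = z" for y z
    using e(1) by (auto simp: A_def aff_def fun_eq_iff)
  have injk: "inj_on k V"
    using homeomorphic_imp_injective_map[OF k] topV by simp
  have "ball_chart n M \<phi>"
    unfolding ball_chart_def
  proof (intro conjI)
    show "continuous_map (top_of_set (unit_cball n)) M \<phi>"
      unfolding \<phi>_def
      using contA homeomorphic_imp_continuous_map[OF k] continuous_map_compose continuous_map_in_subtopology
      by blast
    show "inj_on \<phi> (unit_cball n)"
      using injk injA A hOU unfolding \<phi>_def inj_on_def by (metis comp_apply subsetD)
    have "A ` unit_ball n = {z \<in> eucl n. (\<lambda>i. (z i - h p i) / (e / 2)) \<in> unit_ball n}"
    proof (intro equalityI subsetI)
      fix z assume "z \<in> A ` unit_ball n"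
      then show "z \<in> {z \<in> eucl n. (\<lambda>i. (z i - h p i) / (e / 2)) \<in> unit_ball n}"
        using hp e(1) by (auto simp: A_def unit_ball_def intro: aff_eucl) (auto simp: aff_def)
    next
      fix z assume "z \<in> {z \<in> eucl n. (\<lambda>i. (z i - h p i) / (e / 2)) \<in> unit_ball n}"
      moreover have "z = A (\<lambda>i. (z i - h p i) / (e / 2))"
        using e(1) unfolding A_def aff_def by (intro ext) (simp add: field_simps)
      ultimately show "z \<in> A ` unit_ball n"
        by blast
    qed
    also have "openin (top_of_set (eucl n)) \<dots>"
    proof -
      have "(\<lambda>z i. (z i - h p i) / (e / 2)) \<in> eucl n \<rightarrow> eucl n"
        using hp by (auto simp: eucl_def)
      with contA' have "continuous_map (top_of_set (eucl n)) (top_of_set (eucl n)) (\<lambda>z i. (z i - h p i) / (e / 2))"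
        by auto
      from openin_continuous_map_preimage[OF this openin_unit_ball] show ?thesis
        by simp
    qed
    finally have "openin (Euclidean_space n) (A ` unit_ball n)"
      by (simp add: Euclidean_eq)
    moreover have "A ` unit_ball n \<subseteq> V"
      using A hOU unit_ball_subset by blast
    ultimately have "openin (subtopology (Euclidean_space n) V) (A ` unit_ball n)"
      by (metis openin_subset_topspace_eq openin_subtopology Int_absorb2)
    then have "openin (subtopology M U) (k ` A ` unit_ball n)"
      using homeomorphic_imp_open_map[OF k] by (simp add: open_map_def)
    then show "openin M (\<phi> ` unit_ball n)"
      using UV(1) openin_trans_full by (metis \<phi>_def image_comp)
  qed
  moreover have "p \<in> \<phi> ` unit_ball n"
  proof -
    have "p = \<phi> (\<lambda>i. 0)"
      using kh UV(2) by (simp add: \<phi>_def A_def aff_def)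
    then show ?thesis
      by (simp add: unit_ball_def)
  qed
  moreover have "\<phi> ` unit_cball n \<subseteq> O'"
    using A kh by (fastforce simp: \<phi>_def)
  ultimately show thesis
    using that by blast
qed

section \<open>Affine homeomorphisms supported in one chart\<close>

lemma chart_affine_chart:
  assumes "ball_chart n M \<phi>" "y \<in> unit_cball n"
  shows "chart_affine n M \<phi> l v (\<phi> y) = \<phi> (ball_affine n l v y)"
  using assms chart_in by (auto simp: chart_affine_def ball_chart_def)

lemma chart_affine_shrink:
  assumes "ball_chart n M \<phi>" "x \<in> eucl n"
  shows "chart_affine n M \<phi> l v (\<phi> (shrink n x)) = \<phi> (shrink n (aff l v x))"
  using assms subsetD[OF unit_ball_subset shrink_in[OF assms(2)]]
  by (simp add: chart_affine_chart ball_affine_shrink)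

lemma chart_affine_out:
  assumes "ball_chart n M \<phi>" "x \<in> topspace M" "x \<notin> \<phi> ` unit_ball n"
  shows "chart_affine n M \<phi> l v x = x"
proof (cases "x \<in> \<phi> ` unit_cball n")
  case True
  then obtain y where y: "y \<in> unit_cball n" "x = \<phi> y"
    by blast
  moreover have "\<not> nrm n y < 1"
    using assms(3) y by (auto simp: unit_ball_def unit_cball_def)
  ultimately show ?thesis
    using assms(1) by (simp add: chart_affine_chart ball_affine_sphere)
qed (use assms in \<open>simp add: chart_affine_def\<close>)

lemma chart_affine_in:
  assumes \<phi>: "ball_chart n M \<phi>" and "v \<in> eucl n" "x \<in> topspace M"
  shows "chart_affine n M \<phi> l v x \<in> topspace M"
proof (cases "x \<in> \<phi> ` unit_cball n")
  case True
  then obtain y where "y \<in> unit_cball n" "x = \<phi> y"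
    by blast
  then show ?thesis
    using chart_in[OF \<phi> ball_affine_in] assms by (simp add: chart_affine_chart)
qed (use assms in \<open>simp add: chart_affine_def\<close>)

lemma chart_affine_compose:
  assumes "ball_chart n M \<phi>" "v \<in> eucl n" "w \<in> eucl n" "x \<in> topspace M"
  shows "chart_affine n M \<phi> l v (chart_affine n M \<phi> m w x) = chart_affine n M \<phi> (l * m) (aff l v w) x"
proof (cases "x \<in> \<phi> ` unit_cball n")
  case True
  then show ?thesis
    using assms by (auto simp: chart_affine_chart ball_affine_in ball_affine_compose)
qed (use assms in \<open>simp add: chart_affine_def\<close>)

lemma chart_affine_1_0:
  assumes "ball_chart n M \<phi>" "x \<in> topspace M"
  shows "chart_affine n M \<phi> 1 (\<lambda>i. 0) x = x"
proof (cases "x \<in> \<phi> ` unit_cball n")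
  case True
  then show ?thesis
    using assms by (auto simp: chart_affine_chart ball_affine_1_0)
qed (use assms in \<open>simp add: chart_affine_def\<close>)

text \<open>Gluing along the sphere: the preimage of a closed set is the union of a closed piece
  inside the closed ball, closed in \<open>M\<close> by compactness, and a piece outside the open
  ball, where the map is the identity.\<close>

lemma chart_affine_continuous:
  assumes \<phi>: "ball_chart n M \<phi>" and l: "l > 0" and v: "v \<in> eucl n"
  shows "continuous_map M M (chart_affine n M \<phi> l v)"
  unfolding continuous_map_closedin
proof (intro conjI allI impI)
  show "chart_affine n M \<phi> l v \<in> topspace M \<rightarrow> topspace M"
    using chart_affine_in[OF \<phi> v] by blast
  fix K assume K: "closedin M K"
  let ?D = "\<phi> ` unit_ball n"
  let ?L = "{y \<in> unit_cball n. \<phi> (ball_affine n l v y) \<in> K}"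
  have "continuous_map (top_of_set (unit_cball n)) (top_of_set (unit_cball n)) (ball_affine n l v)"
    using continuous_on_ball_affine[OF l v] ball_affine_in[OF _ v] by auto
  then have "continuous_map (top_of_set (unit_cball n)) M (\<phi> \<circ> ball_affine n l v)"
    using \<phi> unfolding ball_chart_def by (metis continuous_map_compose)
  from closedin_continuous_map_preimage[OF this K] have "closedin M (\<phi> ` ?L)"
    by (intro chart_closed[OF \<phi>]) simp
  moreover have "closedin M (K \<inter> (topspace M - ?D))"
    using K \<phi> by (intro closedin_Int) (auto simp: ball_chart_def)
  moreover have "{x \<in> topspace M. chart_affine n M \<phi> l v x \<in> K} = \<phi> ` ?L \<union> (K \<inter> (topspace M - ?D))"
  proof (intro equalityI subsetI)
    fix x assume x: "x \<in> {x \<in> topspace M. chart_affine n M \<phi> l v x \<in> K}"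
    show "x \<in> \<phi> ` ?L \<union> (K \<inter> (topspace M - ?D))"
    proof (cases "x \<in> \<phi> ` unit_cball n")
      case True
      then obtain y where "y \<in> unit_cball n" "x = \<phi> y"
        by blast
      with x show ?thesis
        by (simp add: chart_affine_chart[OF \<phi>])
    next
      case False
      then have "x \<notin> ?D"
        using unit_ball_subset by blast
      then show ?thesis
        using x \<phi> by (auto simp: chart_affine_out)
    qed
  next
    fix x assume x: "x \<in> \<phi> ` ?L \<union> (K \<inter> (topspace M - ?D))"
    show "x \<in> {x \<in> topspace M. chart_affine n M \<phi> l v x \<in> K}"
    proof (cases "x \<in> \<phi> ` ?L")
      case True
      then show ?thesis
        using \<phi> by (auto simp: chart_affine_chart intro: chart_in)
    next
      case False
      then have "x \<in> K" "x \<in> topspace M" "x \<notin> ?D"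
        using x by blast+
      then show ?thesis
        by (simp add: chart_affine_out[OF \<phi>])
    qed
  qed
  ultimately show "closedin M {x \<in> topspace M. chart_affine n M \<phi> l v x \<in> K}"
    by (simp add: closedin_Un)
qed

lemma chart_affine_carrier:
  assumes \<phi>: "ball_chart n M \<phi>" and l: "l > 0" and v: "v \<in> eucl n"
  shows "chart_affine n M \<phi> l v \<in> carrier G"
proof -
  define w where "w = (\<lambda>i. - v i / l)"
  have w: "w \<in> eucl n"
    using v by (simp add: w_def eucl_def)
  have "aff l v w = (\<lambda>i. 0)" "aff (1 / l) w v = (\<lambda>i. 0)"
    using l by (auto simp: aff_def w_def)
  then have "homeomorphic_maps M M (chart_affine n M \<phi> l v) (chart_affine n M \<phi> (1 / l) w)"
    unfolding homeomorphic_maps_def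
    using chart_affine_continuous[OF \<phi>] l v w
    by (simp add: chart_affine_compose[OF \<phi>] chart_affine_1_0[OF \<phi>])
  then show ?thesis
    by (auto simp: carrier_iff homeomorphic_map_maps chart_affine_def)
qed

lemma chart_affine_mult:
  assumes "ball_chart n M \<phi>" "l > 0" "m > 0" "v \<in> eucl n" "w \<in> eucl n"
  shows "chart_affine n M \<phi> l v \<otimes> chart_affine n M \<phi> m w = chart_affine n M \<phi> (l * m) (aff l v w)"
  using assms by (intro homeo_eqI) (simp_all add: chart_affine_carrier aff_eucl mult_app chart_affine_compose)

lemma chart_affine_one:
  assumes "ball_chart n M \<phi>"
  shows "chart_affine n M \<phi> 1 (\<lambda>i. 0) = \<one>"
  using assms by (intro homeo_eqI) (simp_all add: chart_affine_carrier one_app chart_affine_1_0)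

lemma supp_chart_affine:
  assumes "ball_chart n M \<phi>"
  shows "supp M (chart_affine n M \<phi> l v) \<subseteq> \<phi> ` unit_ball n"
  using chart_affine_out[OF assms] unfolding supp_def by blast

lemma supp_chart_translation:
  assumes \<phi>: "ball_chart n M \<phi>" and v: "v \<in> eucl n" "v \<noteq> (\<lambda>i. 0)"
  shows "supp M (chart_affine n M \<phi> 1 v) = \<phi> ` unit_ball n"
proof
  show "\<phi> ` unit_ball n \<subseteq> supp M (chart_affine n M \<phi> 1 v)"
  proof
    fix x assume x: "x \<in> \<phi> ` unit_ball n"
    then obtain y where y: "y \<in> eucl n" "x = \<phi> (shrink n y)"
      by (auto simp flip: shrink_image)
    have "aff 1 v y \<noteq> y"
      using v(2) by (auto simp: aff_def fun_eq_iff)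
    then show "x \<in> supp M (chart_affine n M \<phi> 1 v)"
      using x y \<phi> v aff_eucl[OF y(1) v(1), of 1] openin_subset[of M "\<phi> ` unit_ball n"]
      by (auto simp: supp_def chart_affine_shrink chart_inj ball_chart_def)
  qed
qed (rule supp_chart_affine[OF \<phi>])

text \<open>A chart is known to be a closed map, so the image is obtained from the open set
  \<open>\<phi>\<close> unit_ball
  n\<open>by removing the closed image of the complement of\<close>shrink n \<open>S\<close> in the
  closed ball.\<close>

lemma chart_open_image:
  assumes \<phi>: "ball_chart n M \<phi>" and S: "openin (top_of_set (eucl n)) S"
  shows "openin M (\<phi> ` shrink n ` S)"
proof -
  have SE: "S \<subseteq> eucl n"
    using openin_subset[OF S] by simp
  have "shrink n ` S = {y \<in> unit_ball n. expand n y \<in> S}"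
  proof (intro equalityI subsetI)
    fix y assume "y \<in> shrink n ` S"
    then show "y \<in> {y \<in> unit_ball n. expand n y \<in> S}"
      using SE shrink_in by (auto simp: expand_shrink)
  next
    fix y assume y: "y \<in> {y \<in> unit_ball n. expand n y \<in> S}"
    then have "y = shrink n (expand n y)"
      by (simp add: unit_ball_def shrink_expand)
    with y show "y \<in> shrink n ` S"
      by blast
  qed
  moreover have "continuous_map (top_of_set (unit_ball n)) (top_of_set (eucl n)) (expand n)"
    using continuous_on_expand expand_in by (auto simp: unit_ball_def)
  ultimately have "openin (top_of_set (unit_ball n)) (shrink n ` S)"
    using openin_continuous_map_preimage[OF _ S, of "top_of_set (unit_ball n)" "expand n"] by simp
  then have "openin (top_of_set (eucl n)) (shrink n ` S)"
    using openin_unit_ball openin_trans by blast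
  moreover have sub: "shrink n ` S \<subseteq> unit_ball n"
    using SE shrink_in by blast
  then have "shrink n ` S \<subseteq> unit_cball n" "unit_cball n \<subseteq> eucl n"
    using unit_ball_subset by (blast, simp add: unit_cball_def)
  ultimately have "openin (top_of_set (unit_cball n)) (shrink n ` S)"
    by (rule openin_subset_trans)
  then have "closedin (top_of_set (unit_cball n)) (unit_cball n - shrink n ` S)"
    by (intro closedin_diff) auto
  then have "closedin M (\<phi> ` (unit_cball n - shrink n ` S))"
    using chart_closed[OF \<phi>] by blast
  moreover have "\<phi> ` (unit_cball n - shrink n ` S) = \<phi> ` unit_cball n - \<phi> ` shrink n ` S"
    using \<phi> sub unit_ball_subset
    by (intro inj_on_image_set_diff[of \<phi> "unit_cball n"]) (auto simp: ball_chart_def)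
  ultimately have "closedin M (\<phi> ` (unit_cball n - shrink n ` S))"
    and "\<phi> ` shrink n ` S = \<phi> ` unit_ball n - \<phi> ` (unit_cball n - shrink n ` S)"
    using unit_ball_subset image_mono[OF sub, of \<phi>] by blast+
  then show ?thesis
    using \<phi> by (simp add: ball_chart_def openin_diff)
qed

lemma chart_contains_ball:
  assumes \<phi>: "ball_chart n M \<phi>" and U: "openin M U" and x: "x \<in> eucl n" "\<phi> (shrink n x) \<in> U"
  obtains e where "e > 0"
    "\<And>y. y \<in> eucl n \<Longrightarrow> nrm n (\<lambda>i. y i - x i) < e \<Longrightarrow> \<phi> (shrink n y) \<in> U"
proof -
  have "continuous_map (top_of_set (eucl n)) (top_of_set (unit_cball n)) (shrink n)"
    using continuous_on_shrink subsetD[OF unit_ball_subset shrink_in] by auto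
  then have "continuous_map (top_of_set (eucl n)) M (\<phi> \<circ> shrink n)"
    using \<phi> unfolding ball_chart_def by (metis continuous_map_compose)
  from openin_continuous_map_preimage[OF this U]
  have "openin (top_of_set (eucl n)) {y \<in> eucl n. \<phi> (shrink n y) \<in> U}"
    by simp
  from eucl_open_contains_ball[OF this, of x n] show thesis
    using that x by auto
qed

definition unit_vec :: "nat \<Rightarrow> nat \<Rightarrow> real" where
  "unit_vec i = (\<lambda>j. if j = i then 1 else 0)"

lemma unit_vec_eucl: "i < n \<Longrightarrow> unit_vec i \<in> eucl n"
  by (auto simp: unit_vec_def eucl_def)

lemma chart_translation_pow:
  assumes "ball_chart n M \<phi>" "v \<in> eucl n"
  shows "chart_affine n M \<phi> 1 v [^] (k :: nat) = chart_affine n M \<phi> 1 (\<lambda>i. real k * v i)"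
proof (induction k)
  case 0
  then show ?case
    using assms by (simp add: chart_affine_one)
next
  case (Suc k)
  have "(\<lambda>i. real k * v i) \<in> eucl n"
    using assms by (simp add: eucl_def)
  then show ?case
    using assms Suc by (simp add: chart_affine_mult) (simp add: aff_def algebra_simps)
qed

text \<open>A translation and its positive powers have no fixed point inside the ball. Positive
  dimension supplies the nonzero vector.\<close>

sublocale locally_moving M G
proof unfold_locales
  fix W x assume W: "openin M W" "x \<in> W"
  then obtain \<phi> where \<phi>: "ball_chart n M \<phi>" "x \<in> \<phi> ` unit_ball n" "\<phi> ` unit_cball n \<subseteq> W"
    using chart_exists by blast
  define v where "v = unit_vec 0"
  have v: "v \<in> eucl n"
    using dim_pos by (simp add: v_def unit_vec_eucl)
  have "(chart_affine n M \<phi> 1 v [^] j) x \<noteq> x" if "j > 0" for j :: nat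
  proof -
    have "(\<lambda>i. real j * v i) \<in> eucl n" "(\<lambda>i. real j * v i) \<noteq> (\<lambda>i. 0)"
      using v that by (auto simp: eucl_def v_def unit_vec_def fun_eq_iff)
    then have "x \<in> supp M (chart_affine n M \<phi> 1 v [^] j)"
      using \<phi> v by (simp add: chart_translation_pow supp_chart_translation)
    then show ?thesis
      by (simp add: supp_def)
  qed
  moreover have "supp M (chart_affine n M \<phi> 1 v) \<subseteq> W"
    using supp_chart_affine[OF \<phi>(1)] \<phi>(3) unit_ball_subset by blast
  ultimately have "\<exists>f\<in>carrier G. supp M f \<subseteq> W \<and> (\<forall>j::nat. j > 0 \<longrightarrow> (f [^] j) x \<noteq> x)"
    using chart_affine_carrier[OF \<phi>(1) _ v, of 1] by auto
  then show "\<exists>f\<in>carrier (Homeo M). supp M f \<subseteq> W \<and>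
      (\<forall>j::nat. j > 0 \<longrightarrow> (f [^]\<^bsub>Homeo M\<^esub> j) x \<noteq> x)"
    unfolding G .
qed

end

section \<open>Infinite products over null families\<close>

context homeo_space
begin

text \<open>The last clause replaces "diameters tend to 0" without a metric: near any point, all but
  finitely many members that come close are small. This is what makes infinite products continuous
  at points where members accumulate.\<close>

definition null_family :: "nat set \<Rightarrow> (nat \<Rightarrow> 'a set) \<Rightarrow> bool" where
  "null_family J D \<longleftrightarrow> (\<forall>m\<in>J. openin M (D m)) \<and> (\<forall>m\<in>J. \<forall>k\<in>J. m \<noteq> k \<longrightarrow> D m \<inter> D k = {}) \<and>
     (\<forall>N x. openin M N \<and> x \<in> N \<longrightarrow>
        (\<exists>N'. openin M N' \<and> x \<in> N' \<and> finite {m \<in> J. D m \<inter> N' \<noteq> {} \<and> \<not> D m \<subseteq> N}))"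

definition supported :: "nat set \<Rightarrow> (nat \<Rightarrow> 'a set) \<Rightarrow> (nat \<Rightarrow> 'a \<Rightarrow> 'a) \<Rightarrow> bool" where
  "supported J D f \<longleftrightarrow> (\<forall>m\<in>J. f m \<in> carrier G \<and> supp M (f m) \<subseteq> D m)"

definition inf_prod :: "nat set \<Rightarrow> (nat \<Rightarrow> 'a \<Rightarrow> 'a) \<Rightarrow> 'a \<Rightarrow> 'a" where
  "inf_prod J f = (\<lambda>x\<in>topspace M.
     if \<exists>m\<in>J. x \<in> supp M (f m) then f (THE m. m \<in> J \<and> x \<in> supp M (f m)) x else x)"

lemma supported_mult:
  "supported J D f \<Longrightarrow> supported J D g \<Longrightarrow> supported J D (\<lambda>m. f m \<otimes> g m)"
  using supp_mult by (fastforce simp: supported_def)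

lemma supported_inv: "supported J D f \<Longrightarrow> supported J D (\<lambda>m. inv (f m))"
  by (simp add: supported_def supp_inv)

lemma inf_prod_out:
  assumes "supported J D f" "x \<in> topspace M" "\<And>m. m \<in> J \<Longrightarrow> x \<notin> D m"
  shows "inf_prod J f x = x"
  using assms by (auto simp: inf_prod_def supported_def)

lemma inf_prod_in:
  assumes nf: "null_family J D" and f: "supported J D f" and m: "m \<in> J" and x: "x \<in> D m"
  shows "inf_prod J f x = f m x"
proof -
  have xM: "x \<in> topspace M"
    using nf m x openin_subset unfolding null_family_def by blast
  have uniq: "k = m" if "k \<in> J" "x \<in> supp M (f k)" for k
    using that nf f m x unfolding null_family_def supported_def by blast
  show ?thesis
  proof (cases "x \<in> supp M (f m)")
    case True
    then have "(THE m. m \<in> J \<and> x \<in> supp M (f m)) = m"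
      using uniq m by blast
    then show ?thesis
      using True xM m by (auto simp: inf_prod_def)
  next
    case False
    then have "\<not> (\<exists>m\<in>J. x \<in> supp M (f m))"
      using uniq by blast
    then show ?thesis
      using False xM by (simp add: inf_prod_def app_notin_supp)
  qed
qed

lemma supported_in:
  assumes "supported J D f" "m \<in> J" "x \<in> D m" "x \<in> topspace M"
  shows "f m x \<in> D m"
proof (cases "x \<in> supp M (f m)")
  case True
  then show ?thesis
    using assms app_supp by (auto simp: supported_def)
qed (use assms in \<open>simp add: app_notin_supp\<close>)

lemma inf_prod_mult_app:
  assumes nf: "null_family J D" and f: "supported J D f" and g: "supported J D g" and x: "x \<in> topspace M"
  shows "inf_prod J f (inf_prod J g x) = inf_prod J (\<lambda>m. f m \<otimes> g m) x"
proof (cases "\<exists>m\<in>J. x \<in> D m")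
  case True
  then obtain m where m: "m \<in> J" "x \<in> D m"
    by blast
  then show ?thesis
    using supported_in[OF g m x] x
    by (simp add: inf_prod_in[OF nf _ m(1)] f g supported_mult mult_app)
next
  case False
  then show ?thesis
    using inf_prod_out[OF f x] inf_prod_out[OF g x] inf_prod_out[OF supported_mult[OF f g] x] by force
qed

lemma inf_prod_one_app:
  assumes "\<And>m. m \<in> J \<Longrightarrow> f m = \<one>" "x \<in> topspace M"
  shows "inf_prod J f x = x"
  using assms by (auto simp: inf_prod_def supp_def one_app)

lemma inf_prod_closed:
  assumes nf: "null_family J D" and f: "supported J D f" and x: "x \<in> topspace M"
  shows "inf_prod J f x \<in> topspace M"
proof (cases "\<exists>m\<in>J. x \<in> D m")
  case True
  then show ?thesis
    using f x by (auto simp: inf_prod_in[OF nf f] supported_def app_closed)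
qed (use inf_prod_out[OF f x] x in auto)

text \<open>Only a point \<open>x\<close> outside every \<open>D m\<close> is delicate. Near it, a
  factor with \<open>D m\<close> inside \<open>N\<close> keeps the points of \<open>D m\<close> in
  \<open>N\<close>; the finitely many other factors are continuous and fix \<open>x\<close>.\<close>

lemma inf_prod_continuous:
  assumes nf: "null_family J D" and f: "supported J D f"
  shows "continuous_map M M (inf_prod J f)"
  unfolding continuous_map_eq_topcontinuous_at topcontinuous_at_def
proof (intro ballI conjI allI impI)
  fix x assume x: "x \<in> topspace M"
  then show "x \<in> topspace M" .
  show "inf_prod J f \<in> topspace M \<rightarrow> topspace M"
    using inf_prod_closed[OF nf f] by blast
  fix N assume N: "openin M N \<and> inf_prod J f x \<in> N"
  have pre: "openin M {y \<in> topspace M. f m y \<in> N}" if "m \<in> J" for m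
  proof (rule openin_continuous_map_preimage)
    show "continuous_map M M (f m)"
      using that f by (simp add: supported_def carrier_hmap homeomorphic_imp_continuous_map)
  qed (use N in simp)
  show "\<exists>U. openin M U \<and> x \<in> U \<and> (\<forall>y\<in>U. inf_prod J f y \<in> N)"
  proof (cases "\<exists>m\<in>J. x \<in> D m")
    case True
    then obtain m where m: "m \<in> J" "x \<in> D m"
      by blast
    have "openin M (D m \<inter> {y \<in> topspace M. f m y \<in> N})"
      using nf m pre by (intro openin_Int) (auto simp: null_family_def)
    moreover have "x \<in> D m \<inter> {y \<in> topspace M. f m y \<in> N}"
      using m x N inf_prod_in[OF nf f m] by simp
    moreover have "\<forall>y\<in>D m \<inter> {y \<in> topspace M. f m y \<in> N}. inf_prod J f y \<in> N"
      using inf_prod_in[OF nf f m(1)] by simp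
    ultimately show ?thesis
      by blast
  next
    case False
    then have Fx: "inf_prod J f x = x"
      using inf_prod_out[OF f x] by blast
    then obtain N0 where N0: "openin M N0" "x \<in> N0" and fin: "finite {m \<in> J. D m \<inter> N0 \<noteq> {} \<and> \<not> D m \<subseteq> N}"
    proof -
      have "openin M N \<and> x \<in> N"
        using N Fx by simp
      then show thesis
        using nf that unfolding null_family_def by blast
    qed
    define B where "B = {m \<in> J. D m \<inter> N0 \<noteq> {} \<and> \<not> D m \<subseteq> N}"
    define U where "U = N \<inter> N0 \<inter> (\<Inter>m\<in>B. {y \<in> topspace M. f m y \<in> N})"
    have "openin M U"
    proof (cases "B = {}")
      case False
      then show ?thesis
        unfolding U_def using fin N N0 pre by (intro openin_Int openin_INT2) (auto simp: B_def)
    qed (use N N0 in \<open>simp add: U_def openin_Int\<close>)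
    moreover have "x \<in> U"
    proof -
      have "f m x = x" if "m \<in> J" for m
        using that False f x by (auto simp: supported_def intro!: app_notin_supp)
      then show ?thesis
        using N N0 Fx x by (simp add: U_def B_def)
    qed
    moreover have "inf_prod J f y \<in> N" if y: "y \<in> U" for y
    proof -
      have yM: "y \<in> topspace M"
        using y N openin_subset by (auto simp: U_def)
      show ?thesis
      proof (cases "\<exists>m\<in>J. y \<in> D m")
        case True
        then obtain m where m: "m \<in> J" "y \<in> D m"
          by blast
        show ?thesis
        proof (cases "D m \<subseteq> N")
          case True
          then show ?thesis
            using inf_prod_in[OF nf f m] supported_in[OF f m yM] by auto
        next
          case False
          then have "m \<in> B"
            using m y by (auto simp: B_def U_def)
          then show ?thesis
            using inf_prod_in[OF nf f m] y by (auto simp: U_def)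
        qed
      next
        case False
        then show ?thesis
          using inf_prod_out[OF f yM] y by (auto simp: U_def)
      qed
    qed
    ultimately show ?thesis
      by blast
  qed
qed

lemma inf_prod_carrier:
  assumes nf: "null_family J D" and f: "supported J D f"
  shows "inf_prod J f \<in> carrier G"
proof -
  have f': "supported J D (\<lambda>m. inv (f m))"
    using f by (rule supported_inv)
  have "inf_prod J f (inf_prod J (\<lambda>m. inv (f m)) x) = x"
    "inf_prod J (\<lambda>m. inv (f m)) (inf_prod J f x) = x" if "x \<in> topspace M" for x
    unfolding inf_prod_mult_app[OF nf f f' that] inf_prod_mult_app[OF nf f' f that]
    using f that by (auto simp: supported_def intro!: inf_prod_one_app)
  then have "homeomorphic_maps M M (inf_prod J f) (inf_prod J (\<lambda>m. inv (f m)))"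
    unfolding homeomorphic_maps_def using inf_prod_continuous[OF nf] f f' by blast
  then show ?thesis
    by (auto simp: carrier_iff homeomorphic_map_maps inf_prod_def)
qed

lemma inf_prod_mult:
  assumes nf: "null_family J D" and f: "supported J D f" and g: "supported J D g"
  shows "inf_prod J f \<otimes> inf_prod J g = inf_prod J (\<lambda>m. f m \<otimes> g m)"
  using assms
  by (intro homeo_eqI) (auto simp: inf_prod_carrier supported_mult mult_app inf_prod_mult_app)

lemma inf_prod_inv:
  assumes nf: "null_family J D" and f: "supported J D f"
  shows "inv (inf_prod J f) = inf_prod J (\<lambda>m. inv (f m))"
proof (rule inv_equality)
  have "inf_prod J (\<lambda>m. inv (f m) \<otimes> f m) = \<one>"
    using inf_prod_carrier[OF nf supported_mult[OF supported_inv[OF f] f]] f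
    by (intro homeo_eqI) (auto simp: one_app supported_def intro!: inf_prod_one_app)
  then show "inf_prod J (\<lambda>m. inv (f m)) \<otimes> inf_prod J f = \<one>"
    by (simp add: inf_prod_mult[OF nf supported_inv[OF f] f])
qed (use inf_prod_carrier[OF nf] f supported_inv in auto)

lemma supp_inf_prod:
  assumes nf: "null_family J D" and f: "supported J D f"
  shows "supp M (inf_prod J f) = (\<Union>m\<in>J. supp M (f m))"
proof (intro equalityI subsetI)
  fix x assume x: "x \<in> supp M (inf_prod J f)"
  then have xM: "x \<in> topspace M" "inf_prod J f x \<noteq> x"
    by (auto simp: supp_def)
  then obtain m where m: "m \<in> J" "x \<in> D m"
    using inf_prod_out[OF f] by blast
  then show "x \<in> (\<Union>m\<in>J. supp M (f m))"
    using xM inf_prod_in[OF nf f m] by (auto simp: supp_def)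
next
  fix x assume "x \<in> (\<Union>m\<in>J. supp M (f m))"
  then obtain m where m: "m \<in> J" "x \<in> supp M (f m)"
    by blast
  then have "x \<in> D m"
    using f by (auto simp: supported_def)
  then show "x \<in> supp M (inf_prod J f)"
    using m inf_prod_in[OF nf f m(1)] by (simp add: supp_def)
qed

end

text \<open>Indices are accepted in increasing order: \<open>m\<close> is taken if it is admissible
  and compatible with every earlier accepted index. The range \<open>{..<m}\<close> makes the
  recursion terminate; the equation would loop as a rewrite rule.\<close>

fun greedy :: "(nat \<Rightarrow> nat \<Rightarrow> bool) \<Rightarrow> (nat \<Rightarrow> bool) \<Rightarrow> nat \<Rightarrow> bool" where
  "greedy R P m \<longleftrightarrow> P m \<and> (\<forall>l\<in>{..<m}. greedy R P l \<longrightarrow> R l m)"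

declare greedy.simps [simp del]

section \<open>Dense null families of balls and elements coding open sets\<close>

context manifold
begin

lemma unit_vec_nonzero: "unit_vec i \<noteq> (\<lambda>i. 0)"
proof
  assume "unit_vec i = (\<lambda>i. 0)"
  then have "unit_vec i i = 0"
    by simp
  then show False
    by (simp add: unit_vec_def)
qed

lemma countable_basis:
  obtains B :: "nat \<Rightarrow> 'a set" where "\<And>i. openin M (B i)"
    "\<And>U x. openin M U \<Longrightarrow> x \<in> U \<Longrightarrow> \<exists>i. x \<in> B i \<and> B i \<subseteq> U"
proof -
  obtain \<B> where \<B>: "countable \<B>" "\<And>V. V \<in> \<B> \<Longrightarrow> openin M V"
    "\<And>U x. openin M U \<Longrightarrow> x \<in> U \<Longrightarrow> \<exists>V\<in>\<B>. x \<in> V \<and> V \<subseteq> U"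
    using second_countable unfolding second_countable_space_def by metis
  define B where "B = from_nat_into (insert {} \<B>)"
  have range: "range B = insert {} \<B>"
    using \<B>(1) by (simp add: B_def range_from_nat_into)
  show thesis
  proof
    show "openin M (B i)" for i
      using range \<B>(2) by (metis insert_iff openin_empty rangeI)
    show "\<exists>i. x \<in> B i \<and> B i \<subseteq> U" if "openin M U" "x \<in> U" for U x
      using \<B>(3)[OF that] range by (metis insertI2 imageE)
  qed
qed

text \<open>Nullity is arranged against a countable basis. Once \<open>m\<close> exceeds the code of
  a pair \<open>(a, b)\<close> with the closure of \<open>B a\<close> inside \<open>B b\<close>, the
  \<open>m\<close>-th ball lies in \<open>B b\<close> or misses \<open>B a\<close>, so each pair has
  finitely many exceptions. Density comes from greedy selection: a ball rejected inside
  \<open>B i\<close> meets an earlier closed ball, whose interior ball then meets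
  \<open>B i\<close>.\<close>

lemma dense_null_family:
  assumes \<Omega>: "openin M \<Omega>"
  obtains J \<phi> where "\<And>m. m \<in> J \<Longrightarrow> ball_chart n M (\<phi> m)" "\<And>m. m \<in> J \<Longrightarrow> \<phi> m ` unit_cball n \<subseteq> \<Omega>"
    "null_family J (\<lambda>m. \<phi> m ` unit_ball n)" "\<Omega> \<subseteq> M closure_of (\<Union>m\<in>J. \<phi> m ` unit_ball n)"
proof -
  obtain B :: "nat \<Rightarrow> 'a set" where B: "\<And>i. openin M (B i)"
    "\<And>U x. openin M U \<Longrightarrow> x \<in> U \<Longrightarrow> \<exists>i. x \<in> B i \<and> B i \<subseteq> U"
    using countable_basis by metis
  define small where "small = (\<lambda>a b C. M closure_of B a \<subseteq> B b \<longrightarrow> C \<subseteq> B b \<or> C \<inter> B a = {})"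
  have ex: "\<exists>\<phi>. ball_chart n M \<phi> \<and> \<phi> ` unit_cball n \<subseteq> B m \<inter> \<Omega> \<and>
      (\<forall>a b. prod_encode (a, b) < m \<longrightarrow> small a b (\<phi> ` unit_cball n))" if ne: "B m \<inter> \<Omega> \<noteq> {}" for m
  proof -
    obtain y where y: "y \<in> B m" "y \<in> \<Omega>"
      using ne by blast
    have yM: "y \<in> topspace M"
      using y(2) \<Omega> openin_subset by blast
    \<comment> \<open>A neighbourhood of \<open>y\<close> that settles the alternative for the pair
      \<open>(a, b)\<close>: if \<open>y\<close> is not in \<open>B b\<close>, it is not in the
      closure of \<open>B a\<close> either.\<close>
    define Y where "Y = (\<lambda>(a, b). if M closure_of B a \<subseteq> B b then (if y \<in> B b then B b else topspace M - M closure_of B a)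
      else topspace M)"
    have Y: "openin M (Y r)" "y \<in> Y r" for r
      using yM B(1) by (auto simp: Y_def split: prod.split)
    \<comment> \<open>For \<open>m = 0\<close> the indexed intersection is the whole type; cutting
      with \<open>topspace M\<close> keeps it open in \<open>M\<close>.\<close>
    define W where "W = B m \<inter> \<Omega> \<inter> ((\<Inter>r<m. Y (prod_decode r)) \<inter> topspace M)"
    have "openin M ((\<Inter>r<m. Y (prod_decode r)) \<inter> topspace M)"
    proof (cases "m = 0")
      case False
      then show ?thesis
        using Y(1) by (intro openin_Int openin_INT2) auto
    qed simp
    then have W: "openin M W"
      unfolding W_def using openin_Int[OF B(1) \<Omega>] by (rule openin_Int[rotated])
    have yW: "y \<in> W"
      using y yM Y(2) by (simp add: W_def)
    obtain \<phi> where \<phi>: "ball_chart n M \<phi>" "\<phi> ` unit_cball n \<subseteq> W"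
      using chart_exists[OF W yW] by blast
    have "small a b (\<phi> ` unit_cball n)" if "prod_encode (a, b) < m" for a b
    proof -
      have "W \<subseteq> Y (a, b)"
      proof
        fix z assume "z \<in> W"
        then have "z \<in> Y (prod_decode (prod_encode (a, b)))"
          using that unfolding W_def by blast
        then show "z \<in> Y (a, b)"
          by simp
      qed
      moreover have "B a \<subseteq> M closure_of B a"
        using B(1) by (simp add: closure_of_subset openin_subset)
      ultimately show ?thesis
        using \<phi>(2) unfolding small_def Y_def by (auto split: if_splits)
    qed
    moreover have "W \<subseteq> B m \<inter> \<Omega>"
      by (auto simp: W_def)
    ultimately show ?thesis
      using \<phi> by blast
  qed
  then obtain \<phi> where \<phi>: "\<And>m. B m \<inter> \<Omega> \<noteq> {} \<Longrightarrow> ball_chart n M (\<phi> m) \<and> \<phi> m ` unit_cball n \<subseteq> B m \<inter> \<Omega> \<and>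
      (\<forall>a b. prod_encode (a, b) < m \<longrightarrow> small a b (\<phi> m ` unit_cball n))"
    by metis
  define C where "C = (\<lambda>m. \<phi> m ` unit_cball n)"
  define D where "D = (\<lambda>m. \<phi> m ` unit_ball n)"
  define J where "J = Collect (greedy (\<lambda>l m. C l \<inter> C m = {}) (\<lambda>m. B m \<inter> \<Omega> \<noteq> {}))"
  have J: "m \<in> J \<longleftrightarrow> B m \<inter> \<Omega> \<noteq> {} \<and> (\<forall>l<m. l \<in> J \<longrightarrow> C l \<inter> C m = {})" for m
    unfolding J_def mem_Collect_eq by (subst greedy.simps) auto
  have DC: "D m \<subseteq> C m" for m
    using unit_ball_subset by (auto simp: C_def D_def)
  have disj: "C m \<inter> C k = {}" if "m \<in> J" "k \<in> J" "m \<noteq> k" for m k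
    using that J by (metis Int_commute linorder_neqE_nat)
  show thesis
  proof
    show "ball_chart n M (\<phi> m)" "\<phi> m ` unit_cball n \<subseteq> \<Omega>" if "m \<in> J" for m
      using that \<phi>[of m] J by blast+
    then have D_open: "openin M (D m)" if "m \<in> J" for m
      using that by (auto simp: D_def ball_chart_def)
    show "null_family J (\<lambda>m. \<phi> m ` unit_ball n)"
      unfolding null_family_def D_def[symmetric]
    proof (intro conjI allI impI ballI)
      show "D m \<inter> D k = {}" if "m \<in> J" "k \<in> J" "m \<noteq> k" for m k
        using disj[OF that] DC by blast
      fix N x assume N: "openin M N \<and> x \<in> N"
      then obtain b where b: "x \<in> B b" "B b \<subseteq> N"
        using B(2) by blast
      obtain \<psi> where \<psi>: "ball_chart n M \<psi>" "x \<in> \<psi> ` unit_ball n" "\<psi> ` unit_cball n \<subseteq> B b"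
        using chart_exists[OF B(1) b(1)] .
      obtain a where a: "x \<in> B a" "B a \<subseteq> \<psi> ` unit_ball n"
        using B(2) \<psi>(1,2) unfolding ball_chart_def by meson
      have "M closure_of B a \<subseteq> \<psi> ` unit_cball n"
      proof (rule closure_of_minimal)
        show "B a \<subseteq> \<psi> ` unit_cball n"
          using a(2) unit_ball_subset by blast
        show "closedin M (\<psi> ` unit_cball n)"
          using chart_compact[OF \<psi>(1)] Hausdorff compactin_imp_closedin by blast
      qed
      then have ab: "M closure_of B a \<subseteq> B b"
        using \<psi>(3) by blast
      have "m \<le> prod_encode (a, b)" if "m \<in> J" "D m \<inter> B a \<noteq> {}" "\<not> D m \<subseteq> N" for m
      proof (rule ccontr)
        assume "\<not> m \<le> prod_encode (a, b)"
        then have "small a b (C m)"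
          using \<phi>[of m] J[of m] that(1) by (auto simp: C_def)
        then show False
          using ab that DC[of m] b(2) unfolding small_def by blast
      qed
      then have "finite {m \<in> J. D m \<inter> B a \<noteq> {} \<and> \<not> D m \<subseteq> N}"
        by (intro finite_subset[OF _ finite_atMost[of "prod_encode (a, b)"]]) auto
      then show "\<exists>N'. openin M N' \<and> x \<in> N' \<and> finite {m \<in> J. D m \<inter> N' \<noteq> {} \<and> \<not> D m \<subseteq> N}"
        using B(1)[of a] a(1) by blast
    qed (use D_open in auto)
    show "\<Omega> \<subseteq> M closure_of (\<Union>m\<in>J. \<phi> m ` unit_ball n)"
      unfolding D_def[symmetric]
    proof
      fix x assume x: "x \<in> \<Omega>"
      show "x \<in> M closure_of (\<Union>m\<in>J. D m)"
        unfolding in_closure_of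
      proof (intro conjI allI impI)
        show "x \<in> topspace M"
          using x \<Omega> openin_subset by blast
        fix T assume T: "x \<in> T \<and> openin M T"
        then obtain i where i: "x \<in> B i" "B i \<subseteq> T \<inter> \<Omega>"
          using B(2)[of "T \<inter> \<Omega>" x] x \<Omega> by blast
        have "B i \<inter> \<Omega> \<noteq> {}"
          using i x by blast
        then have \<phi>i: "C i \<subseteq> B i"
          using \<phi>[of i] by (auto simp: C_def)
        have zero: "(\<lambda>_. 0) \<in> unit_ball n"
          by (simp add: unit_ball_def)
        show "\<exists>y. y \<in> (\<Union>m\<in>J. D m) \<and> y \<in> T"
        proof (cases "i \<in> J")
          case True
          then show ?thesis
            using zero \<phi>i DC[of i] i(2) unfolding D_def by blast
        next
          case False
          then obtain l where l: "l \<in> J" "C l \<inter> C i \<noteq> {}"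
            using J[of i] \<open>B i \<inter> \<Omega> \<noteq> {}\<close> by blast
          have "C l \<subseteq> M closure_of D l"
            using l(1) J[of l] \<phi>[of l] chart_closure unfolding C_def D_def by blast
          then have "B i \<inter> M closure_of D l \<noteq> {}"
            using l(2) \<phi>i by blast
          then have "B i \<inter> D l \<noteq> {}"
            using openin_Int_closure_of_eq_empty[OF B(1)] by blast
          then show ?thesis
            using l(1) i(2) by blast
        qed
      qed
    qed
  qed
qed

text \<open>Translating in every ball of a dense null family moves exactly the points of the balls.
  The support need not be all of \<open>\<Omega>\<close>, but it is dense in it, and only interiors
  of closures are ever compared.\<close>

lemma regular_open_coded:
  assumes "openin M \<Omega>"
  obtains b where "b \<in> carrier G" "supp M b \<subseteq> \<Omega>" "\<Omega> \<subseteq> M closure_of supp M b"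
proof -
  obtain J \<phi> where \<phi>: "\<And>m. m \<in> J \<Longrightarrow> ball_chart n M (\<phi> m)" "\<And>m. m \<in> J \<Longrightarrow> \<phi> m ` unit_cball n \<subseteq> \<Omega>"
    "null_family J (\<lambda>m. \<phi> m ` unit_ball n)" "\<Omega> \<subseteq> M closure_of (\<Union>m\<in>J. \<phi> m ` unit_ball n)"
    using dense_null_family[OF assms] by metis
  define f where "f = (\<lambda>m. chart_affine n M (\<phi> m) 1 (unit_vec 0))"
  have v: "unit_vec 0 \<in> eucl n" "unit_vec 0 \<noteq> (\<lambda>i. 0)"
    using dim_pos by (auto simp: unit_vec_eucl unit_vec_nonzero)
  have s: "supp M (f m) = \<phi> m ` unit_ball n" if "m \<in> J" for m
    using that \<phi>(1) v by (simp add: f_def supp_chart_translation)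
  have f: "supported J (\<lambda>m. \<phi> m ` unit_ball n) f"
    using s \<phi>(1) v by (simp add: supported_def) (simp add: f_def chart_affine_carrier)
  have "supp M (inf_prod J f) = (\<Union>m\<in>J. \<phi> m ` unit_ball n)"
    using supp_inf_prod[OF \<phi>(3) f] s by simp
  moreover have "(\<Union>m\<in>J. \<phi> m ` unit_ball n) \<subseteq> \<Omega>"
    using \<phi>(2) unit_ball_subset by blast
  ultimately show thesis
    using that[of "inf_prod J f"] inf_prod_carrier[OF \<phi>(3) f] \<phi>(4) by simp
qed

lemma coded_basis:
  assumes "topspace M \<noteq> {}"
  shows "\<exists>b :: nat \<Rightarrow> 'a \<Rightarrow> 'a. (\<forall>i. b i \<in> carrier G \<and> b i \<noteq> \<one>) \<and>
    (\<forall>K \<Omega>. compactin M K \<and> openin M \<Omega> \<and> K \<subseteq> \<Omega> \<and> \<Omega> \<noteq> {} \<longrightarrow>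
       (\<exists>i. K \<subseteq> M interior_of M closure_of supp M (b i) \<and> supp M (b i) \<subseteq> \<Omega>))"
proof -
  obtain B :: "nat \<Rightarrow> 'a set" where B: "\<And>i. openin M (B i)"
    "\<And>U x. openin M U \<Longrightarrow> x \<in> U \<Longrightarrow> \<exists>i. x \<in> B i \<and> B i \<subseteq> U"
    using countable_basis by metis
  \<comment> \<open>Finite unions, indexed by lists, can be squeezed between a compact and an open
    set. The default \<open>topspace M\<close> keeps \<open>W l\<close> nonempty, so that its code
    is not the identity.\<close>
  define W where "W = (\<lambda>l. if (\<Union>i\<in>set l. B i) = {} then topspace M else (\<Union>i\<in>set l. B i))"
  have W: "openin M (W l)" "W l \<noteq> {}" for l
    using assms B(1) by (auto simp: W_def)
  have "\<exists>b\<in>carrier G. supp M b \<subseteq> W l \<and> W l \<subseteq> M closure_of supp M b" for l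
    using regular_open_coded[OF W(1)] by metis
  then obtain b where b: "\<And>l. b l \<in> carrier G" "\<And>l. supp M (b l) \<subseteq> W l"
    "\<And>l. W l \<subseteq> M closure_of supp M (b l)"
    by metis
  have ne: "b l \<noteq> \<one>" for l
    using b(3)[of l] W(2)[of l] b(1) supp_empty_iff[of "b l"] by auto
  have approx: "\<exists>l. K \<subseteq> M interior_of M closure_of supp M (b l) \<and> supp M (b l) \<subseteq> \<Omega>"
    if K: "compactin M K" "openin M \<Omega>" "K \<subseteq> \<Omega>" "\<Omega> \<noteq> {}" for K \<Omega>
  proof -
    obtain x where x: "x \<in> \<Omega>"
      using K(4) by blast
    have xM: "x \<in> topspace M"
      using x K(2) openin_subset by blast
    \<comment> \<open>The extra point \<open>x\<close> matters for empty \<open>K\<close>: it makes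
      the finite cover nonempty, so the default value of \<open>W\<close> does not
      intervene.\<close>
    have cK: "compactin M (insert x K)"
      using compactin_Un[of M "{x}" K] K(1) xM by simp
    have sub: "insert x K \<subseteq> \<Union> (B ` {i. B i \<subseteq> \<Omega>})"
      using B(2)[OF K(2)] x K(3) by blast
    have opn: "openin M U" if "U \<in> B ` {i. B i \<subseteq> \<Omega>}" for U
      using that B(1) by auto
    obtain \<F> where \<F>: "finite \<F>" "\<F> \<subseteq> B ` {i. B i \<subseteq> \<Omega>}" "insert x K \<subseteq> \<Union>\<F>"
      using compactinD[OF cK opn sub] by blast
    then obtain I where I: "finite I" "I \<subseteq> {i. B i \<subseteq> \<Omega>}" "\<F> = B ` I"
      by (meson finite_subset_image)
    obtain l where l: "set l = I"
      using I(1) finite_list by blast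
    have Wl: "W l = \<Union>\<F>"
      using \<F>(3) I(3) l by (auto simp: W_def)
    have "W l \<subseteq> M interior_of M closure_of supp M (b l)"
      using b(3) W(1) by (simp add: interior_of_maximal)
    moreover have "W l \<subseteq> \<Omega>"
      using Wl I by blast
    ultimately show ?thesis
      using b(2)[of l] \<F>(3) Wl by blast
  qed
  show ?thesis
  proof (intro exI[of _ "\<lambda>i. b (from_nat i)"] conjI allI impI)
    show "b (from_nat i) \<in> carrier G" "b (from_nat i) \<noteq> \<one>" for i
      using b(1) ne by auto
    show "\<exists>i. K \<subseteq> M interior_of M closure_of supp M (b (from_nat i)) \<and> supp M (b (from_nat i)) \<subseteq> \<Omega>"
      if "compactin M K \<and> openin M \<Omega> \<and> K \<subseteq> \<Omega> \<and> \<Omega> \<noteq> {}" for K \<Omega>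
      using approx[of K \<Omega>] that by (metis from_nat_to_nat)
  qed
qed

end

section \<open>A finitely generated group with arbitrarily small supports\<close>

lemma (in locally_moving) noncommuting:
  assumes W: "openin M W" "x \<in> W"
  obtains f g where "f \<in> carrier G" "g \<in> carrier G" "supp M f \<subseteq> W" "supp M g \<subseteq> W" "f \<otimes> g \<noteq> g \<otimes> f"
proof -
  obtain f where f: "f \<in> carrier G" "supp M f \<subseteq> W" "x \<in> supp M f"
    using moving1[OF W] .
  obtain V where V: "openin M V" "x \<in> V" "f ` V \<inter> V = {}"
    using separate[OF f(1,3)] .
  obtain g where g: "g \<in> carrier G" "supp M g \<subseteq> W \<inter> V" "x \<in> supp M g"
    using moving1[of "W \<inter> V" x] W V by blast
  have xM: "x \<in> topspace M"
    using W openin_subset by blast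
  have "f x \<notin> supp M g"
    using V g(2) by blast
  then have "(g \<otimes> f) x = f x"
    using xM f by (simp add: mult_app app_notin_supp app_closed)
  moreover have "(f \<otimes> g) x \<noteq> f x"
    using xM f g by (simp add: mult_app app_eq_iff app_closed) (simp add: supp_def)
  ultimately have "f \<otimes> g \<noteq> g \<otimes> f"
    by metis
  then show thesis
    using that f g by blast
qed

lemma (in homeo_space) inf_prod_cong:
  assumes nf: "null_family J D" and f: "supported J D f" and eq: "\<And>m. m \<in> J \<Longrightarrow> f m = g m"
  shows "inf_prod J f = inf_prod J g"
proof -
  have g: "supported J D g"
    using f eq by (simp add: supported_def)
  have "inf_prod J f x = inf_prod J g x" if x: "x \<in> topspace M" for x
  proof (cases "\<exists>m\<in>J. x \<in> D m")
    case True
    then show ?thesis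
      using inf_prod_in[OF nf f] inf_prod_in[OF nf g] eq by auto
  next
    case False
    then show ?thesis
      using inf_prod_out[OF f x] inf_prod_out[OF g x] by auto
  qed
  then show ?thesis
    using inf_prod_carrier[OF nf] f g by (intro homeo_eqI) auto
qed

lemma (in group) commutator_trivial:
  assumes "a \<in> carrier G" "b \<in> carrier G" "a \<otimes> b = b \<otimes> a"
  shows "a \<otimes> b \<otimes> inv a \<otimes> inv b = \<one>"
proof -
  have "a \<otimes> b \<otimes> inv a \<otimes> inv b = b \<otimes> (a \<otimes> inv a) \<otimes> inv b"
    using assms by (simp add: m_assoc)
  then show ?thesis
    using assms by simp
qed

lemma (in group) commutator_nontrivial:
  assumes "a \<in> carrier G" "b \<in> carrier G" "a \<otimes> b \<otimes> inv a \<otimes> inv b = \<one>"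
  shows "a \<otimes> b = b \<otimes> a"
proof -
  have "a \<otimes> b = (a \<otimes> b \<otimes> inv a \<otimes> inv b) \<otimes> (b \<otimes> a)"
    using assms(1,2) by (simp add: m_assoc) (simp flip: m_assoc)
  then show ?thesis
    using assms by simp
qed

section \<open>The affine group acting in all balls at once\<close>

context manifold
begin

text \<open>\<open>L\<close> contains every dyadic vector, as an integer combination of unit vectors
  halved \<open>k\<close> times. Rounding each of the \<open>n\<close> coordinates of
  \<open>x\<close> down to a multiple of \<open>1 / 2^k\<close> costs at most \<open>n / 2^k\<close>
  in total.\<close>

lemma dyadic_translations_dense:
  assumes add: "\<And>v w. v \<in> L \<Longrightarrow> w \<in> L \<Longrightarrow> (\<lambda>i. v i + w i) \<in> L"
    and neg: "\<And>v. v \<in> L \<Longrightarrow> (\<lambda>i. - v i) \<in> L"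
    and half: "\<And>v. v \<in> L \<Longrightarrow> (\<lambda>i. v i / 2) \<in> L"
    and zero: "(\<lambda>i. 0) \<in> L"
    and basis: "\<And>i. i < n \<Longrightarrow> unit_vec i \<in> L"
    and e: "e > 0"
  shows "\<exists>v\<in>L. nrm n (\<lambda>i. v i - x i) < e"
proof -
  have nat_mult: "(\<lambda>j. real m * unit_vec i j) \<in> L" if "i < n" for i m
  proof (induction m)
    case (Suc m)
    show ?case
      using add[OF Suc basis[OF that]] by (simp add: algebra_simps)
  qed (simp add: zero)
  have int_mult: "(\<lambda>j. real_of_int z * unit_vec i j) \<in> L" if "i < n" for i z
  proof (cases "z \<ge> 0")
    case True
    then show ?thesis
      using nat_mult[OF that, of "nat z"] by simp
  next
    case False
    then show ?thesis
      using neg[OF nat_mult[OF that, of "nat (- z)"]] by simp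
  qed
  have int_vec: "(\<lambda>i. if i < m then real_of_int (z i) else 0) \<in> L" if "m \<le> n" for m z
    using that
  proof (induction m)
    case (Suc m)
    then have "(\<lambda>j. (if j < m then real_of_int (z j) else 0) + real_of_int (z m) * unit_vec m j) \<in> L"
      by (intro add int_mult Suc.IH) auto
    moreover have "(\<lambda>j. (if j < m then real_of_int (z j) else 0) + real_of_int (z m) * unit_vec m j) =
        (\<lambda>i. if i < Suc m then real_of_int (z i) else 0)"
      by (auto simp: unit_vec_def fun_eq_iff less_Suc_eq)
    ultimately show ?case
      by simp
  qed (simp add: zero)
  have dyadic: "(\<lambda>i. (if i < n then real_of_int (z i) else 0) / 2 ^ k) \<in> L" for z k
  proof (induction k)
    case 0
    then show ?case
      using int_vec[of n z] by simp
  next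
    case (Suc k)
    then show ?case
      using half[OF Suc] by (simp add: mult.commute)
  qed
  obtain k where k: "real n / e < 2 ^ k"
    using real_arch_pow[of 2 "real n / e"] by auto
  define v where "v = (\<lambda>i. (if i < n then real_of_int \<lfloor>x i * 2 ^ k\<rfloor> else 0) / 2 ^ k)"
  have "\<bar>v i - x i\<bar> \<le> 1 / 2 ^ k" if "i < n" for i
  proof -
    have "v i - x i = (real_of_int \<lfloor>x i * 2 ^ k\<rfloor> - x i * 2 ^ k) / 2 ^ k"
      using that by (simp add: v_def field_simps)
    moreover have "\<bar>real_of_int \<lfloor>x i * 2 ^ k\<rfloor> - x i * 2 ^ k\<bar> \<le> 1"
      by linarith
    ultimately show ?thesis
      by (simp add: divide_right_mono)
  qed
  then have "nrm n (\<lambda>i. v i - x i) \<le> (\<Sum>i<n. 1 / 2 ^ k)"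
    unfolding nrm_def by (intro sum_mono) auto
  also have "\<dots> = real n / 2 ^ k"
    by simp
  also have "\<dots> < e"
    using k e by (simp add: field_simps)
  finally have "nrm n (\<lambda>i. v i - x i) < e" .
  moreover have "v \<in> L"
    unfolding v_def by (rule dyadic)
  ultimately show ?thesis
    by blast
qed

text \<open>A word first isolates a single ball: \<open>w m\<close> is a nontrivial commutator
  supported in \<open>E m\<close>. Dyadic dilations and translations then carry \<open>E m\<close>
  into any nonempty open part of the \<open>m\<close>-th ball; they act in the other balls as well,
  which is harmless because \<open>w m\<close> is trivial there. By density every nonempty open set
  meets some ball.\<close>

lemma pi_base_generators:
  "\<exists>P. finite P \<and> P \<subseteq> carrier G \<and>
     (\<forall>U. openin M U \<and> U \<noteq> {} \<longrightarrow> (\<exists>w\<in>generate G P. w \<noteq> \<one> \<and> supp M w \<subseteq> U))"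
proof -
  obtain J \<phi> where chart: "\<And>m. m \<in> J \<Longrightarrow> ball_chart n M (\<phi> m)"
    and nf: "null_family J (\<lambda>m. \<phi> m ` unit_ball n)"
    and dense: "topspace M \<subseteq> M closure_of (\<Union>m\<in>J. \<phi> m ` unit_ball n)"
    using dense_null_family[OF openin_topspace] by metis
  define D where "D = (\<lambda>m. \<phi> m ` unit_ball n)"
  note nf = nf[folded D_def]
  define a where "a = (\<lambda>l v m. chart_affine n M (\<phi> m) l v)"
  define A where "A = (\<lambda>l v. inf_prod J (a l v))"
  have a_sup: "supported J D (a l v)" if "l > 0" "v \<in> eucl n" for l v
    using that chart chart_affine_carrier supp_chart_affine by (auto simp: supported_def a_def D_def)
  have A_carrier: "A l v \<in> carrier G" if "l > 0" "v \<in> eucl n" for l v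
    unfolding A_def using that by (intro inf_prod_carrier[OF nf] a_sup)
  have A_mult: "A l v \<otimes> A m w = A (l * m) (aff l v w)"
    if "l > 0" "m > 0" "v \<in> eucl n" "w \<in> eucl n" for l m v w
    unfolding A_def using that chart
    by (subst inf_prod_mult[OF nf]; (intro inf_prod_cong[OF nf] supported_mult a_sup)?)
      (auto simp: a_def chart_affine_mult)
  have A_one: "A 1 (\<lambda>i. 0) = \<one>"
    using A_carrier[of 1 "\<lambda>i. 0"] chart
    by (intro homeo_eqI) (auto simp: one_app A_def a_def chart_affine_one intro!: inf_prod_one_app)
  have A_app: "A l v (\<phi> m (shrink n x)) = \<phi> m (shrink n (aff l v x))"
    if "l > 0" "v \<in> eucl n" "m \<in> J" "x \<in> eucl n" for l v m x
  proof -
    have "\<phi> m (shrink n x) \<in> D m"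
      using that shrink_in by (auto simp: D_def)
    then have "A l v (\<phi> m (shrink n x)) = a l v m (\<phi> m (shrink n x))"
      unfolding A_def using that by (intro inf_prod_in[OF nf] a_sup)
    then show ?thesis
      using that chart by (simp add: a_def chart_affine_shrink)
  qed
  have A_inv: "inv (A l v) = A (1 / l) (\<lambda>i. - v i / l)" if "l > 0" "v \<in> eucl n" for l v
  proof (rule inv_equality)
    have e: "(\<lambda>i. - v i / l) \<in> eucl n" "aff (1 / l) (\<lambda>i. - v i / l) v = (\<lambda>i. 0)"
      using that by (auto simp: eucl_def aff_def)
    then show "A (1 / l) (\<lambda>i. - v i / l) \<otimes> A l v = \<one>"
      using that by (simp add: A_mult A_one)
    show "A l v \<in> carrier G" "A (1 / l) (\<lambda>i. - v i / l) \<in> carrier G"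
      using that e by (auto intro: A_carrier)
  qed
  define E where "E = (\<lambda>m. \<phi> m ` shrink n ` {x \<in> eucl n. nrm n x < 1})"
  have "openin (top_of_set (eucl n)) {x \<in> eucl n. nrm n x < 1}"
    using openin_unit_ball by (simp add: unit_ball_def)
  then have E_open: "openin M (E m)" if "m \<in> J" for m
    using that chart_open_image[OF chart] by (simp add: E_def)
  have E_ne: "\<phi> m (shrink n (\<lambda>i. 0)) \<in> E m" for m
    by (auto simp: E_def)
  have ED: "E m \<subseteq> D m" for m
    using shrink_in by (auto simp: E_def D_def)
  have "\<exists>f g. f \<in> carrier G \<and> g \<in> carrier G \<and> supp M f \<subseteq> E m \<and> supp M g \<subseteq> E m \<and> f \<otimes> g \<noteq> g \<otimes> f"
    if "m \<in> J" for m
    using noncommuting[OF E_open[OF that] E_ne] by metis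
  then obtain f g where fg: "\<And>m. m \<in> J \<Longrightarrow> f m \<in> carrier G \<and> g m \<in> carrier G \<and>
      supp M (f m) \<subseteq> E m \<and> supp M (g m) \<subseteq> E m \<and> f m \<otimes> g m \<noteq> g m \<otimes> f m"
    by metis
  have f_sup: "supported J D f" and g_sup: "supported J D g"
    using fg ED by (fastforce simp: supported_def)+
  \<comment> \<open>The factor 2 is the width of \<open>E k\<close> in direction 0: a shift by at
    least one unit of \<open>r\<close> moves \<open>E k\<close> off itself.\<close>
  define t where "t = (\<lambda>r i. 2 * r * unit_vec 0 i)"
  have t: "t r \<in> eucl n" for r
    using unit_vec_eucl[OF dim_pos] by (simp add: eucl_def t_def)
  define T where "T = (\<lambda>r. a 1 (t r))"
  have T_sup: "supported J D (T r)" for r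
    unfolding T_def by (intro a_sup t) simp
  have T_carrier: "T r m \<in> carrier G" if "m \<in> J" for r m
    using T_sup that by (simp add: supported_def)
  have T_mult: "T r m \<otimes> T s m = T (r + s) m" if "m \<in> J" for r s m
  proof -
    have "aff 1 (t r) (t s) = t (r + s)"
      by (auto simp: aff_def t_def algebra_simps)
    then show ?thesis
      using that chart t by (simp add: T_def a_def chart_affine_mult)
  qed
  have T_zero: "T 0 m = \<one>" if "m \<in> J" for m
    using that chart by (simp add: T_def a_def t_def chart_affine_one)
  have T_inv: "inv (T r m) = T (- r) m" if "m \<in> J" for r m
    using that T_mult[of m "- r" r] T_zero T_carrier by (intro inv_equality) auto
  text \<open>\<open>u\<close> carries \<open>f m\<close> at distance \<open>m\<close>: conjugating \<open>u\<close> by the \<open>m\<close>-th power of the shift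
    puts it back over \<open>g m\<close> in the \<open>m\<close>-th ball, and off \<open>E k\<close> in all others.\<close>
  define u where "u = inf_prod J (\<lambda>k. T (real k) k \<otimes> f k \<otimes> T (- real k) k)"
  define e where "e = inf_prod J g"
  define s where "s = (\<lambda>r. inf_prod J (T r))"
  have sA: "s r = A 1 (t r)" for r
    by (simp add: s_def A_def T_def)
  have Tk_sup: "supported J D (\<lambda>k. T (c * real k) k)" for c
    using T_sup by (auto simp: supported_def)
  have u_sup: "supported J D (\<lambda>k. T (real k) k \<otimes> f k \<otimes> T (- real k) k)"
    using Tk_sup[of 1] Tk_sup[of "-1"] f_sup by (intro supported_mult) auto
  \<comment> \<open>There are finitely many generators although \<open>J\<close> may be infinite,
    since each of them acts in all balls simultaneously.\<close>
  define P where "P = {A 2 (\<lambda>i. 0), u, e} \<union> (\<lambda>i. A 1 (unit_vec i)) ` {..<n}"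
  have u_carrier: "u \<in> carrier G" and e_carrier: "e \<in> carrier G"
    unfolding u_def e_def using u_sup g_sup by (auto intro: inf_prod_carrier[OF nf])
  then have P: "finite P" "P \<subseteq> carrier G"
    unfolding P_def by (auto intro: A_carrier unit_vec_eucl)
  interpret W: subgroup "generate G P" G
    using P by (intro generate_is_subgroup)
  have gen: "p \<in> P \<Longrightarrow> p \<in> generate G P" for p
    by (rule generate.incl)
  define L where "L = {v \<in> eucl n. A 1 v \<in> generate G P}"
  have L_eucl: "v \<in> eucl n" and L_gen: "A 1 v \<in> generate G P" if "v \<in> L" for v
    using that by (auto simp: L_def)
  have L_add: "(\<lambda>i. v i + w i) \<in> L" if "v \<in> L" "w \<in> L" for v w
  proof -
    have "A 1 v \<otimes> A 1 w = A 1 (\<lambda>i. v i + w i)"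
      using L_eucl that by (simp add: A_mult) (simp add: aff_def add.commute)
    then show ?thesis
      using that W.m_closed[OF L_gen[OF that(1)] L_gen[OF that(2)]] by (simp add: L_def eucl_def)
  qed
  have L_neg: "(\<lambda>i. - v i) \<in> L" if "v \<in> L" for v
    using that W.m_inv_closed[OF L_gen[OF that]] by (simp add: A_inv L_eucl) (simp add: L_def eucl_def)
  have A2: "A 2 (\<lambda>i. 0) \<in> generate G P"
    by (rule gen) (simp add: P_def)
  have Ahalf: "A (1 / 2) (\<lambda>i. 0) \<in> generate G P"
    using W.m_inv_closed[OF A2] by (simp add: A_inv)
  \<comment> \<open>Conjugating by the dilation halves the vector of a translation, which is how
    finitely many generators yield a dense set of translations.\<close>
  have L_half: "(\<lambda>i. v i / 2) \<in> L" if "v \<in> L" for v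
  proof -
    have h: "(\<lambda>i. v i / 2) \<in> eucl n"
      using L_eucl[OF that] by (simp add: eucl_def)
    have "aff (1 / 2) (\<lambda>i. 0) v = (\<lambda>i. v i / 2)" "aff (1 / 2) (\<lambda>i. v i / 2) (\<lambda>i. 0) = (\<lambda>i. v i / 2)"
      by (auto simp: aff_def)
    then have "A (1 / 2) (\<lambda>i. 0) \<otimes> A 1 v \<otimes> A 2 (\<lambda>i. 0) = A 1 (\<lambda>i. v i / 2)"
      using L_eucl[OF that] h by (simp add: A_mult)
    then show ?thesis
      using h W.m_closed[OF W.m_closed[OF Ahalf L_gen[OF that]] A2] by (simp add: L_def)
  qed
  have L_zero: "(\<lambda>i. 0) \<in> L"
    by (simp add: L_def A_one)
  have L_unit: "unit_vec i \<in> L" if "i < n" for i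
  proof -
    have "A 1 (unit_vec i) \<in> P"
      using that by (auto simp: P_def)
    then show ?thesis
      using that gen by (simp add: L_def unit_vec_eucl)
  qed
  have L_int: "(\<lambda>i. real m * v i) \<in> L" if "v \<in> L" for m v
  proof (induction m)
    case (Suc m)
    then show ?case
      using L_add[OF Suc that] by (simp add: algebra_simps)
  qed (simp add: L_zero)
  have s_gen: "s (real m) \<in> generate G P" for m
    using L_gen[OF L_int[OF L_unit[OF dim_pos], of "2 * m"]] by (simp add: sA t_def)
  have s_inv: "inv (s r) = s (- r)" for r
    using t by (simp add: sA A_inv) (simp add: t_def)
  have s_gen': "s (- real m) \<in> generate G P" for m
    using W.m_inv_closed[OF s_gen[of m]] by (simp add: s_inv)
  \<comment> \<open>The factor in ball \<open>k\<close> of \<open>u\<close> conjugated by the shift: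
    \<open>f k\<close> displaced by \<open>k - m\<close>, hence \<open>f m\<close> itself for
    \<open>k = m\<close>.\<close>
  define c where "c = (\<lambda>m k. T (- real m) k \<otimes> (T (real k) k \<otimes> f k \<otimes> T (- real k) k) \<otimes> T (real m) k)"
  define w where "w = (\<lambda>m. s (- real m) \<otimes> u \<otimes> s (real m) \<otimes> e \<otimes>
    inv (s (- real m) \<otimes> u \<otimes> s (real m)) \<otimes> inv e)"
  have w_gen: "w m \<in> generate G P" for m
    unfolding w_def by (intro W.m_closed W.m_inv_closed s_gen s_gen' gen) (auto simp: P_def)
  have c_sup: "supported J D (c m)" for m
    unfolding c_def by (intro supported_mult T_sup u_sup)
  have c_prod: "s (- real m) \<otimes> u \<otimes> s (real m) = inf_prod J (c m)" for m
    unfolding s_def u_def c_def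
    by (simp add: inf_prod_mult[OF nf] supported_mult T_sup u_sup)
  have w_sup: "supported J D (\<lambda>k. c m k \<otimes> g k \<otimes> inv (c m k) \<otimes> inv (g k))" for m
    by (intro supported_mult supported_inv c_sup g_sup)
  have w_prod: "w m = inf_prod J (\<lambda>k. c m k \<otimes> g k \<otimes> inv (c m k) \<otimes> inv (g k))" for m
    unfolding w_def c_prod e_def
    by (simp add: inf_prod_mult[OF nf] inf_prod_inv[OF nf] supported_mult supported_inv c_sup g_sup)
  have c_conj: "c m k = T (real k - real m) k \<otimes> f k \<otimes> inv (T (real k - real m) k)" if "k \<in> J" for m k
  proof -
    have "c m k = (T (- real m) k \<otimes> T (real k) k) \<otimes> f k \<otimes> (T (- real k) k \<otimes> T (real m) k)"
      using that fg T_carrier by (simp add: c_def m_assoc)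
    then show ?thesis
      using that by (simp add: T_mult T_inv)
  qed
  \<comment> \<open>For \<open>k\<close> different from \<open>m\<close> the displaced support lies
    off \<open>E k\<close>, where \<open>g k\<close> is supported, so the commutator vanishes in
    ball \<open>k\<close>.\<close>
  have far: "c m k \<otimes> g k = g k \<otimes> c m k" if k: "k \<in> J" "k \<noteq> m" for m k
  proof (rule commute_disjoint)
    show "c m k \<in> carrier G" "g k \<in> carrier G"
      using k c_sup fg by (auto simp: supported_def)
    let ?r = "real k - real m"
    have r: "\<bar>?r\<bar> \<ge> 1"
      using k(2) by linarith
    have "supp M (c m k) = T ?r k ` supp M (f k)"
      using k fg by (simp add: c_conj supp_conj T_carrier)
    also have "\<dots> \<subseteq> T ?r k ` E k"
      using k fg by blast
    also have "T ?r k ` E k \<inter> E k = {}"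
    proof (rule ccontr)
      assume "T ?r k ` E k \<inter> E k \<noteq> {}"
      then obtain x y where xy: "x \<in> eucl n" "nrm n x < 1" "y \<in> eucl n" "nrm n y < 1"
        "T ?r k (\<phi> k (shrink n x)) = \<phi> k (shrink n y)"
        by (auto simp: E_def)
      then have "y = aff 1 (t ?r) x"
        using k chart t by (simp add: T_def a_def chart_affine_shrink chart_inj aff_eucl)
      then have "y 0 = x 0 + 2 * ?r"
        by (simp add: aff_def t_def unit_vec_def)
      moreover have "\<bar>x 0\<bar> < 1" "\<bar>y 0\<bar> < 1"
        using nrm_coord[OF dim_pos, of x] nrm_coord[OF dim_pos, of y] xy by auto
      ultimately show False
        using r by (simp add: abs_less_iff abs_if split: if_splits)
    qed
    finally show "supp M (c m k) \<inter> supp M (g k) = {}"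
      using k fg by blast
  qed
  have w_supp: "supp M (w m) \<subseteq> E m" if m: "m \<in> J" for m
  proof
    fix x assume "x \<in> supp M (w m)"
    then obtain k where k: "k \<in> J" "x \<in> supp M (c m k \<otimes> g k \<otimes> inv (c m k) \<otimes> inv (g k))"
      unfolding w_prod supp_inf_prod[OF nf w_sup] by blast
    have ck: "c m k \<in> carrier G" "g k \<in> carrier G"
      using k c_sup fg by (auto simp: supported_def)
    have "k = m"
    proof (rule ccontr)
      assume "k \<noteq> m"
      then have "supp M (c m k \<otimes> g k \<otimes> inv (c m k) \<otimes> inv (g k)) = {}"
        using commutator_trivial[OF ck far] k(1) by (simp add: supp_empty_iff)
      with k(2) show False
        by simp
    qed
    have cm: "c m m = f m"
      using m fg by (simp add: c_conj T_zero)
    have "supp M (f m \<otimes> g m \<otimes> inv (f m) \<otimes> inv (g m)) \<subseteq> E m"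
      using m fg[OF m] supp_mult[of "f m \<otimes> g m \<otimes> inv (f m)" "inv (g m)"]
        supp_mult[of "f m \<otimes> g m" "inv (f m)"] supp_mult[of "f m" "g m"] supp_inv[of "f m"] supp_inv[of "g m"]
      by (simp, blast)
    then show "x \<in> E m"
      using k \<open>k = m\<close> cm by auto
  qed
  have w_ne: "w m \<noteq> \<one>" if m: "m \<in> J" for m
  proof
    assume "w m = \<one>"
    then have "supp M (w m) = {}"
      by (simp add: supp_empty_iff)
    then have "supp M (c m m \<otimes> g m \<otimes> inv (c m m) \<otimes> inv (g m)) = {}"
      unfolding w_prod supp_inf_prod[OF nf w_sup] using m by blast
    moreover have "c m m = f m"
      using m fg by (simp add: c_conj T_zero)
    ultimately have "f m \<otimes> g m \<otimes> inv (f m) \<otimes> inv (g m) = \<one>"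
      using fg[OF m] by (simp add: supp_empty_iff)
    then show False
      using fg[OF m] commutator_nontrivial by blast
  qed
  have "\<exists>w\<in>generate G P. w \<noteq> \<one> \<and> supp M w \<subseteq> U" if U: "openin M U" "U \<noteq> {}" for U
  proof -
    have "U \<inter> M closure_of (\<Union>m\<in>J. D m) \<noteq> {}"
      using U dense openin_subset unfolding D_def by blast
    then have "U \<inter> (\<Union>m\<in>J. D m) \<noteq> {}"
      using openin_Int_closure_of_eq_empty[OF U(1)] by blast
    then obtain m x where m: "m \<in> J" and x: "x \<in> eucl n" "\<phi> m (shrink n x) \<in> U"
      by (auto simp: D_def simp flip: shrink_image)
    obtain d where d: "d > 0" "\<And>y. y \<in> eucl n \<Longrightarrow> nrm n (\<lambda>i. y i - x i) < d \<Longrightarrow> \<phi> m (shrink n y) \<in> U"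
      using chart_contains_ball[OF chart[OF m] U(1) x] by blast
    obtain v where v: "v \<in> L" "nrm n (\<lambda>i. v i - x i) < d / 2"
      using dyadic_translations_dense[of L "d / 2" x] L_add L_neg L_half L_zero L_unit d(1) by auto
    obtain k where k: "(1 / 2) ^ k < d / 2"
      using real_arch_pow_inv[of "d / 2" "1 / 2"] d(1) by auto
    have pow: "A ((1 / 2) ^ k) (\<lambda>i. 0) \<in> generate G P" for k
    proof (induction k)
      case (Suc k)
      have "A (1 / 2) (\<lambda>i. 0) \<otimes> A ((1 / 2) ^ k) (\<lambda>i. 0) = A ((1 / 2) ^ Suc k) (\<lambda>i. 0)"
        by (simp add: A_mult) (simp add: aff_def)
      then show ?case
        using W.m_closed[OF Ahalf Suc] by simp
    qed (simp add: A_one)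
    \<comment> \<open>Contract about the centre, then translate: \<open>E m\<close> becomes a ball
      of radius \<open>(1 / 2)^k\<close> about \<open>v\<close>, within distance \<open>d\<close> of
      \<open>x\<close>.\<close>
    define h where "h = A 1 v \<otimes> A ((1 / 2) ^ k) (\<lambda>i. 0)"
    have h_gen: "h \<in> generate G P"
      unfolding h_def using pow L_gen[OF v(1)] by (rule W.m_closed[rotated])
    have h: "h = A ((1 / 2) ^ k) v"
      using L_eucl[OF v(1)] by (simp add: h_def A_mult) (simp add: aff_def)
    have "h ` E m \<subseteq> U"
    proof
      fix z assume "z \<in> h ` E m"
      then obtain y where y: "y \<in> eucl n" "nrm n y < 1" "z = h (\<phi> m (shrink n y))"
        by (auto simp: E_def)
      let ?y = "aff ((1 / 2) ^ k) v y"
      have "nrm n (\<lambda>i. ?y i - x i) = nrm n (\<lambda>i. (1 / 2) ^ k * y i + (v i - x i))"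
        by (simp add: aff_def algebra_simps)
      also have "\<dots> \<le> nrm n (\<lambda>i. (1 / 2) ^ k * y i) + nrm n (\<lambda>i. v i - x i)"
        by (rule nrm_add)
      also have "nrm n (\<lambda>i. (1 / 2) ^ k * y i) \<le> (1 / 2) ^ k * 1"
        unfolding nrm_scale using y(2) nrm_nonneg by (intro mult_mono) auto
      finally have "nrm n (\<lambda>i. ?y i - x i) < d"
        using v(2) k by linarith
      then show "z \<in> U"
        using y L_eucl[OF v(1)] m by (simp add: h A_app aff_eucl d(2))
    qed
    moreover have "supp M (h \<otimes> w m \<otimes> inv h) = h ` supp M (w m)"
      using h_gen w_gen by (intro supp_conj) (auto intro: W.mem_carrier)
    ultimately have "supp M (h \<otimes> w m \<otimes> inv h) \<subseteq> U"
      using w_supp[OF m] by blast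
    moreover have "h \<otimes> w m \<otimes> inv h \<noteq> \<one>"
    proof
      have hw: "h \<in> carrier G" "w m \<in> carrier G"
        using h_gen w_gen by (auto intro: W.mem_carrier)
      assume "h \<otimes> w m \<otimes> inv h = \<one>"
      then have "h ` supp M (w m) = {}"
        using hw by (simp flip: supp_conj add: supp_empty_iff)
      then show False
        using w_ne[OF m] hw by (simp add: supp_empty_iff)
    qed
    moreover have "h \<otimes> w m \<otimes> inv h \<in> generate G P"
      by (intro W.m_closed W.m_inv_closed h_gen w_gen)
    ultimately show ?thesis
      by blast
  qed
  then show ?thesis
    using P by blast
qed

end

section \<open>Compact containment\<close>

text \<open>The equation between \<open>a'\<close>, \<open>h\<close> and \<open>a\<close> says,
  without inverses, that \<open>a'\<close> is the conjugate of \<open>a\<close> by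
  \<open>h\<close>.\<close>

definition alg_squeeze :: "('g, 'b) monoid_scheme \<Rightarrow> 'g \<Rightarrow> 'g \<Rightarrow> bool" where
  "alg_squeeze G a c \<longleftrightarrow>
     (\<forall>w\<in>carrier G. w \<noteq> \<one>\<^bsub>G\<^esub> \<and> alg_below G w c \<longrightarrow>
        (\<exists>h\<in>carrier G. \<exists>a'\<in>carrier G.
           alg_below G h c \<and> a' \<otimes>\<^bsub>G\<^esub> h = h \<otimes>\<^bsub>G\<^esub> a \<and> alg_below G a' w))"

text \<open>Squeezing the support of \<open>a\<close> into small sets forces its closure to be compact; monotonicity
  in \<open>b\<close> is built in by the existential quantifier.\<close>

definition alg_inside :: "('g, 'b) monoid_scheme \<Rightarrow> 'g \<Rightarrow> 'g \<Rightarrow> bool" where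
  "alg_inside G a b \<longleftrightarrow>
     (\<exists>c\<in>carrier G. c \<noteq> \<one>\<^bsub>G\<^esub> \<and> alg_below G c b \<and> alg_squeeze G a c)"

section \<open>Regular supports, and compact containment in terms of them\<close>

context manifold
begin

definition rsupp :: "('a \<Rightarrow> 'a) \<Rightarrow> 'a set" where
  "rsupp f = M interior_of (M closure_of supp M f)"

lemma openin_rsupp: "openin M (rsupp f)"
  by (simp add: rsupp_def)

lemma rsupp_subset: "rsupp f \<subseteq> topspace M"
  by (simp add: openin_rsupp openin_subset)

lemma supp_subset_rsupp: "f \<in> carrier G \<Longrightarrow> supp M f \<subseteq> rsupp f"
  unfolding rsupp_def by (simp add: interior_of_maximal openin_supp closure_of_subset supp_subset)

lemma rsupp_subset_closure: "rsupp f \<subseteq> M closure_of supp M f"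
  unfolding rsupp_def by (rule interior_of_subset)

lemma below_iff: 
  assumes f: "f \<in> carrier G" and h: "h \<in> carrier G"
  shows "alg_below G f h \<longleftrightarrow> rsupp f \<subseteq> rsupp h"
proof
  assume "alg_below G f h"
  then have "M closure_of supp M f \<subseteq> M closure_of supp M h"
    using alg_below_iff[OF f h] by (simp add: closure_of_minimal)
  then show "rsupp f \<subseteq> rsupp h"
    unfolding rsupp_def by (rule interior_of_mono)
next
  assume "rsupp f \<subseteq> rsupp h"
  then show "alg_below G f h"
    using alg_below_iff[OF f h] supp_subset_rsupp[OF f] rsupp_subset_closure[of h] by blast
qed

lemma below_if_supp: "f \<in> carrier G \<Longrightarrow> h \<in> carrier G \<Longrightarrow> supp M f \<subseteq> rsupp h \<Longrightarrow> alg_below G f h"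
  using alg_below_iff rsupp_subset_closure by blast

lemma rsupp_ne: "f \<in> carrier G \<Longrightarrow> f \<noteq> \<one> \<Longrightarrow> rsupp f \<noteq> {}"
  using supp_subset_rsupp supp_empty_iff by blast

lemma rsupp_conj:
  assumes f: "f \<in> carrier G" and h: "h \<in> carrier G"
  shows "rsupp (h \<otimes> f \<otimes> inv h) = h ` rsupp f"
  unfolding rsupp_def supp_conj[OF h f]
  using homeomorphic_map_closure_of[OF carrier_hmap[OF h] supp_subset]
    homeomorphic_map_interior_of[OF carrier_hmap[OF h] closure_of_subset_topspace]
  by simp

lemma conj_unique:
  assumes "a \<in> carrier G" "h \<in> carrier G" "f \<in> carrier G" "a \<otimes> h = h \<otimes> f"
  shows "a = h \<otimes> f \<otimes> inv h"
  using assms by (metis inv_solve_right m_closed)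

lemma squeeze_mono:
  assumes "a \<in> carrier G" "a' \<in> carrier G" "c \<in> carrier G"
    and below: "alg_below G a' a" and sq: "alg_squeeze G a c"
  shows "alg_squeeze G a' c"
  unfolding alg_squeeze_def
proof (intro ballI impI)
  fix w assume w: "w \<in> carrier G" "w \<noteq> \<one> \<and> alg_below G w c"
  obtain h b where hb: "h \<in> carrier G" "b \<in> carrier G" "alg_below G h c" "b \<otimes> h = h \<otimes> a" "alg_below G b w"
    using sq w unfolding alg_squeeze_def by blast
  have "b = h \<otimes> a \<otimes> inv h"
    using hb assms by (intro conj_unique)
  then have "h ` rsupp a \<subseteq> rsupp w"
    using hb w assms by (simp add: below_iff rsupp_conj)
  moreover have "rsupp a' \<subseteq> rsupp a"
    using below assms by (simp add: below_iff)
  ultimately have "alg_below G (h \<otimes> a' \<otimes> inv h) w"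
    using hb w assms by (simp add: below_iff rsupp_conj) blast
  moreover have "h \<otimes> a' \<otimes> inv h \<otimes> h = h \<otimes> a'"
    using hb assms by (simp add: m_assoc)
  ultimately show "\<exists>h\<in>carrier G. \<exists>b\<in>carrier G. alg_below G h c \<and> b \<otimes> h = h \<otimes> a' \<and> alg_below G b w"
    using hb assms by (meson inv_closed m_closed)
qed

lemma inside_mono:
  assumes "a \<in> carrier G" "a' \<in> carrier G" "b \<in> carrier G" "b' \<in> carrier G"
    and "alg_below G a' a" "alg_below G b b'" "alg_inside G a b"
  shows "alg_inside G a' b'"
proof -
  obtain c where c: "c \<in> carrier G" "c \<noteq> \<one>" "alg_below G c b" "alg_squeeze G a c"
    using assms unfolding alg_inside_def by blast
  then have "alg_below G c b'"
    using assms by (simp add: below_iff)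
  moreover have "alg_squeeze G a' c"
    using squeeze_mono assms c by blast
  ultimately show ?thesis
    unfolding alg_inside_def using c by blast
qed

text \<open>Choose \<open>w\<close> supported in a chart whose closed ball lies in
  \<open>supp M c\<close>. Squeezing \<open>a\<close> below \<open>w\<close> puts its moved support
  into that compact ball, and pulling the ball back by \<open>h\<close> gives a compact set
  \<open>K\<close> around the support of \<open>a\<close>.\<close>

lemma inside_compact:
  assumes a: "a \<in> carrier G" and b: "b \<in> carrier G" and ab: "alg_inside G a b"
  shows "compactin M (M closure_of supp M a)" "M closure_of supp M a \<subseteq> rsupp b" "b \<noteq> \<one>"
proof -
  obtain c where c: "c \<in> carrier G" "c \<noteq> \<one>" "alg_below G c b" "alg_squeeze G a c"
    using ab unfolding alg_inside_def by blast
  then obtain x where x: "x \<in> supp M c"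
    using supp_empty_iff by blast
  obtain \<phi> where \<phi>: "ball_chart n M \<phi>" "x \<in> \<phi> ` unit_ball n" "\<phi> ` unit_cball n \<subseteq> supp M c"
    using chart_exists[OF openin_supp[OF c(1)] x] .
  obtain w where w: "w \<in> carrier G" "supp M w \<subseteq> \<phi> ` unit_ball n" "x \<in> supp M w"
    using moving1[OF _ \<phi>(2)] \<phi>(1) unfolding ball_chart_def by blast
  have "w \<noteq> \<one>"
    using w supp_empty_iff by blast
  moreover have "alg_below G w c"
    using w c \<phi>(3) supp_subset_rsupp[OF c(1)] unit_ball_subset by (intro below_if_supp) blast+
  ultimately obtain h a' where h: "h \<in> carrier G" "a' \<in> carrier G" "alg_below G h c" "a' \<otimes> h = h \<otimes> a" "alg_below G a' w"
    using c(4) w(1) unfolding alg_squeeze_def by blast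
  have "a' = h \<otimes> a \<otimes> inv h"
    using h a by (intro conj_unique)
  then have "h ` supp M a \<subseteq> M closure_of supp M w"
    using h w alg_below_iff a by (simp add: supp_conj)
  also have "M closure_of supp M w \<subseteq> \<phi> ` unit_cball n"
  proof (rule closure_of_minimal)
    show "supp M w \<subseteq> \<phi> ` unit_cball n"
      using w(2) unit_ball_subset by blast
    show "closedin M (\<phi> ` unit_cball n)"
      using chart_compact[OF \<phi>(1)] Hausdorff compactin_imp_closedin by blast
  qed
  finally have ha: "h ` supp M a \<subseteq> \<phi> ` unit_cball n" .
  define K where "K = (inv h) ` \<phi> ` unit_cball n"
  have K: "compactin M K"
    unfolding K_def using h chart_compact[OF \<phi>(1)]
    by (intro image_compactin[of M]) (auto intro: homeomorphic_imp_continuous_map carrier_hmap)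
  have "supp M a \<subseteq> K"
  proof
    fix y assume y: "y \<in> supp M a"
    then have "y \<in> topspace M"
      by (simp add: supp_def)
    then have "y = (inv h) (h y)"
      using h by (simp add: inv_app)
    moreover have "h y \<in> \<phi> ` unit_cball n"
      using y ha by blast
    ultimately show "y \<in> K"
      unfolding K_def by blast
  qed
  then have cl: "M closure_of supp M a \<subseteq> K"
    using K Hausdorff by (simp add: closure_of_minimal compactin_imp_closedin)
  then show "compactin M (M closure_of supp M a)"
    using K closed_compactin[of M K] by simp
  \<comment> \<open>\<open>inv h\<close> has the same support as \<open>h\<close>, inside
    \<open>rsupp c\<close>: a point moved by it stays in that support, and any other point of the
    ball stays where it is.\<close>
  have "K \<subseteq> rsupp c"
  proof
    fix y assume "y \<in> K"
    then obtain z where z: "z \<in> supp M c" "y = (inv h) z"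
      using \<phi>(3) by (auto simp: K_def)
    show "y \<in> rsupp c"
    proof (cases "z \<in> supp M (inv h)")
      case True
      then have "y \<in> supp M h"
        using z h app_supp[of "inv h" z] by (simp add: supp_inv)
      then show ?thesis
        using supp_subset_rsupp[OF h(1)] h(1,3) c(1) by (auto simp: below_iff)
    next
      case False
      then have "y = z"
        using z by (simp add: supp_def)
      then show ?thesis
        using z supp_subset_rsupp[OF c(1)] by blast
    qed
  qed
  then show "M closure_of supp M a \<subseteq> rsupp b"
    using cl c b by (auto simp: below_iff)
  show "b \<noteq> \<one>"
  proof
    assume "b = \<one>"
    then have "supp M b = {}"
      using b supp_empty_iff by blast
    then show False
      using c(1,3) b x alg_below_iff[of c b] by auto
  qed
qed

text \<open>In affine coordinates of a chart, \<open>a\<close> lives on a ball of finite radius and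
  \<open>b\<close> on the whole chart. An open set met by the chart contains a small ball there, and
  a contraction supported in the chart carries the support of \<open>a\<close> into it. The witness
  for \<open>c\<close> is \<open>b\<close> itself.\<close>

lemma inside_exists:
  assumes W: "openin M W" "p \<in> W"
  obtains a b where "a \<in> carrier G" "b \<in> carrier G" "p \<in> supp M a" "M closure_of supp M b \<subseteq> W"
    "alg_inside G a b"
proof -
  obtain \<phi> where \<phi>: "ball_chart n M \<phi>" "p \<in> \<phi> ` unit_ball n" "\<phi> ` unit_cball n \<subseteq> W"
    using chart_exists[OF W] .
  obtain x where x: "x \<in> eucl n" "p = \<phi> (shrink n x)"
    using \<phi>(2) by (auto simp flip: shrink_image)
  define b where "b = chart_affine n M \<phi> 1 (unit_vec 0)"
  have b: "b \<in> carrier G" "supp M b = \<phi> ` unit_ball n"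
    unfolding b_def using \<phi>(1) dim_pos
    by (auto simp: chart_affine_carrier unit_vec_eucl unit_vec_nonzero supp_chart_translation)
  have b1: "b \<noteq> \<one>"
    using b \<phi>(2) supp_empty_iff by blast
  define r where "r = nrm n x + 1"
  have r: "r > 0"
    using nrm_nonneg[of n x] by (simp add: r_def)
  define S where "S = {y \<in> eucl n. nrm n y < r}"
  have "open (nrm n -` {..<r})"
    using continuous_on_nrm[of UNIV "\<lambda>x. x" n] by (intro open_vimage) (auto simp: continuous_on_id)
  moreover have "S = eucl n \<inter> nrm n -` {..<r}"
    by (auto simp: S_def)
  ultimately have "openin (top_of_set (eucl n)) S"
    by (auto simp: openin_open)
  then have "openin M (\<phi> ` shrink n ` S)"
    using chart_open_image[OF \<phi>(1)] by blast
  moreover have "p \<in> \<phi> ` shrink n ` S"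
    using x by (auto simp: S_def r_def)
  ultimately obtain a where a: "a \<in> carrier G" "supp M a \<subseteq> \<phi> ` shrink n ` S" "p \<in> supp M a"
    using moving1 by blast
  have "alg_squeeze G a b"
    unfolding alg_squeeze_def
  proof (intro ballI impI)
    fix w assume w: "w \<in> carrier G" "w \<noteq> \<one> \<and> alg_below G w b"
    have "supp M w \<inter> M closure_of supp M b \<noteq> {}"
      using w b alg_below_iff supp_empty_iff[of w] by blast
    then have "supp M w \<inter> supp M b \<noteq> {}"
      using openin_Int_closure_of_eq_empty[OF openin_supp[OF w(1)]] by blast
    then obtain y where y: "y \<in> eucl n" "\<phi> (shrink n y) \<in> supp M w"
      using b(2) by (auto simp flip: shrink_image)
    obtain e where e: "e > 0" "\<And>z. z \<in> eucl n \<Longrightarrow> nrm n (\<lambda>i. z i - y i) < e \<Longrightarrow> \<phi> (shrink n z) \<in> supp M w"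
      using chart_contains_ball[OF \<phi>(1) openin_supp[OF w(1)] y] by blast
    \<comment> \<open>The affine map with this ratio and translation part \<open>y\<close> sends the
      ball of radius \<open>r\<close> about 0 into the ball of radius \<open>e\<close> about
      \<open>y\<close>.\<close>
    define l where "l = e / r"
    have l: "l > 0"
      using e r by (simp add: l_def)
    define h where "h = chart_affine n M \<phi> l y"
    have h: "h \<in> carrier G" "supp M h \<subseteq> supp M b"
      unfolding h_def b(2) using \<phi>(1) l y by (auto simp: chart_affine_carrier intro: subsetD[OF supp_chart_affine])
    have "h ` supp M a \<subseteq> supp M w"
    proof
      fix z assume "z \<in> h ` supp M a"
      then obtain s where s: "s \<in> S" "z = h (\<phi> (shrink n s))"
        using a(2) by blast
      have "nrm n (\<lambda>i. aff l y s i - y i) = l * nrm n s"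
        using l nrm_scale[of n l s] by (simp add: aff_def)
      also have "\<dots> < l * r"
        using l s by (intro mult_strict_left_mono) (auto simp: S_def)
      also have "\<dots> = e"
        using r by (simp add: l_def)
      finally have "\<phi> (shrink n (aff l y s)) \<in> supp M w"
        using s y by (intro e(2)) (auto simp: S_def aff_eucl)
      then show "z \<in> supp M w"
        using s \<phi>(1) by (simp add: h_def chart_affine_shrink S_def)
    qed
    then have "alg_below G (h \<otimes> a \<otimes> inv h) w"
      using h a w supp_subset_rsupp[OF w(1)] by (intro below_if_supp) (auto simp: supp_conj)
    moreover have "alg_below G h b"
      using h b supp_subset_rsupp[OF b(1)] by (intro below_if_supp) auto
    moreover have "h \<otimes> a \<otimes> inv h \<otimes> h = h \<otimes> a"
      using h a by (simp add: m_assoc)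
    ultimately show "\<exists>h\<in>carrier G. \<exists>a'\<in>carrier G. alg_below G h b \<and> a' \<otimes> h = h \<otimes> a \<and> alg_below G a' w"
      using h a by (meson inv_closed m_closed)
  qed
  then have "alg_inside G a b"
    unfolding alg_inside_def using b b1 by (auto simp: below_iff)
  moreover have "M closure_of supp M b \<subseteq> W"
  proof -
    have "M closure_of supp M b \<subseteq> \<phi> ` unit_cball n"
      unfolding b(2) using chart_compact[OF \<phi>(1)] Hausdorff unit_ball_subset
      by (intro closure_of_minimal) (auto intro: compactin_imp_closedin)
    then show ?thesis
      using \<phi>(3) by blast
  qed
  ultimately show thesis
    using that a b by blast
qed

section \<open>Matching bases\<close>

text \<open>The form of "basis" that the language can express. By \<open>inside_exists\<close>,
  pairs related by \<open>alg_inside\<close> occur around every point within every neighbourhood, so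
  interpolating between them yields a topological basis.\<close>

definition interpolating :: "(nat \<Rightarrow> 'a \<Rightarrow> 'a) \<Rightarrow> bool" where
  "interpolating z \<longleftrightarrow> (\<forall>i. z i \<in> carrier G \<and> z i \<noteq> \<one>) \<and>
     (\<forall>a\<in>carrier G. \<forall>b\<in>carrier G. alg_inside G a b \<longrightarrow> (\<exists>i. alg_below G a (z i) \<and> alg_below G (z i) b))"

lemma interpolating_basis:
  assumes z: "interpolating z" and W: "openin M W" "p \<in> W"
  obtains i where "p \<in> rsupp (z i)" "rsupp (z i) \<subseteq> W"
proof -
  obtain a b where ab: "a \<in> carrier G" "b \<in> carrier G" "p \<in> supp M a" "M closure_of supp M b \<subseteq> W"
    "alg_inside G a b"
    using inside_exists[OF W] .
  then obtain i where i: "z i \<in> carrier G" "alg_below G a (z i)" "alg_below G (z i) b"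
    using z unfolding interpolating_def by blast
  then have "rsupp a \<subseteq> rsupp (z i)" "rsupp (z i) \<subseteq> rsupp b"
    using ab below_iff by blast+
  then show thesis
    using that[of i] ab supp_subset_rsupp rsupp_subset_closure by blast
qed

lemma interpolating_inside:
  assumes z: "interpolating z" and p: "p \<in> rsupp (z i)"
  obtains j where "p \<in> rsupp (z j)" "alg_inside G (z j) (z i)"
proof -
  have zc: "z i \<in> carrier G" for i
    using z by (simp add: interpolating_def)
  obtain a b where ab: "a \<in> carrier G" "b \<in> carrier G" "p \<in> supp M a" "M closure_of supp M b \<subseteq> rsupp (z i)"
    "alg_inside G a b"
    using inside_exists[OF openin_rsupp p] .
  obtain j where j: "p \<in> rsupp (z j)" "rsupp (z j) \<subseteq> supp M a"
    using interpolating_basis[OF z openin_supp[OF ab(1)] ab(3)] .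
  have "alg_below G (z j) a"
    using j ab supp_subset_rsupp[OF ab(1)] zc by (simp add: below_iff)
  moreover have "alg_below G b (z i)"
    using ab zc rsupp_subset_closure[of b] by (simp add: below_iff)
  ultimately have "alg_inside G (z j) (z i)"
    using inside_mono ab zc by blast
  then show thesis
    using that j(1) by blast
qed

definition matching :: "(nat \<Rightarrow> 'a \<Rightarrow> 'a) \<Rightarrow> (nat \<Rightarrow> 'a \<Rightarrow> 'a) \<Rightarrow> bool" where
  "matching z z' \<longleftrightarrow> interpolating z \<and> interpolating z' \<and>
     (\<forall>i j. alg_below G (z i) (z j) \<longleftrightarrow> alg_below G (z' i) (z' j)) \<and>
     (\<forall>i j. alg_inside G (z i) (z j) \<longleftrightarrow> alg_inside G (z' i) (z' j))"

lemma matching_sym: "matching z z' \<Longrightarrow> matching z' z"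
  by (auto simp: matching_def)

lemma separating:
  assumes z: "interpolating z" and pq: "p \<in> topspace M" "q \<in> topspace M"
    and sub: "\<And>i. p \<in> rsupp (z i) \<Longrightarrow> q \<in> rsupp (z i)"
  shows "p = q"
proof (rule ccontr)
  assume "p \<noteq> q"
  then obtain U V where UV: "openin M U" "openin M V" "p \<in> U" "q \<in> V" "disjnt U V"
    using Hausdorff pq unfolding Hausdorff_space_def by metis
  obtain i where "p \<in> rsupp (z i)" "rsupp (z i) \<subseteq> U"
    using interpolating_basis[OF z UV(1,3)] .
  then show False
    using sub UV by (auto simp: disjnt_iff)
qed

text \<open>Compactness turns the filter of codes at \<open>p\<close> into a point on the other side.\<close>

lemma matching_point_subset:
  assumes m: "matching z z'" and p: "p \<in> topspace M"
  shows "\<exists>q\<in>topspace M. \<forall>i. p \<in> rsupp (z i) \<longrightarrow> q \<in> rsupp (z' i)"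
proof -
  have z: "interpolating z" and z': "interpolating z'"
    using m by (auto simp: matching_def)
  have zc: "z i \<in> carrier G" "z' i \<in> carrier G" "z' i \<noteq> \<one>" for i
    using z z' by (auto simp: interpolating_def)
  have sub: "rsupp (z i) \<subseteq> rsupp (z j) \<Longrightarrow> rsupp (z' i) \<subseteq> rsupp (z' j)" for i j
    using m zc by (auto simp: matching_def below_iff)
  have ins: "alg_inside G (z i) (z j) \<Longrightarrow> M closure_of supp M (z' i) \<subseteq> rsupp (z' j) \<and>
      compactin M (M closure_of supp M (z' i))" for i j
    using m inside_compact(1,2)[OF zc(2)[of i] zc(2)[of j]] by (auto simp: matching_def)
  define F where "F = {i. p \<in> rsupp (z i)}"
  \<comment> \<open>As \<open>M\<close> may be noncompact, the finite intersection property is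
    applied inside one compact set \<open>K j0\<close>, supplied by a code strictly inside
    another.\<close>
  obtain i0 where i0: "p \<in> rsupp (z i0)"
    using interpolating_basis[OF z openin_topspace p] .
  obtain j0 where j0: "p \<in> rsupp (z j0)" "alg_inside G (z j0) (z i0)"
    using interpolating_inside[OF z i0] .
  define K where "K = (\<lambda>i. M closure_of supp M (z' i))"
  have fin: "K j0 \<inter> \<Inter> (K ` I) \<noteq> {}" if I: "finite I" "I \<subseteq> F" for I
  proof -
    have "openin M (\<Inter>i\<in>insert j0 I. rsupp (z i))"
      using I(1) by (intro openin_INT2) (auto simp: openin_rsupp)
    moreover have "p \<in> (\<Inter>i\<in>insert j0 I. rsupp (z i))"
      using I(2) j0 by (auto simp: F_def)
    ultimately obtain k where "p \<in> rsupp (z k)" "rsupp (z k) \<subseteq> (\<Inter>i\<in>insert j0 I. rsupp (z i))"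
      using interpolating_basis[OF z] by blast
    then have "rsupp (z' k) \<subseteq> rsupp (z' i)" if "i \<in> insert j0 I" for i
      using sub that by blast
    then have "rsupp (z' k) \<subseteq> K i" if "i \<in> insert j0 I" for i
      using that rsupp_subset_closure unfolding K_def by blast
    then have "rsupp (z' k) \<subseteq> K j0 \<inter> \<Inter> (K ` I)"
      by blast
    then show ?thesis
      using rsupp_ne zc by blast
  qed
  have "K j0 \<inter> \<Inter> (K ` F) \<noteq> {}"
  proof -
    have "compactin M (K j0)"
      using ins j0 by (simp add: K_def)
    then have "\<forall>\<U>. (\<forall>C\<in>\<U>. closedin M C) \<and> (\<forall>\<F>. finite \<F> \<and> \<F> \<subseteq> \<U> \<longrightarrow> K j0 \<inter> \<Inter>\<F> \<noteq> {}) \<longrightarrow> K j0 \<inter> \<Inter>\<U> \<noteq> {}"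
      by (simp add: compactin_fip)
    moreover have "\<forall>C\<in>K ` F. closedin M C"
      by (auto simp: K_def)
    moreover have "K j0 \<inter> \<Inter>\<F> \<noteq> {}" if "finite \<F>" "\<F> \<subseteq> K ` F" for \<F>
    proof -
      obtain I where "finite I" "I \<subseteq> F" "\<F> = K ` I"
        using \<open>finite \<F>\<close> \<open>\<F> \<subseteq> K ` F\<close> by (meson finite_subset_image)
      then show ?thesis
        using fin by simp
    qed
    ultimately show ?thesis
      by blast
  qed
  then obtain q where q: "\<And>j. p \<in> rsupp (z j) \<Longrightarrow> q \<in> K j"
    by (auto simp: F_def)
  \<comment> \<open>So far \<open>q\<close> lies only in closures; a code inside \<open>z i\<close>
    has its matched closure already within the open set \<open>rsupp (z' i)\<close>.\<close>
  have "q \<in> rsupp (z' i)" if pi: "p \<in> rsupp (z i)" for i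
  proof -
    obtain j where "p \<in> rsupp (z j)" "alg_inside G (z j) (z i)"
      using interpolating_inside[OF z pi] .
    then show ?thesis
      using q[of j] ins[of j i] by (auto simp: K_def)
  qed
  moreover have "q \<in> topspace M"
    using q[OF j0(1)] closure_of_subset_topspace by (fastforce simp: K_def)
  ultimately show ?thesis
    by blast
qed

text \<open>Going to the other side and back yields a point in every basic set containing
  \<open>p\<close>; it is \<open>p\<close> by \<open>separating\<close>, so both inclusions are
  equalities.\<close>

lemma matching_point:
  assumes m: "matching z z'" and p: "p \<in> topspace M"
  shows "\<exists>q\<in>topspace M. \<forall>i. p \<in> rsupp (z i) \<longleftrightarrow> q \<in> rsupp (z' i)"
proof -
  obtain q where q: "q \<in> topspace M" "\<And>i. p \<in> rsupp (z i) \<Longrightarrow> q \<in> rsupp (z' i)"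
    using matching_point_subset[OF m p] by blast
  obtain p' where p': "p' \<in> topspace M" "\<And>i. q \<in> rsupp (z' i) \<Longrightarrow> p' \<in> rsupp (z i)"
    using matching_point_subset[OF matching_sym[OF m] q(1)] by blast
  have "p = p'"
    by (rule separating[of z]) (use m p p' q in \<open>auto simp: matching_def\<close>)
  then show ?thesis
    using p' q by blast
qed

lemma matching_homeo:
  assumes m: "matching z z'"
  obtains k where "k \<in> carrier G" "\<And>p i. p \<in> topspace M \<Longrightarrow> p \<in> rsupp (z i) \<longleftrightarrow> k p \<in> rsupp (z' i)"
proof -
  have z: "interpolating z" and z': "interpolating z'"
    using m by (auto simp: matching_def)
  obtain k where k: "\<And>p. p \<in> topspace M \<Longrightarrow> k p \<in> topspace M"
    "\<And>p i. p \<in> topspace M \<Longrightarrow> p \<in> rsupp (z i) \<longleftrightarrow> k p \<in> rsupp (z' i)"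
    using matching_point[OF m] by metis
  obtain k' where k': "\<And>p. p \<in> topspace M \<Longrightarrow> k' p \<in> topspace M"
    "\<And>p i. p \<in> topspace M \<Longrightarrow> p \<in> rsupp (z' i) \<longleftrightarrow> k' p \<in> rsupp (z i)"
    using matching_point[OF matching_sym[OF m]] by metis
  \<comment> \<open>Stated for general \<open>y\<close>, \<open>y'\<close> to serve both
    \<open>k\<close> and its inverse: the preimage of a basic set is the basic set of the same
    index.\<close>
  have cont: "continuous_map M M f"
    if f: "\<And>p. p \<in> topspace M \<Longrightarrow> f p \<in> topspace M" "\<And>p i. p \<in> topspace M \<Longrightarrow> p \<in> rsupp (y i) \<longleftrightarrow> f p \<in> rsupp (y' i)"
      and y': "interpolating y'" for f y y'
    unfolding continuous_map_eq_topcontinuous_at topcontinuous_at_def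
  proof (intro ballI conjI allI impI)
    fix x V assume x: "x \<in> topspace M" and V: "openin M V \<and> f x \<in> V"
    obtain i where i: "f x \<in> rsupp (y' i)" "rsupp (y' i) \<subseteq> V"
      using interpolating_basis[OF y'] V by blast
    have "\<forall>p\<in>rsupp (y i). f p \<in> V"
      using f(2) i(2) rsupp_subset by blast
    then show "\<exists>U. openin M U \<and> x \<in> U \<and> (\<forall>y\<in>U. f y \<in> V)"
      using f(2)[OF x] i(1) openin_rsupp by blast
  qed (use f in auto)
  have "homeomorphic_maps M M k k'"
    unfolding homeomorphic_maps_def
  proof (intro conjI ballI)
    show "continuous_map M M k" "continuous_map M M k'"
      using cont[of k z z'] cont[of k' z' z] k k' z z' by blast+
    show "k' (k p) = p" if "p \<in> topspace M" for p
      using separating[OF z that, of "k' (k p)"] k k' that by auto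
    show "k (k' p) = p" if "p \<in> topspace M" for p
      using separating[OF z' that, of "k (k' p)"] k k' that by auto
  qed
  then have "homeomorphic_map M M k"
    using homeomorphic_map_maps by blast
  then have "homeomorphic_map M M (restrict k (topspace M))"
    by (rule homeomorphic_map_eq) simp
  then have "restrict k (topspace M) \<in> carrier G"
    by (simp add: carrier_iff)
  then show thesis
    using that[of "restrict k (topspace M)"] k(2) by simp
qed

text \<open>The homeomorphism matching the bases intertwines the actions, as \<open>k (g p)\<close>
  and \<open>h (k p)\<close> cannot be separated. One inclusion suffices in
  \<open>separating\<close>, which is why \<open>act\<close> is an implication.\<close>

lemma matching_conjugate:
  assumes m: "matching z z'" and g: "g \<in> carrier G" and h: "h \<in> carrier G"
    and act: "\<And>i j. alg_below G (g \<otimes> z i \<otimes> inv g) (z j) \<Longrightarrow> alg_below G (h \<otimes> z' i \<otimes> inv h) (z' j)"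
  shows "conjugate_in G h g"
proof -
  have z: "interpolating z" and z': "interpolating z'"
    using m by (auto simp: matching_def)
  have zc: "z i \<in> carrier G" "z' i \<in> carrier G" for i
    using z z' by (auto simp: interpolating_def)
  obtain k where k: "k \<in> carrier G" "\<And>p i. p \<in> topspace M \<Longrightarrow> p \<in> rsupp (z i) \<longleftrightarrow> k p \<in> rsupp (z' i)"
    using matching_homeo[OF m] by blast
  have "k (g p) = h (k p)" if p: "p \<in> topspace M" for p
  proof (rule separating[OF z'])
    show "k (g p) \<in> topspace M" "h (k p) \<in> topspace M"
      using p k g h by (simp_all add: app_closed)
    fix j assume "k (g p) \<in> rsupp (z' j)"
    then have "g p \<in> rsupp (z j)"
      using k(2) p g by (simp add: app_closed)
    then have "p \<in> (inv g) ` rsupp (z j)"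
      using p g by (metis imageI inv_app)
    then obtain i where i: "p \<in> rsupp (z i)" "rsupp (z i) \<subseteq> (inv g) ` rsupp (z j)"
      using interpolating_basis[OF z openin_image[OF _ openin_rsupp]] g by (metis inv_closed)
    have "g ` rsupp (z i) \<subseteq> rsupp (z j)"
    proof
      fix y assume "y \<in> g ` rsupp (z i)"
      then obtain x where "x \<in> rsupp (z j)" "y = g ((inv g) x)"
        using i(2) by blast
      then show "y \<in> rsupp (z j)"
        using g rsupp_subset[of "z j"] by (auto simp: app_inv)
    qed
    then have "alg_below G (g \<otimes> z i \<otimes> inv g) (z j)"
      using g zc by (simp add: below_iff rsupp_conj)
    then have "h ` rsupp (z' i) \<subseteq> rsupp (z' j)"
      using act h zc below_iff[of "h \<otimes> z' i \<otimes> inv h" "z' j"] by (simp add: rsupp_conj)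
    moreover have "k p \<in> rsupp (z' i)"
      using k(2) p i(1) by blast
    ultimately show "h (k p) \<in> rsupp (z' j)"
      by blast
  qed
  then have "k \<otimes> g = h \<otimes> k"
    using k g h by (intro homeo_eqI) (simp_all add: mult_app)
  then have "h = k \<otimes> g \<otimes> inv k"
    using k g h by (metis conj_unique)
  then show ?thesis
    unfolding conjugate_in_def using k(1) by blast
qed

end

section \<open>The defining formula\<close>

lemma term_elt_upd_mono: "term_elt G n s \<Longrightarrow> n \<le> m \<Longrightarrow> s (v(m := a)) = s v"
  using term_elt_mono term_elt_upd by metis

lemma term_elt_pow: "term_elt G n s \<Longrightarrow> term_elt G n (\<lambda>v. s v [^]\<^bsub>G\<^esub> (k :: nat))"
  by (induction k) (simp_all add: term_elt_one term_elt_mult)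

lemma definable_alg_disjoint:
  assumes "term_elt G n s" "term_elt G n t"
  shows "definable G n (\<lambda>v. alg_disjoint G (s v) (t v))"
  unfolding alg_disjoint_def
  by (intro definable_all definable_ex definable_imp definable_conj definable_not definable_eq
      term_elt_mult term_elt_var term_elt_one term_elt_mono[OF assms(1)] term_elt_mono[OF assms(2)])
    (simp_all add: term_elt_upd_mono[OF assms(1)] term_elt_upd_mono[OF assms(2)])

lemma definable_alg_below:
  assumes "term_elt G n s" "term_elt G n t"
  shows "definable G n (\<lambda>v. alg_below G (s v) (t v))"
  unfolding alg_below_def
  by (intro definable_all definable_imp definable_eq definable_alg_disjoint term_elt_pow
      term_elt_mult term_elt_var term_elt_mono[OF assms(1)] term_elt_mono[OF assms(2)])
    (simp_all add: term_elt_upd_mono[OF assms(1)] term_elt_upd_mono[OF assms(2)])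

lemma definable_alg_squeeze:
  assumes "term_elt G n s" "term_elt G n t"
  shows "definable G n (\<lambda>v. alg_squeeze G (s v) (t v))"
  unfolding alg_squeeze_def
  by (intro definable_all definable_ex definable_imp definable_conj definable_not definable_eq
      definable_alg_below term_elt_one term_elt_mult term_elt_var
      term_elt_mono[OF assms(1)] term_elt_mono[OF assms(2)])
    (simp_all add: term_elt_upd_mono[OF assms(1)] term_elt_upd_mono[OF assms(2)])

lemma definable_alg_inside:
  assumes "term_elt G n s" "term_elt G n t"
  shows "definable G n (\<lambda>v. alg_inside G (s v) (t v))"
  unfolding alg_inside_def
  by (intro definable_ex definable_conj definable_not definable_eq definable_alg_below
      definable_alg_squeeze term_elt_one term_elt_var
      term_elt_mono[OF assms(1)] term_elt_mono[OF assms(2)])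
    (simp_all add: term_elt_upd_mono[OF assms(1)] term_elt_upd_mono[OF assms(2)])

text \<open>Variables \<open>1\<close> to \<open>N\<close> hold generators of a group with small supports; \<open>z\<close> has code \<open>i\<close> over
  \<open>v\<close> if the words in them lying below \<open>z\<close> are those lying below \<open>b i\<close> for the
  reference assignment \<open>a\<close>. The remaining clauses say that the sets so coded have the same diagram
  as the reference sets, also with respect to the homeomorphism \<open>v 0\<close>, and form a basis.\<close>

definition has_code ::
  "('g, 'b) monoid_scheme \<Rightarrow> nat \<Rightarrow> (nat \<Rightarrow> 'g) \<Rightarrow> (nat \<Rightarrow> 'g) \<Rightarrow> nat \<Rightarrow> 'g \<Rightarrow> (nat \<Rightarrow> 'g) \<Rightarrow> bool" where
  "has_code G N a b i z v \<longleftrightarrow>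
     (\<forall>t. tvars t \<subseteq> {1..N} \<longrightarrow> (alg_below G (tval G v t) z \<longleftrightarrow> alg_below G (tval G a t) (b i)))"

definition codes_match ::
  "('g, 'b) monoid_scheme \<Rightarrow> nat \<Rightarrow> (nat \<Rightarrow> 'g) \<Rightarrow> (nat \<Rightarrow> 'g) \<Rightarrow> (nat \<Rightarrow> 'g) \<Rightarrow> bool" where
  "codes_match G N a b v \<longleftrightarrow>
     (\<forall>i. \<exists>z\<in>carrier G. z \<noteq> \<one>\<^bsub>G\<^esub> \<and> has_code G N a b i z v) \<and>
     (\<forall>i j. \<forall>z\<in>carrier G. \<forall>z'\<in>carrier G. has_code G N a b i z v \<and> has_code G N a b j z' v \<longrightarrow>
        (alg_below G z z' \<longleftrightarrow> alg_below G (b i) (b j)) \<and>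
        (alg_inside G z z' \<longleftrightarrow> alg_inside G (b i) (b j)) \<and>
        (\<forall>c\<in>carrier G. c \<otimes>\<^bsub>G\<^esub> v 0 = v 0 \<otimes>\<^bsub>G\<^esub> z \<longrightarrow>
           alg_below G (a 0 \<otimes>\<^bsub>G\<^esub> b i \<otimes>\<^bsub>G\<^esub> inv\<^bsub>G\<^esub> a 0) (b j) \<longrightarrow> alg_below G c z')) \<and>
     (\<forall>x\<in>carrier G. \<forall>y\<in>carrier G. alg_inside G x y \<longrightarrow>
        (\<exists>i. \<exists>z\<in>carrier G. has_code G N a b i z v \<and> alg_below G x z \<and> alg_below G z y))"

lemma has_code_upd: "N < m \<Longrightarrow> has_code G N a b i z (v(m := x)) = has_code G N a b i z v"
proof -
  assume "N < m"
  then have "tval G (v(m := x)) t = tval G v t" if "tvars t \<subseteq> {1..N}" for t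
    using that by (intro tval_cong) auto
  then show ?thesis
    by (simp add: has_code_def)
qed

lemma definable_has_code:
  assumes "N < m" "term_elt G m s"
  shows "definable G m (\<lambda>v. has_code G N a b i (s v) v)"
  unfolding has_code_def
proof (intro definable_all_countable)
  fix t
  show "definable G m (\<lambda>v. tvars t \<subseteq> {1..N} \<longrightarrow>
      (alg_below G (tval G v t) (s v) \<longleftrightarrow> alg_below G (tval G a t) (b i)))"
  proof (cases "tvars t \<subseteq> {1..N}")
    case True
    then have "tvars t \<subseteq> {..<m}"
      using assms(1) by auto
    then show ?thesis
      using assms(2) by (intro definable_imp definable_const definable_iff_const definable_alg_below term_elt_tval)
  next
    case False
    then show ?thesis
      using definable_const[of G m True] by simp
  qed
qed

text \<open>\<open>a\<close> and \<open>b\<close> occur only in statements whose truth does not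
  depend on \<open>v\<close>. These become constants of the formula, so its only free variables are
  0 and the generators.\<close>

lemma definable_codes_match: "definable G (1 + N) (codes_match G N a b)"
proof -
  have "definable G (Suc N) (\<lambda>v. codes_match G N a b v)"
    unfolding codes_match_def
    by (intro definable_conj definable_all_nat definable_ex_nat definable_all definable_ex definable_imp
        definable_not definable_eq definable_iff_const definable_const definable_has_code definable_alg_below
        definable_alg_inside term_elt_mult term_elt_var term_elt_one)
      (simp_all add: has_code_upd)
  then show ?thesis
    by simp
qed

section \<open>The formula holds exactly on the conjugacy class\<close>

context manifold
begin

lemma generate_terms:
  assumes P: "finite P" "P \<subseteq> carrier G" and g: "g \<in> carrier G"
  obtains N a where "\<And>i. a i \<in> carrier G" "a 0 = g"
    "\<And>w. w \<in> generate G P \<Longrightarrow> \<exists>t. tvars t \<subseteq> {1..N} \<and> tval G a t = w"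
proof -
  \<comment> \<open>Terms have no inverses, so the inverses of the generators are listed as letters
    of their own.\<close>
  obtain ps where ps: "set ps = P \<union> (\<lambda>x. inv x) ` P"
    using P(1) finite_list by (metis finite_Un finite_imageI)
  define N where "N = length ps"
  \<comment> \<open>Position 0 is reserved for the homeomorphism, so letter \<open>i - 1\<close> of
    the list sits at \<open>i\<close>. The default \<open>\<one>\<close> keeps the whole assignment
    in the carrier.\<close>
  define a where "a = (\<lambda>i. if i = 0 then g else if i \<le> N then ps ! (i - 1) else \<one>)"
  have psc: "p \<in> carrier G" if "p \<in> set ps" for p
    using that ps P(2) by auto
  have letter: "\<exists>t. tvars t \<subseteq> {1..N} \<and> tval G a t = p" if p: "p \<in> set ps" for p
  proof -
    obtain i where i: "i < N" "p = ps ! i"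
      using p by (metis N_def in_set_conv_nth)
    then show ?thesis
      by (intro exI[of _ "Var (Suc i)"]) (auto simp: a_def)
  qed
  show thesis
  proof
    show "a i \<in> carrier G" for i
      using g psc by (auto simp: a_def N_def)
    show "a 0 = g"
      by (simp add: a_def)
    show "\<exists>t. tvars t \<subseteq> {1..N} \<and> tval G a t = w" if "w \<in> generate G P" for w
      using that
    proof induction
      case one
      then show ?case
        by (intro exI[of _ One]) simp
    next
      case (incl h)
      then show ?case
        using letter ps by blast
    next
      case (inv h)
      then show ?case
        using letter ps by blast
    next
      case (eng h1 h2)
      then obtain t1 t2 where "tvars t1 \<subseteq> {1..N}" "tval G a t1 = h1" "tvars t2 \<subseteq> {1..N}" "tval G a t2 = h2"
        by blast
      then show ?case
        by (intro exI[of _ "Mult t1 t2"]) simp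
    qed
  qed
qed

text \<open>If \<open>x\<close> is not below \<open>y\<close>, some nontrivial word is supported in
  \<open>supp M x\<close> off the closure of \<open>supp M y\<close> and tells their codes apart.
  Hence a code determines the regular support, and the diagram clauses hold because they depend only
  on regular supports.\<close>

lemma codes_match_self:
  assumes a: "\<And>i. a i \<in> carrier G" and b: "interpolating b"
    and dense: "\<And>U. openin M U \<Longrightarrow> U \<noteq> {} \<Longrightarrow>
      \<exists>t. tvars t \<subseteq> {1..N} \<and> tval G a t \<noteq> \<one> \<and> supp M (tval G a t) \<subseteq> U"
  shows "codes_match G N a b a"
proof -
  have bc: "b i \<in> carrier G" "b i \<noteq> \<one>" for i
    using b by (auto simp: interpolating_def)
  have tc: "tval G a t \<in> carrier G" for t
    using a by (simp add: tval_closed)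
  have below: "alg_below G x y"
    if xy: "x \<in> carrier G" "y \<in> carrier G"
      and t: "\<And>t. tvars t \<subseteq> {1..N} \<Longrightarrow> alg_below G (tval G a t) x \<Longrightarrow> alg_below G (tval G a t) y" for x y
  proof (rule ccontr)
    assume "\<not> alg_below G x y"
    then have "supp M x - M closure_of supp M y \<noteq> {}"
      using xy alg_below_iff by blast
    moreover have "openin M (supp M x - M closure_of supp M y)"
      using xy by (intro openin_diff openin_supp) auto
    ultimately obtain t where t': "tvars t \<subseteq> {1..N}" "tval G a t \<noteq> \<one>"
      "supp M (tval G a t) \<subseteq> supp M x - M closure_of supp M y"
      using dense by meson
    have "alg_below G (tval G a t) x"
      using t'(3) xy tc supp_subset_rsupp[OF xy(1)] by (intro below_if_supp) auto
    then have "supp M (tval G a t) \<subseteq> M closure_of supp M y"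
      using t t'(1) xy(2) tc alg_below_iff by blast
    then have "supp M (tval G a t) = {}"
      using t'(3) by blast
    then show False
      using t'(2) tc supp_empty_iff by blast
  qed
  have rs: "rsupp z = rsupp (b i)" if "z \<in> carrier G" "has_code G N a b i z a" for z i
    using that bc below[of z "b i"] below[of "b i" z]
    by (auto simp: has_code_def below_iff)
  have self: "has_code G N a b i (b i) a" for i
    by (simp add: has_code_def)
  have inside: "alg_inside G x y \<longleftrightarrow> alg_inside G x' y'"
    if "x \<in> carrier G" "x' \<in> carrier G" "y \<in> carrier G" "y' \<in> carrier G" "rsupp x = rsupp x'" "rsupp y = rsupp y'"
    for x x' y y'
  proof -
    have "alg_below G x x'" "alg_below G x' x" "alg_below G y y'" "alg_below G y' y"
      using that by (simp_all add: below_iff)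
    then show ?thesis
      using that(1-4) inside_mono by blast
  qed
  show ?thesis
    unfolding codes_match_def
  proof (intro conjI allI ballI impI)
    show "\<exists>z\<in>carrier G. z \<noteq> \<one> \<and> has_code G N a b i z a" for i
      using bc self by blast
    show "\<exists>i. \<exists>z\<in>carrier G. has_code G N a b i z a \<and> alg_below G x z \<and> alg_below G z y"
      if "x \<in> carrier G" "y \<in> carrier G" "alg_inside G x y" for x y
      using b that bc(1) self unfolding interpolating_def by meson
    fix i j z z' assume zz: "z \<in> carrier G" "z' \<in> carrier G" "has_code G N a b i z a \<and> has_code G N a b j z' a"
    then have r: "rsupp z = rsupp (b i)" "rsupp z' = rsupp (b j)"
      using rs by auto
    show "alg_below G z z' \<longleftrightarrow> alg_below G (b i) (b j)"
      using zz r bc by (simp add: below_iff)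
    show "alg_inside G z z' \<longleftrightarrow> alg_inside G (b i) (b j)"
      using zz r bc by (intro inside) auto
    show "alg_below G c z'" if c: "c \<in> carrier G" "c \<otimes> a 0 = a 0 \<otimes> z"
      "alg_below G (a 0 \<otimes> b i \<otimes> inv a 0) (b j)" for c
    proof -
      have "c = a 0 \<otimes> z \<otimes> inv a 0"
        using c a zz by (intro conj_unique)
      then show ?thesis
        using c(3) zz r a bc by (simp add: below_iff rsupp_conj)
    qed
  qed
qed

text \<open>The generators held by \<open>v\<close> are not assumed to have small supports. What
  matters is that every code is realised, that all realisations satisfy the reference diagram, and
  that realisations interpolate; choosing one for each code gives a basis matching
  \<open>b\<close>.\<close>

lemma conjugate_if_codes_match:
  assumes a: "\<And>i. a i \<in> carrier G" and b: "interpolating b"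
    and v: "\<And>i. v i \<in> carrier G" and cm: "codes_match G N a b v"
  shows "conjugate_in G (v 0) (a 0)"
proof -
  have bc: "b i \<in> carrier G" "b i \<noteq> \<one>" for i
    using b by (auto simp: interpolating_def)
  have "\<exists>z. z \<in> carrier G \<and> z \<noteq> \<one> \<and> has_code G N a b i z v" for i
    using cm unfolding codes_match_def by blast
  then obtain z where z: "\<And>i. z i \<in> carrier G" "\<And>i. z i \<noteq> \<one>" "\<And>i. has_code G N a b i (z i) v"
    by metis
  have diag: "alg_below G y y' \<longleftrightarrow> alg_below G (b i) (b j)" "alg_inside G y y' \<longleftrightarrow> alg_inside G (b i) (b j)"
    if "y \<in> carrier G" "y' \<in> carrier G" "has_code G N a b i y v" "has_code G N a b j y' v" for y y' i j
    using cm that unfolding codes_match_def by blast+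
  have act: "alg_below G c y'"
    if "y \<in> carrier G" "y' \<in> carrier G" "has_code G N a b i y v" "has_code G N a b j y' v"
      "c \<in> carrier G" "c \<otimes> v 0 = v 0 \<otimes> y" "alg_below G (a 0 \<otimes> b i \<otimes> inv a 0) (b j)" for y y' i j c
    using cm that unfolding codes_match_def by blast
  have "interpolating z"
    unfolding interpolating_def
  proof (intro conjI allI ballI impI)
    show "z i \<in> carrier G" "z i \<noteq> \<one>" for i
      using z by auto
    fix x y assume xy: "x \<in> carrier G" "y \<in> carrier G" "alg_inside G x y"
    then obtain i y' where y': "y' \<in> carrier G" "has_code G N a b i y' v" "alg_below G x y'" "alg_below G y' y"
      using cm unfolding codes_match_def by blast
    \<comment> \<open>The diagram clause for the pair of indices \<open>(i, i)\<close> makes any two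
      realisations of one code mutually \<open>alg_below\<close>, so the chosen \<open>z i\<close>
      can replace \<open>y'\<close>.\<close>
    have "alg_below G y' (z i)" "alg_below G (z i) y'"
      using diag(1)[OF y'(1) z(1) y'(2) z(3)] diag(1)[OF z(1) y'(1) z(3) y'(2)] bc by (auto simp: below_iff)
    then have "alg_below G x (z i) \<and> alg_below G (z i) y"
      using xy y' z by (auto simp: below_iff)
    then show "\<exists>i. alg_below G x (z i) \<and> alg_below G (z i) y"
      by blast
  qed
  then have "matching b z"
    using b diag[OF z(1) z(1) z(3) z(3)] by (simp add: matching_def)
  then show ?thesis
  proof (rule matching_conjugate)
    show "a 0 \<in> carrier G" "v 0 \<in> carrier G"
      using a v by auto
    fix i j assume "alg_below G (a 0 \<otimes> b i \<otimes> inv a 0) (b j)"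
    moreover have "v 0 \<otimes> z i \<otimes> inv v 0 \<otimes> v 0 = v 0 \<otimes> z i"
      using z v by (simp add: m_assoc)
    ultimately show "alg_below G (v 0 \<otimes> z i \<otimes> inv v 0) (z j)"
      using act[OF z(1) z(1) z(3) z(3)] z v by simp
  qed
qed

lemma conjugacy_class_definable:
  assumes ne: "topspace M \<noteq> {}" and g: "g \<in> carrier G"
  shows "\<exists>\<psi>. fvars \<psi> \<subseteq> {0} \<and> (\<forall>h\<in>carrier G. sat1 G \<psi> h \<longleftrightarrow> conjugate_in G h g)"
proof -
  obtain P where P: "finite P" "P \<subseteq> carrier G"
    "\<And>U. openin M U \<Longrightarrow> U \<noteq> {} \<Longrightarrow> \<exists>w\<in>generate G P. w \<noteq> \<one> \<and> supp M w \<subseteq> U"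
    using pi_base_generators by metis
  obtain N a where a: "\<And>i. a i \<in> carrier G" "a 0 = g"
    "\<And>w. w \<in> generate G P \<Longrightarrow> \<exists>t. tvars t \<subseteq> {1..N} \<and> tval G a t = w"
    using generate_terms[OF P(1,2) g] by metis
  have dense: "\<exists>t. tvars t \<subseteq> {1..N} \<and> tval G a t \<noteq> \<one> \<and> supp M (tval G a t) \<subseteq> U"
    if "openin M U" "U \<noteq> {}" for U
    using P(3)[OF that] a(3) by metis
  obtain b :: "nat \<Rightarrow> 'a \<Rightarrow> 'a" where b: "\<forall>i. b i \<in> carrier G \<and> b i \<noteq> \<one>"
    "\<forall>K \<Omega>. compactin M K \<and> openin M \<Omega> \<and> K \<subseteq> \<Omega> \<and> \<Omega> \<noteq> {} \<longrightarrow>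
       (\<exists>i. K \<subseteq> rsupp (b i) \<and> supp M (b i) \<subseteq> \<Omega>)"
    using coded_basis[OF ne, folded rsupp_def] by blast
  have "interpolating b"
    unfolding interpolating_def
  proof (intro conjI allI ballI impI)
    fix x y assume xy: "x \<in> carrier G" "y \<in> carrier G" "alg_inside G x y"
    \<comment> \<open>\<open>inside_compact\<close> supplies the compact set and its inclusion in
      \<open>rsupp y\<close>; its last conclusion makes \<open>rsupp y\<close> nonempty, as the
      choice of \<open>b\<close> requires.\<close>
    have "\<exists>i. M closure_of supp M x \<subseteq> rsupp (b i) \<and> supp M (b i) \<subseteq> rsupp y"
      by (rule b(2)[rule_format])
        (use inside_compact[OF xy] openin_rsupp rsupp_ne[OF xy(2)] in \<open>intro conjI; simp\<close>)
    then obtain i where i: "M closure_of supp M x \<subseteq> rsupp (b i)" "supp M (b i) \<subseteq> rsupp y"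
      by blast
    have "alg_below G x (b i)"
      using xy(1) b(1) subset_trans[OF closure_of_subset[OF supp_subset] i(1)] by (intro below_if_supp) auto
    moreover have "alg_below G (b i) y"
      using i(2) xy(2) b(1) by (intro below_if_supp) auto
    ultimately show "\<exists>i. alg_below G x (b i) \<and> alg_below G (b i) y"
      by blast
  qed (use b in auto)
  note b = this
  let ?P = "\<lambda>v. \<exists>w. (\<forall>i. w i \<in> carrier G) \<and> (\<forall>i<1. w i = v i) \<and> codes_match G N a b w"
  obtain \<psi> where \<psi>: "fvars \<psi> \<subseteq> {..<1}" "\<And>v. (\<forall>i. v i \<in> carrier G) \<Longrightarrow> sat G \<psi> v = ?P v"
    using definable_ex_tuple[OF definable_codes_match[of G N a b]] unfolding definable_def by metis
  have sat1: "sat1 G \<psi> h \<longleftrightarrow> (\<exists>w. (\<forall>i. w i \<in> carrier G) \<and> w 0 = h \<and> codes_match G N a b w)"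
    if "h \<in> carrier G" for h
    using that \<psi>(2)[of "\<lambda>_. h"] by (simp add: sat1_def)
  have "sat1 G \<psi> h" if h: "h \<in> carrier G" "conjugate_in G h g" for h
  proof -
    obtain k where k: "k \<in> carrier G" "h = k \<otimes> g \<otimes> inv k"
      using h(2) unfolding conjugate_in_def by blast
    \<comment> \<open>This inner automorphism sends \<open>g\<close> to \<open>h\<close>, so the
      formula, verified at \<open>g\<close>, holds at \<open>h\<close>.\<close>
    define \<sigma> where "\<sigma> = (\<lambda>x. k \<otimes> x \<otimes> inv k)"
    have cancel: "inv k \<otimes> (k \<otimes> y) = y" "k \<otimes> (inv k \<otimes> y) = y" if "y \<in> carrier G" for y
      using k(1) that by (simp_all flip: m_assoc)
    have "\<sigma> \<in> hom G G"
      using k(1) by (intro homI) (auto simp: \<sigma>_def m_assoc cancel)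
    moreover have "bij_betw \<sigma> (carrier G) (carrier G)"
      using k(1) by (intro bij_betw_byWitness[where f' = "\<lambda>x. inv k \<otimes> x \<otimes> k"])
        (auto simp: \<sigma>_def m_assoc cancel)
    ultimately have "sat G \<psi> (\<lambda>i. \<sigma> ((\<lambda>_. g) i)) = sat G \<psi> (\<lambda>_. g)"
      using g is_group by (intro sat_automorphism) auto
    moreover have "sat1 G \<psi> g"
      using sat1[OF g] a codes_match_self[OF a(1) b dense] by blast
    ultimately show ?thesis
      using k(2) by (simp add: sat1_def \<sigma>_def)
  qed
  moreover have "conjugate_in G h g" if h: "h \<in> carrier G" "sat1 G \<psi> h" for h
  proof -
    obtain w where "\<forall>i. w i \<in> carrier G" "w 0 = h" "codes_match G N a b w"
      using h(2) unfolding sat1[OF h(1)] by blast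
    then show ?thesis
      using conjugate_if_codes_match[of a b w N] a(1,2) b by simp
  qed
  moreover have "fvars \<psi> \<subseteq> {0}"
    using \<psi>(1) by auto
  ultimately show ?thesis
    by blast
qed

end

theorem theorem1p9:
  fixes M :: "'a topology" and g :: "'a \<Rightarrow> 'a"
  assumes "connected_manifold M"
    and "g \<in> carrier (Homeo M)"
  shows "\<exists>\<psi>. fvars \<psi> \<subseteq> {0} \<and>
           (\<forall>h\<in>carrier (Homeo M). sat1 (Homeo M) \<psi> h \<longleftrightarrow> conjugate_in (Homeo M) h g)"
proof (cases "topspace M = {}")
  case True
  \<comment> \<open>Over the empty space there is only one extensional function; the group is
    trivial and a valid equation defines its single class.\<close>
  have "conjugate_in (Homeo M) h g" if "h \<in> carrier (Homeo M)" for h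
  proof -
    interpret group "Homeo M"
      by (rule group_Homeo)
    have eq: "x = y" if "x \<in> carrier (Homeo M)" "y \<in> carrier (Homeo M)" for x y
      using that True by (intro extensionalityI[of x "{}"]) (auto simp: Homeo_def)
    show ?thesis
      unfolding conjugate_in_def using that assms(2) eq by (meson inv_closed m_closed)
  qed
  then show ?thesis
    by (intro exI[of _ "Eq One One"]) (auto simp: sat1_def)
next
  case False
  obtain n where n: "n > 0" "locally_Euclidean_space n M"
    using assms(1) unfolding connected_manifold_def by blast
  interpret manifold M "Homeo M" n
    using assms(1) n by unfold_locales (auto simp: connected_manifold_def)
  show ?thesis
    using conjugacy_class_definable[OF False assms(2)] .
qed

end
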